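(* Let $G$ be a group, let $\mathcal{L}$ be an irreducible $G$-module (a finite-dimensional complex vector space with a linear $G$-action), and let $V \subseteq \mathcal{L}$ be an irreducible affine cone of dimension $N \geq 1$. If $V$ is closed under the $G$-action (i.e. $gv \in V$ for all $g \in G$, $v \in V$), then the following hold. (1) $V$ is $m$-nondefective for all positive integers $m \leq \frac{\dim \mathcal{L}}{N} - N$. (2) The generic rank $m^{\circ}$ with respect to $V$ satisfies $\frac{\dim \mathcal{L}}{N} \leq m^{\circ} \leq \frac{\dim \mathcal{L}}{N} + N$.
   Context: Everything is over $\mathbb{C}$. An affine cone in $\mathcal{L}$ is a Zariski closed subset $V \subseteq \mathcal{L}$ with $\mathbb{C}\cdot V \subseteq V$; it is irreducible as a variety if it is not the union of two proper closed subsets. A $G$-module $\mathcal{L}$ is irreducible if it is nonzero and contains no proper nonzero $G$-submodule. The $m$-th secant variety $\sigma_m V$ is the Zariski closure of $\{x_1 + \ldots + x_m \mid x_1,\ldots,x_m \in V\}$ in $\mathcal{L}$. The variety $V$ (of affine dimension $N$) is called $m$-nondefective if $\dim \sigma_m V = \min\{mN, \dim \mathcal{L}\}$. The generic rank $m^{\circ}$ of $\mathcal{L}$ with respect to $V$ is the smallest $m$ such that $\sigma_m V = \mathcal{L}$. *)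

theory Defs
  imports "HOL-Analysis.Analysis" "HOL-Algebra.Group_Action"
begin

text \<open>
  A complex vector space is given by a type \<open>'b\<close> with its additive group structure and an explicit
  scalar multiplication \<open>sc :: complex \<Rightarrow> 'b \<Rightarrow> 'b\<close>, as in \<^theory>\<open>HOL.Vector_Spaces\<close>.
  Regular functions are described without coordinates: they form the algebra generated
  by the linear functionals.
\<close>

inductive_set polynomial_functions ::
    "(complex \<Rightarrow> 'b \<Rightarrow> 'b) \<Rightarrow> ('b::ab_group_add \<Rightarrow> complex) set"
  for sc :: "complex \<Rightarrow> 'b \<Rightarrow> 'b" where
  const: "(\<lambda>x. c) \<in> polynomial_functions sc"
| functional: "Vector_Spaces.linear sc (*) f \<Longrightarrow> f \<in> polynomial_functions sc"
| add: "p \<in> polynomial_functions sc \<Longrightarrow> q \<in> polynomial_functions sc \<Longrightarrow>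
    (\<lambda>x. p x + q x) \<in> polynomial_functions sc"
| mult: "p \<in> polynomial_functions sc \<Longrightarrow> q \<in> polynomial_functions sc \<Longrightarrow>
    (\<lambda>x. p x * q x) \<in> polynomial_functions sc"

definition zero_locus :: "('b \<Rightarrow> complex) set \<Rightarrow> 'b set" where
  "zero_locus P = {x. \<forall>p\<in>P. p x = 0}"

definition zariski :: "(complex \<Rightarrow> 'b \<Rightarrow> 'b) \<Rightarrow> 'b::ab_group_add topology" where
  "zariski sc = topology (\<lambda>U. \<exists>P \<subseteq> polynomial_functions sc. - U = zero_locus P)"

lemma istopology_zariski:
  "istopology (\<lambda>U. \<exists>P \<subseteq> polynomial_functions sc. - U = zero_locus P)"
  unfolding istopology_def
proof (intro conjI allI impI)
  fix S T
  assume "\<exists>P \<subseteq> polynomial_functions sc. - S = zero_locus P"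
    and "\<exists>P \<subseteq> polynomial_functions sc. - T = zero_locus P"
  then obtain P Q where P: "P \<subseteq> polynomial_functions sc" "- S = zero_locus P"
    and Q: "Q \<subseteq> polynomial_functions sc" "- T = zero_locus Q"
    by blast
  define R where "R = (\<lambda>(p, q) x. p x * q x) ` (P \<times> Q)"
  have "R \<subseteq> polynomial_functions sc"
  proof
    fix r assume "r \<in> R"
    then obtain p q where r: "r = (\<lambda>x. p x * q x)" and pq: "p \<in> P" "q \<in> Q"
      by (auto simp: R_def)
    have "p \<in> polynomial_functions sc" "q \<in> polynomial_functions sc"
      using pq P(1) Q(1) by (simp_all add: subset_iff)
    then show "r \<in> polynomial_functions sc"
      unfolding r by (rule polynomial_functions.mult)
  qed
  moreover have "zero_locus R = zero_locus P \<union> zero_locus Q"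
    by (auto simp: R_def zero_locus_def)
  ultimately show "\<exists>R \<subseteq> polynomial_functions sc. - (S \<inter> T) = zero_locus R"
    by (intro exI[of _ R] conjI) (simp_all only: Compl_Int P(2) Q(2))
next
  fix K
  assume "\<forall>U\<in>K. \<exists>P \<subseteq> polynomial_functions sc. - U = zero_locus P"
  then obtain F where F: "\<And>U. U \<in> K \<Longrightarrow> F U \<subseteq> polynomial_functions sc"
    "\<And>U. U \<in> K \<Longrightarrow> - U = zero_locus (F U)"
    unfolding bchoice_iff by blast
  have "- \<Union>K = (\<Inter>U\<in>K. zero_locus (F U))"
    using F(2) by auto
  also have "\<dots> = zero_locus (\<Union>U\<in>K. F U)"
    by (auto simp: zero_locus_def)
  finally show "\<exists>P \<subseteq> polynomial_functions sc. - \<Union>K = zero_locus P"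
    using F(1) by (intro exI[of _ "\<Union>U\<in>K. F U"] conjI UN_least)
qed

lemma openin_zariski:
  "openin (zariski sc) U \<longleftrightarrow> (\<exists>P \<subseteq> polynomial_functions sc. - U = zero_locus P)"
  by (simp only: zariski_def topology_inverse'[OF istopology_zariski])

lemma topspace_zariski [simp]: "topspace (zariski sc) = UNIV"
proof -
  have "openin (zariski sc) UNIV"
    unfolding openin_zariski
    by (intro exI[of _ "{\<lambda>x. 1}"] conjI) (simp_all add: zero_locus_def polynomial_functions.const)
  then show ?thesis
    using openin_subset by blast
qed

lemma closedin_zariski:
  "closedin (zariski sc) Z \<longleftrightarrow> (\<exists>P \<subseteq> polynomial_functions sc. Z = zero_locus P)"
  by (simp add: closedin_def openin_zariski Compl_eq_Diff_UNIV [symmetric])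

text \<open>The empty space is not irreducible; this matters for the count in \<open>krull_dim\<close>.\<close>

definition irreducible_space :: "'a topology \<Rightarrow> bool" where
  "irreducible_space X \<longleftrightarrow> topspace X \<noteq> {} \<and>
     \<not> (\<exists>A B. closedin X A \<and> closedin X B \<and> A \<subset> topspace X \<and> B \<subset> topspace X \<and>
          A \<union> B = topspace X)"

text \<open>
  Supremum of the lengths \<open>n\<close> of chains \<open>Z 0 \<subset> \<dots> \<subset> Z n\<close> of irreducible closed subsets, with value
  \<open>\<infinity>\<close> if these are unbounded; the empty space has dimension \<open>0\<close>.
\<close>

definition krull_dim :: "'a topology \<Rightarrow> enat" where
  "krull_dim X = Sup {enat n | n. \<exists>Z :: nat \<Rightarrow> 'a set.
     (\<forall>i\<le>n. closedin X (Z i) \<and> irreducible_space (subtopology X (Z i))) \<and>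
     (\<forall>i<n. Z i \<subset> Z (Suc i))}"

definition variety_dim :: "(complex \<Rightarrow> 'b \<Rightarrow> 'b) \<Rightarrow> 'b::ab_group_add set \<Rightarrow> enat" where
  "variety_dim sc V = krull_dim (subtopology (zariski sc) V)"

definition irreducible_variety :: "(complex \<Rightarrow> 'b \<Rightarrow> 'b) \<Rightarrow> 'b::ab_group_add set \<Rightarrow> bool" where
  "irreducible_variety sc V \<longleftrightarrow>
     closedin (zariski sc) V \<and> irreducible_space (subtopology (zariski sc) V)"

definition affine_cone :: "(complex \<Rightarrow> 'b \<Rightarrow> 'b) \<Rightarrow> 'b::ab_group_add set \<Rightarrow> bool" where
  "affine_cone sc V \<longleftrightarrow> closedin (zariski sc) V \<and> (\<forall>c. \<forall>v\<in>V. sc c v \<in> V)"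

definition secant_variety ::
    "(complex \<Rightarrow> 'b \<Rightarrow> 'b) \<Rightarrow> nat \<Rightarrow> 'b::ab_group_add set \<Rightarrow> 'b set" where
  "secant_variety sc m V =
     zariski sc closure_of {\<Sum>i<m. x i | x. \<forall>i<m. x i \<in> V}"

definition nondefective ::
    "(complex \<Rightarrow> 'b \<Rightarrow> 'b) \<Rightarrow> nat \<Rightarrow> 'b::ab_group_add set \<Rightarrow> bool" where
  "nondefective sc m V \<longleftrightarrow>
     variety_dim sc (secant_variety sc m V) =
       min (enat m * variety_dim sc V) (enat (vector_space.dim sc UNIV))"

text \<open>
  \<open>generic_rank\<close> is meaningful only if some secant variety of \<open>V\<close> is the whole space. The value
  \<open>m = 0\<close> needs no exclusion for a nonzero space, since the \<open>0\<close>-th secant variety is \<open>{0}\<close>.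
\<close>

definition generic_rank :: "(complex \<Rightarrow> 'b \<Rightarrow> 'b) \<Rightarrow> 'b::ab_group_add set \<Rightarrow> nat" where
  "generic_rank sc V = (LEAST m. secant_variety sc m V = UNIV)"

definition linear_action ::
    "('g, 'x) monoid_scheme \<Rightarrow> (complex \<Rightarrow> 'b \<Rightarrow> 'b) \<Rightarrow> ('g \<Rightarrow> 'b::ab_group_add \<Rightarrow> 'b) \<Rightarrow> bool" where
  "linear_action G sc \<phi> \<longleftrightarrow>
     group_action G UNIV \<phi> \<and> (\<forall>g\<in>carrier G. Vector_Spaces.linear sc sc (\<phi> g))"

definition invariant_under :: "('g, 'x) monoid_scheme \<Rightarrow> ('g \<Rightarrow> 'b \<Rightarrow> 'b) \<Rightarrow> 'b set \<Rightarrow> bool" where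
  "invariant_under G \<phi> W \<longleftrightarrow> (\<forall>g\<in>carrier G. \<forall>w\<in>W. \<phi> g w \<in> W)"

definition irreducible_module ::
    "('g, 'x) monoid_scheme \<Rightarrow> (complex \<Rightarrow> 'b \<Rightarrow> 'b) \<Rightarrow> ('g \<Rightarrow> 'b::ab_group_add \<Rightarrow> 'b) \<Rightarrow> bool" where
  "irreducible_module G sc \<phi> \<longleftrightarrow>
     linear_action G sc \<phi> \<and> (UNIV :: 'b set) \<noteq> {0} \<and>
     (\<forall>W. module.subspace sc W \<and> invariant_under G \<phi> W \<longrightarrow> W = {0} \<or> W = UNIV)"

end

theory Submission
  imports Defs "HOL-Computational_Algebra.Fundamental_Theorem_Algebra"
begin

text \<open>
  Let \<open>r(m)\<close> be the maximal dimension of \<open>W = T\<^sub>1 + \<dots> + T\<^sub>m\<close>, the sum of the tangent spaces of \<open>V\<close>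
  at \<open>m\<close> regular points. It is attained at generic points, it bounds \<open>dim \<sigma>\<^sub>m V\<close> from below, and its
  increments are at most \<open>N\<close> and nonincreasing. If two consecutive increments \<open>r(m+1) - r(m)\<close> and
  \<open>r(m+2) - r(m+1)\<close> agree and are smaller than \<open>N\<close>, then for a generic further point the intersection
  of its tangent space with \<open>W\<close> is nonzero and does not change when the \<open>m\<close> points are exchanged one
  after the other. So the vectors lying in \<open>W\<close> for generic points form a nonzero subspace, which is
  invariant under \<open>G\<close>, hence everything, and \<open>r(m) = dim L\<close>. Consequently the increments are \<open>N\<close> up
  to some point and then decrease strictly until \<open>r\<close> reaches \<open>dim L\<close>, which gives all estimates.

  Krull dimension is compared with generic tangent dimension through algebraically independent
  functions. A chain of primes of length \<open>k\<close> yields \<open>k\<close> independent functions. Conversely a level set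
  of one of \<open>k\<close> independent functions contains an irreducible variety on which the others stay
  independent, because otherwise uncountably many level sets would give a linear dependence and
  thereby an algebraic relation; the Nullstellensatz follows by the same argument. Cutting along such
  level sets until the tangent space vanishes bounds the number of independent functions by the
  tangent dimension.
\<close>

section \<open>Polynomial functions\<close>

text \<open>Write n for dim L. If the increment first drops below N at k points, then k * N \<le> n,
  and the increments from there on are at most N - 1, N - 2 and so on, so r(k + N - 1) = n; this is
  the source of the upper bound for the generic rank. These last steps contribute at most (N - 1)^2,
  so n \<le> k * N + (N - 1)^2, and every m with m * N + N * N \<le> n satisfies m \<le> k, whence
  r(m) = m * N.

  Between tangent sums and secant varieties an inclusion is at hand, one half of Terracini's lemma:
  the tangent sum lies in the tangent space of the secant variety at the sum of the points. The
  opposite estimate, dimension at most m * N, comes from viewing a secant variety as a join with V.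
  The two estimates meet when r(m) = m * N; when r(m) = n, the lower one meets the dimension of the
  whole space.

  Conditions on several points are imposed one point at a time, each generic relative to the
  preceding ones. This reduces them to the irreducibility of V and gives a description of generic
  vectors that every symmetry of V respects.\<close>

locale complex_fd_space = finite_dimensional_vector_space sc Basis
  for sc :: "complex \<Rightarrow> 'b::ab_group_add \<Rightarrow> 'b" and Basis :: "'b set"
begin

abbreviation R :: "('b \<Rightarrow> complex) set" where "R \<equiv> polynomial_functions sc"

abbreviation coord :: "'b \<Rightarrow> 'b \<Rightarrow> complex" where "coord b x \<equiv> representation Basis x b"

lemma linear_coord: "Vector_Spaces.linear sc (*) (coord b)"
  using linear_representation[OF independent_Basis span_Basis] .

lemma coord_in_R: "coord b \<in> R"
  by (rule polynomial_functions.functional[OF linear_coord])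

lemma coord_simps:
  "coord b (x + y) = coord b x + coord b y" "coord b (x - y) = coord b x - coord b y"
  "coord b (sc c x) = c * coord b x" "coord b 0 = 0"
  using independent_Basis span_Basis
  by (simp_all add: representation_add representation_diff representation_scale representation_zero)

lemma coord_sum: "coord b (\<Sum>i\<in>I. f i) = (\<Sum>i\<in>I. coord b (f i))"
  by (induction I rule: infinite_finite_induct) (simp_all add: coord_simps)

lemma sum_coord: "(\<Sum>b\<in>Basis. sc (coord b x) b) = x"
  by (rule sum_representation_eq[OF independent_Basis]) (simp_all add: finite_Basis span_Basis)

lemma linear_functional_coord:
  assumes "Vector_Spaces.linear sc (*) f"
  shows "f x = (\<Sum>b\<in>Basis. coord b x * f b)"
proof -
  interpret f: Vector_Spaces.linear sc "(*)" f by fact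
  have "f x = f (\<Sum>b\<in>Basis. sc (coord b x) b)" by (simp only: sum_coord)
  also have "\<dots> = (\<Sum>b\<in>Basis. coord b x * f b)" by (simp only: f.sum f.scale)
  finally show ?thesis .
qed

lemma R_sum: "(\<And>i. i \<in> I \<Longrightarrow> p i \<in> R) \<Longrightarrow> (\<lambda>x. \<Sum>i\<in>I. p i x) \<in> R"
  by (induction I rule: infinite_finite_induct)
     (auto intro: polynomial_functions.const polynomial_functions.add)

lemma R_cmult: "p \<in> R \<Longrightarrow> (\<lambda>x. c * p x) \<in> R"
  by (rule polynomial_functions.mult[OF polynomial_functions.const])

lemma R_diff: "p \<in> R \<Longrightarrow> q \<in> R \<Longrightarrow> (\<lambda>x. p x - q x) \<in> R"
  using polynomial_functions.add[OF _ R_cmult[of q "-1"]] by simp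

lemma R_power: "p \<in> R \<Longrightarrow> (\<lambda>x. p x ^ k) \<in> R"
  by (induction k) (auto intro: polynomial_functions.const polynomial_functions.mult)

lemmas R_intros = polynomial_functions.const polynomial_functions.functional
  polynomial_functions.add polynomial_functions.mult R_sum R_cmult R_diff R_power coord_in_R

section \<open>Polynomial functions of bounded degree\<close>

definition monomials :: "nat \<Rightarrow> ('b \<Rightarrow> complex) set" where
  "monomials s = (\<lambda>bs x. \<Prod>b\<leftarrow>bs. coord b x) ` {bs. set bs \<subseteq> Basis \<and> length bs \<le> s}"

lemma finite_monomials: "finite (monomials s)"
  unfolding monomials_def by (intro finite_imageI finite_lists_length_le finite_Basis)

lemma monomials_mono: "s \<le> t \<Longrightarrow> monomials s \<subseteq> monomials t"
  unfolding monomials_def by auto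

lemma monomials_mult:
  assumes "e \<in> monomials s" "e' \<in> monomials t"
  shows "(\<lambda>x. e x * e' x) \<in> monomials (s + t)"
proof -
  obtain bs bs' where *: "set bs \<subseteq> Basis" "length bs \<le> s" "e = (\<lambda>x. \<Prod>b\<leftarrow>bs. coord b x)"
    "set bs' \<subseteq> Basis" "length bs' \<le> t" "e' = (\<lambda>x. \<Prod>b\<leftarrow>bs'. coord b x)"
    using assms unfolding monomials_def by auto
  have "(\<lambda>x. e x * e' x) = (\<lambda>x. \<Prod>b\<leftarrow>bs @ bs'. coord b x)"
    using * by (auto simp: fun_eq_iff)
  moreover have "bs @ bs' \<in> {bs. set bs \<subseteq> Basis \<and> length bs \<le> s + t}" using * by auto
  ultimately show ?thesis unfolding monomials_def by (rule image_eqI)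
qed

definition fin_comb :: "('b \<Rightarrow> complex) set \<Rightarrow> ('b \<Rightarrow> complex) \<Rightarrow> bool" where
  "fin_comb E p \<longleftrightarrow> (\<exists>\<gamma>. \<forall>x. p x = (\<Sum>e\<in>E. \<gamma> e * e x))"

lemma fin_comb_mono:
  assumes "fin_comb E p" "E \<subseteq> E'" "finite E'"
  shows "fin_comb E' p"
proof -
  obtain \<gamma> where \<gamma>: "\<And>x. p x = (\<Sum>e\<in>E. \<gamma> e * e x)" using assms(1) unfolding fin_comb_def by auto
  have "p x = (\<Sum>e\<in>E'. (if e \<in> E then \<gamma> e else 0) * e x)" for x
    unfolding \<gamma> using assms by (intro sum.mono_neutral_cong_left) auto
  then show ?thesis unfolding fin_comb_def by (intro exI[of _ "\<lambda>e. if e \<in> E then \<gamma> e else 0"]) simp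
qed

lemma fin_comb_add:
  assumes "fin_comb E p" "fin_comb E q"
  shows "fin_comb E (\<lambda>x. p x + q x)"
proof -
  obtain \<gamma> where \<gamma>: "\<And>x. p x = (\<Sum>e\<in>E. \<gamma> e * e x)" using assms(1) unfolding fin_comb_def by auto
  obtain \<delta> where \<delta>: "\<And>x. q x = (\<Sum>e\<in>E. \<delta> e * e x)" using assms(2) unfolding fin_comb_def by auto
  have "p x + q x = (\<Sum>e\<in>E. (\<gamma> e + \<delta> e) * e x)" for x
    unfolding \<gamma> \<delta> by (simp add: sum.distrib distrib_right)
  then show ?thesis unfolding fin_comb_def by (intro exI[of _ "\<lambda>e. \<gamma> e + \<delta> e"]) simp
qed

lemma fin_comb_cmult:
  assumes "fin_comb E p"
  shows "fin_comb E (\<lambda>x. c * p x)"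
proof -
  obtain \<gamma> where \<gamma>: "\<And>x. p x = (\<Sum>e\<in>E. \<gamma> e * e x)" using assms(1) unfolding fin_comb_def by auto
  have "c * p x = (\<Sum>e\<in>E. (c * \<gamma> e) * e x)" for x
    unfolding \<gamma> by (simp add: sum_distrib_left mult.assoc)
  then show ?thesis unfolding fin_comb_def by (intro exI[of _ "\<lambda>e. c * \<gamma> e"]) simp
qed

lemma fin_comb_base: "finite E \<Longrightarrow> e \<in> E \<Longrightarrow> fin_comb E e"
  unfolding fin_comb_def
  by (rule exI[of _ "\<lambda>f. if f = e then 1 else 0"]) (simp add: if_distrib[of "\<lambda>c. c * _"] cong: if_cong)

lemma fin_comb_sum: "(\<And>i. i \<in> I \<Longrightarrow> fin_comb E (p i)) \<Longrightarrow> fin_comb E (\<lambda>x. \<Sum>i\<in>I. p i x)"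
proof (induction I rule: infinite_finite_induct)
  case (insert i I)
  then show ?case using fin_comb_add[of E "p i"] by simp
qed (auto simp: fin_comb_def intro: exI[of _ "\<lambda>_. 0"])

lemma fin_comb_mult:
  assumes "fin_comb (monomials s) p" "fin_comb (monomials t) q"
  shows "fin_comb (monomials (s + t)) (\<lambda>x. p x * q x)"
proof -
  obtain \<gamma> where \<gamma>: "\<And>x. p x = (\<Sum>e\<in>monomials s. \<gamma> e * e x)"
    using assms(1) unfolding fin_comb_def by auto
  obtain \<delta> where \<delta>: "\<And>x. q x = (\<Sum>e\<in>monomials t. \<delta> e * e x)"
    using assms(2) unfolding fin_comb_def by auto
  have eq: "(\<lambda>x. p x * q x) =
    (\<lambda>x. \<Sum>e\<in>monomials s. \<Sum>e'\<in>monomials t. (\<gamma> e * \<delta> e') * (e x * e' x))"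
    unfolding \<gamma> \<delta> sum_product by (intro ext sum.cong refl) (simp add: mult_ac)
  show ?thesis unfolding eq
    by (intro fin_comb_sum fin_comb_cmult fin_comb_base finite_monomials monomials_mult)
qed

lemma R_fin_comb: "p \<in> R \<Longrightarrow> \<exists>s. fin_comb (monomials s) p"
proof (induction rule: polynomial_functions.induct)
  case (const c)
  have "(\<lambda>x. 1) \<in> monomials 0" unfolding monomials_def by (auto simp: image_iff)
  from fin_comb_cmult[OF fin_comb_base[OF finite_monomials this], of c] show ?case by auto
next
  case (functional f)
  have *: "coord b \<in> monomials 1" if "b \<in> Basis" for b
    unfolding monomials_def by (rule image_eqI[of _ _ "[b]"]) (auto simp: that)
  have eq: "f = (\<lambda>x. \<Sum>b\<in>Basis. f b * coord b x)"
    by (rule ext, subst linear_functional_coord[OF functional]) (simp add: mult.commute)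
  have "fin_comb (monomials 1) (\<lambda>x. \<Sum>b\<in>Basis. f b * coord b x)"
    by (rule fin_comb_sum, rule fin_comb_cmult, rule fin_comb_base[OF finite_monomials *])
  then show ?case using eq by metis
next
  case (add p q)
  then obtain s t where "fin_comb (monomials s) p" "fin_comb (monomials t) q" by auto
  then have "fin_comb (monomials (s + t)) p" "fin_comb (monomials (s + t)) q"
    by (auto intro: fin_comb_mono[OF _ monomials_mono finite_monomials])
  then show ?case using fin_comb_add by blast
next
  case (mult p q)
  then show ?case using fin_comb_mult by blast
qed

end

text \<open>Gaussian elimination on one coordinate \<open>e\<close> at a time, with a pivot row
  \<open>k\<close>. The rows are an indexed family rather than a set, so that equal rows with
  different indices count separately.\<close>

lemma nontrivial_relation:
  fixes \<gamma> :: "'i \<Rightarrow> 'e \<Rightarrow> 'f::field"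
  assumes "finite E" "finite I" "card E < card I"
  shows "\<exists>\<alpha>. (\<exists>i\<in>I. \<alpha> i \<noteq> 0) \<and> (\<forall>e\<in>E. (\<Sum>i\<in>I. \<alpha> i * \<gamma> i e) = 0)"
  using assms
proof (induction E arbitrary: I \<gamma> rule: finite_induct)
  case empty
  then show ?case by (intro exI[of _ "\<lambda>_. 1"]) (auto simp: card_gt_0_iff)
next
  case (insert e E)
  show ?case
  proof (cases "\<exists>k\<in>I. \<gamma> k e \<noteq> 0")
    case False
    obtain \<alpha> where "\<exists>i\<in>I. \<alpha> i \<noteq> 0" "\<forall>e\<in>E. (\<Sum>i\<in>I. \<alpha> i * \<gamma> i e) = 0"
      using insert.IH[of I \<gamma>] insert.prems insert.hyps by auto
    then show ?thesis using False by (intro exI[of _ \<alpha>]) auto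
  next
    case True
    then obtain k where k: "k \<in> I" "\<gamma> k e \<noteq> 0" by auto
    define J where "J = I - {k}"
    define \<delta> where "\<delta> i e' = \<gamma> i e' - \<gamma> i e / \<gamma> k e * \<gamma> k e'" for i e'
    have J: "finite J" "card E < card J" "I = insert k J" "k \<notin> J"
      using insert.prems insert.hyps k unfolding J_def by auto
    obtain \<alpha> where \<alpha>: "\<exists>i\<in>J. \<alpha> i \<noteq> 0" "\<forall>e\<in>E. (\<Sum>i\<in>J. \<alpha> i * \<delta> i e) = 0"
      using insert.IH[of J \<delta>] J by auto
    \<comment> \<open>The coefficient of the pivot row collects the multiples of it that were
      subtracted in \<open>\<delta>\<close>.\<close>
    define \<beta> where "\<beta> = \<alpha>(k := - (\<Sum>i\<in>J. \<alpha> i * (\<gamma> i e / \<gamma> k e)))"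
    have sum_J: "(\<Sum>i\<in>J. \<beta> i * c i) = (\<Sum>i\<in>J. \<alpha> i * c i)" for c
      using J(4) by (intro sum.cong) (auto simp: \<beta>_def)
    have "(\<Sum>i\<in>I. \<beta> i * \<gamma> i e') = (\<Sum>i\<in>J. \<alpha> i * \<delta> i e')" for e'
      unfolding J(3) using J(1,4)
      by (simp add: sum_J)
        (simp add: \<beta>_def \<delta>_def sum_distrib_right sum_subtractf right_diff_distrib mult.assoc)
    moreover have "(\<Sum>i\<in>J. \<alpha> i * \<delta> i e) = 0" using k by (simp add: \<delta>_def)
    ultimately have "\<forall>e'\<in>insert e E. (\<Sum>i\<in>I. \<beta> i * \<gamma> i e') = 0" using \<alpha>(2) by auto
    moreover have "\<exists>i\<in>I. \<beta> i \<noteq> 0" using \<alpha>(1) J(3,4) by (auto simp: \<beta>_def)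
    ultimately show ?thesis by blast
  qed
qed

section \<open>Prime ideals of polynomial functions\<close>

context complex_fd_space
begin

definition ideal_R :: "('b \<Rightarrow> complex) set \<Rightarrow> bool" where
  "ideal_R P \<longleftrightarrow> P \<subseteq> R \<and> (\<lambda>x. 0) \<in> P \<and> (\<forall>p\<in>P. \<forall>q\<in>P. (\<lambda>x. p x + q x) \<in> P) \<and>
     (\<forall>p\<in>P. \<forall>q\<in>R. (\<lambda>x. p x * q x) \<in> P)"

definition prime_R :: "('b \<Rightarrow> complex) set \<Rightarrow> bool" where
  "prime_R P \<longleftrightarrow> ideal_R P \<and> (\<lambda>x. 1) \<notin> P \<and>
     (\<forall>p\<in>R. \<forall>q\<in>R. (\<lambda>x. p x * q x) \<in> P \<longrightarrow> p \<in> P \<or> q \<in> P)"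

lemma ideal_RD:
  assumes "ideal_R P"
  shows "p \<in> P \<Longrightarrow> p \<in> R" "(\<lambda>x. 0) \<in> P" "p \<in> P \<Longrightarrow> q \<in> P \<Longrightarrow> (\<lambda>x. p x + q x) \<in> P"
    "p \<in> P \<Longrightarrow> q \<in> R \<Longrightarrow> (\<lambda>x. p x * q x) \<in> P" "p \<in> P \<Longrightarrow> q \<in> R \<Longrightarrow> (\<lambda>x. q x * p x) \<in> P"
  using assms unfolding ideal_R_def by (auto simp: mult.commute)

lemma ideal_R_diff:
  assumes "ideal_R P" "p \<in> P" "q \<in> P"
  shows "(\<lambda>x. p x - q x) \<in> P"
  using ideal_RD(3)[OF assms(1,2) ideal_RD(5)[OF assms(1,3) polynomial_functions.const[of "-1"]]]
  by simp

lemma ideal_R_sum: "ideal_R P \<Longrightarrow> (\<And>i. i \<in> I \<Longrightarrow> p i \<in> P) \<Longrightarrow> (\<lambda>x. \<Sum>i\<in>I. p i x) \<in> P"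
  by (induction I rule: infinite_finite_induct) (auto simp: ideal_RD)

lemma prime_RD:
  assumes "prime_R P"
  shows "ideal_R P" "(\<lambda>x. 1) \<notin> P"
    "p \<in> R \<Longrightarrow> q \<in> R \<Longrightarrow> (\<lambda>x. p x * q x) \<in> P \<Longrightarrow> p \<in> P \<or> q \<in> P"
  using assms unfolding prime_R_def by auto

lemma prime_R_const:
  assumes "prime_R P" "(\<lambda>x. c) \<in> P"
  shows "c = 0"
proof (rule ccontr)
  assume "c \<noteq> 0"
  then show False
    using ideal_RD(4)[OF prime_RD(1)[OF assms(1)] assms(2) polynomial_functions.const[of "1/c"]]
      prime_RD(2)[OF assms(1)] by simp
qed

lemma prime_R_power: "prime_R P \<Longrightarrow> h \<in> R \<Longrightarrow> (\<lambda>x. h x ^ k) \<in> P \<Longrightarrow> h \<in> P"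
proof (induction k)
  case 0
  then show ?case using prime_RD(2) by auto
next
  case (Suc k)
  then show ?case using prime_RD(3)[OF Suc.prems(1), of h "\<lambda>x. h x ^ k"] by (auto intro: R_intros)
qed

lemma ideal_R_generated:
  assumes "ideal_R P" "t \<in> R"
  shows "ideal_R {\<lambda>x. p x + t x * g x | p g. p \<in> P \<and> g \<in> R}" (is "ideal_R ?I")
    and "P \<subseteq> {\<lambda>x. p x + t x * g x | p g. p \<in> P \<and> g \<in> R}"
    and "t \<in> {\<lambda>x. p x + t x * g x | p g. p \<in> P \<and> g \<in> R}"
proof -
  show P: "P \<subseteq> ?I"
  proof
    fix p assume "p \<in> P"
    then show "p \<in> ?I" by (intro CollectI exI[of _ p] exI[of _ "\<lambda>x. 0"]) (auto intro: R_intros)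
  qed
  show "t \<in> ?I"
    by (intro CollectI exI[of _ "\<lambda>x. 0"] exI[of _ "\<lambda>x. 1"]) (auto intro: R_intros ideal_RD assms)
  show "ideal_R ?I" unfolding ideal_R_def
  proof (intro conjI ballI)
    show "?I \<subseteq> R"
      using assms(2) ideal_RD(1)[OF assms(1)]
      by (auto intro: polynomial_functions.add polynomial_functions.mult)
    show "(\<lambda>x. 0) \<in> ?I" using P ideal_RD(2)[OF assms(1)] by auto
  next
    fix a b assume "a \<in> ?I" "b \<in> ?I"
    then obtain p g p' g' where *: "a = (\<lambda>x. p x + t x * g x)" "b = (\<lambda>x. p' x + t x * g' x)"
      "p \<in> P" "p' \<in> P" "g \<in> R" "g' \<in> R" by auto
    show "(\<lambda>x. a x + b x) \<in> ?I"
      by (intro CollectI exI[of _ "\<lambda>x. p x + p' x"] exI[of _ "\<lambda>x. g x + g' x"])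
         (auto simp: * algebra_simps intro: R_intros ideal_RD assms)
  next
    fix a q assume "a \<in> ?I" "q \<in> R"
    then obtain p g where *: "a = (\<lambda>x. p x + t x * g x)" "p \<in> P" "g \<in> R" by auto
    show "(\<lambda>x. a x * q x) \<in> ?I"
      by (intro CollectI exI[of _ "\<lambda>x. p x * q x"] exI[of _ "\<lambda>x. g x * q x"])
         (auto simp: * \<open>q \<in> R\<close> algebra_simps intro: R_intros ideal_RD assms)
  qed
qed

text \<open>Krull's argument: an ideal that is maximal among those missing a multiplicative set is
  prime. The last conclusion records the maximality itself, which the Nullstellensatz uses beyond
  primality.\<close>

lemma prime_R_avoiding:
  assumes I: "ideal_R I" "I \<inter> S = {}" and S: "S \<subseteq> R" "(\<lambda>x. 1) \<in> S"
    "\<And>p q. p \<in> S \<Longrightarrow> q \<in> S \<Longrightarrow> (\<lambda>x. p x * q x) \<in> S"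
  obtains P where "prime_R P" "I \<subseteq> P" "P \<inter> S = {}"
    "\<And>t. t \<in> R \<Longrightarrow> t \<notin> P \<Longrightarrow> \<exists>p\<in>P. \<exists>g\<in>R. (\<lambda>x. p x + t x * g x) \<in> S"
proof -
  define \<A> where "\<A> = {P. ideal_R P \<and> I \<subseteq> P \<and> P \<inter> S = {}}"
  have "\<exists>M\<in>\<A>. \<forall>X\<in>\<A>. M \<subseteq> X \<longrightarrow> X = M"
  proof (rule subset_Zorn_nonempty)
    show "\<A> \<noteq> {}" using I by (auto simp: \<A>_def)
    fix \<C> assume ne: "\<C> \<noteq> {}" and ch: "subset.chain \<A> \<C>"
    then have C: "\<And>P. P \<in> \<C> \<Longrightarrow> ideal_R P \<and> I \<subseteq> P \<and> P \<inter> S = {}"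
      by (auto simp: subset.chain_def \<A>_def)
    have tot: "P \<subseteq> Q \<or> Q \<subseteq> P" if "P \<in> \<C>" "Q \<in> \<C>" for P Q
      using ch that by (auto simp: subset_chain_def)
    have "ideal_R (\<Union>\<C>)" unfolding ideal_R_def
    proof (intro conjI ballI)
      show "\<Union>\<C> \<subseteq> R" using C ideal_RD(1) by blast
      show "(\<lambda>x. 0) \<in> \<Union>\<C>" using C ne ideal_RD(2) by blast
    next
      fix p q assume "p \<in> \<Union>\<C>" "q \<in> \<Union>\<C>"
      then obtain P Q where "p \<in> P" "q \<in> Q" "P \<in> \<C>" "Q \<in> \<C>" by auto
      then obtain P where "p \<in> P" "q \<in> P" "P \<in> \<C>" using tot by blast
      then show "(\<lambda>x. p x + q x) \<in> \<Union>\<C>" using C ideal_RD(3) by blast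
    next
      fix p q assume "p \<in> \<Union>\<C>" "q \<in> R"
      then show "(\<lambda>x. p x * q x) \<in> \<Union>\<C>" using C ideal_RD(4) by blast
    qed
    then show "\<Union>\<C> \<in> \<A>" using C ne by (fastforce simp: \<A>_def)
  qed
  from this obtain P where P: "ideal_R P" "I \<subseteq> P" "P \<inter> S = {}" and
    max: "\<And>Q. ideal_R Q \<Longrightarrow> P \<subseteq> Q \<Longrightarrow> Q \<inter> S = {} \<Longrightarrow> Q = P"
  proof -
    assume *: "\<And>P. ideal_R P \<Longrightarrow> I \<subseteq> P \<Longrightarrow> P \<inter> S = {} \<Longrightarrow>
      (\<And>Q. ideal_R Q \<Longrightarrow> P \<subseteq> Q \<Longrightarrow> Q \<inter> S = {} \<Longrightarrow> Q = P) \<Longrightarrow> thesis"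
    assume "\<exists>M\<in>\<A>. \<forall>X\<in>\<A>. M \<subseteq> X \<longrightarrow> X = M"
    then obtain M where M: "M \<in> \<A>" "\<And>X. X \<in> \<A> \<Longrightarrow> M \<subseteq> X \<Longrightarrow> X = M" by blast
    show thesis
    proof (rule *[of M])
      show "Q = M" if "ideal_R Q" "M \<subseteq> Q" "Q \<inter> S = {}" for Q
        using M that by (auto simp: \<A>_def)
    qed (use M in \<open>auto simp: \<A>_def\<close>)
  qed
  have meet: "\<exists>p\<in>P. \<exists>g\<in>R. (\<lambda>x. p x + t x * g x) \<in> S" if t: "t \<in> R" "t \<notin> P" for t
  proof (rule ccontr)
    assume "\<not> ?thesis"
    then have "{\<lambda>x. p x + t x * g x | p g. p \<in> P \<and> g \<in> R} \<inter> S = {}" by auto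
    from max[OF ideal_R_generated(1,2)[OF P(1) t(1)] this] ideal_R_generated(3)[OF P(1) t(1)]
    show False using t by auto
  qed
  have "prime_R P" unfolding prime_R_def
  proof (intro conjI ballI impI P(1))
    show "(\<lambda>x. 1) \<notin> P" using P S by auto
    fix a b assume ab: "a \<in> R" "b \<in> R" "(\<lambda>x. a x * b x) \<in> P"
    show "a \<in> P \<or> b \<in> P"
    proof (rule ccontr)
      assume "\<not> ?thesis"
      then obtain p g q k where *: "p \<in> P" "g \<in> R" "(\<lambda>x. p x + a x * g x) \<in> S"
        "q \<in> P" "k \<in> R" "(\<lambda>x. q x + b x * k x) \<in> S"
        using meet ab by metis
      have "(\<lambda>x. (p x + a x * g x) * (q x + b x * k x)) \<in> S" using S(3) * by blast
      \<comment> \<open>Each of the three summands has a factor in \<open>P\<close>, namely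
        \<open>p\<close>, the product of \<open>a\<close> and \<open>b\<close>, or \<open>q\<close>;
        so an element of \<open>S\<close> would lie in \<open>P\<close>.\<close>
      moreover have "(\<lambda>x. (p x + a x * g x) * (q x + b x * k x)) =
        (\<lambda>x. p x * (q x + b x * k x) + ((a x * b x) * (g x * k x) + q x * (a x * g x)))"
        by (simp add: algebra_simps)
      moreover have "(\<lambda>x. p x * (q x + b x * k x)) \<in> P" "(\<lambda>x. q x * (a x * g x)) \<in> P"
        "(\<lambda>x. (a x * b x) * (g x * k x)) \<in> P"
        using * ab S(1)
        by (auto intro!: ideal_RD(4)[OF P(1)] polynomial_functions.mult dest: subsetD)
      then have "(\<lambda>x. p x * (q x + b x * k x) + ((a x * b x) * (g x * k x) + q x * (a x * g x))) \<in> P"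
        by (intro ideal_RD(3)[OF P(1)])
      ultimately show False using P(3) by auto
    qed
  qed
  with P meet that show thesis by blast
qed

end

section \<open>Algebraic independence modulo a prime ideal\<close>

inductive_set subalg :: "('b \<Rightarrow> complex) set \<Rightarrow> ('b \<Rightarrow> complex) set" for F where
  const: "(\<lambda>x. c) \<in> subalg F"
| gen: "f \<in> F \<Longrightarrow> f \<in> subalg F"
| add: "p \<in> subalg F \<Longrightarrow> q \<in> subalg F \<Longrightarrow> (\<lambda>x. p x + q x) \<in> subalg F"
| mult: "p \<in> subalg F \<Longrightarrow> q \<in> subalg F \<Longrightarrow> (\<lambda>x. p x * q x) \<in> subalg F"

lemma subalg_mono: "F \<subseteq> F' \<Longrightarrow> subalg F \<subseteq> subalg F'"
proof
  fix p assume "F \<subseteq> F'" "p \<in> subalg F"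
  from this(2,1) show "p \<in> subalg F'" by induction (auto intro: subalg.intros)
qed

lemma subalg_sum: "(\<And>i. i \<in> I \<Longrightarrow> p i \<in> subalg F) \<Longrightarrow> (\<lambda>x. \<Sum>i\<in>I. p i x) \<in> subalg F"
  by (induction I rule: infinite_finite_induct) (auto intro: subalg.intros)

lemma subalg_cmult: "p \<in> subalg F \<Longrightarrow> (\<lambda>x. c * p x) \<in> subalg F"
  by (rule subalg.mult[OF subalg.const])

lemma subalg_power: "p \<in> subalg F \<Longrightarrow> (\<lambda>x. p x ^ k) \<in> subalg F"
  by (induction k) (auto intro: subalg.intros)

lemma subalg_empty: "p \<in> subalg {} \<Longrightarrow> \<exists>c. p = (\<lambda>x. c)"
  by (induction rule: subalg.induct) auto

text \<open>A polynomial over an algebra \<open>A\<close> of functions is encoded pointwise, as a map into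
  \<^typ>\<open>complex poly\<close> of bounded degree whose coefficient functions lie in \<open>A\<close>.\<close>

definition polys_over :: "('b \<Rightarrow> complex) set \<Rightarrow> ('b \<Rightarrow> complex poly) set" where
  "polys_over A = {q. (\<forall>i. (\<lambda>x. coeff (q x) i) \<in> A) \<and> (\<exists>n. \<forall>x. degree (q x) \<le> n)}"

lemma polys_overI:
  "(\<And>i. (\<lambda>x. coeff (q x) i) \<in> A) \<Longrightarrow> (\<And>x. degree (q x) \<le> n) \<Longrightarrow> q \<in> polys_over A"
  unfolding polys_over_def by blast

lemma polys_over_mono: "A \<subseteq> A' \<Longrightarrow> polys_over A \<subseteq> polys_over A'"
  unfolding polys_over_def by blast

lemma poly_bounded: "degree q \<le> n \<Longrightarrow> poly q z = (\<Sum>i\<le>n. coeff q i * z ^ i)"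
  for q :: "'a::comm_semiring_1 poly"
  unfolding poly_altdef by (intro sum.mono_neutral_left) (auto simp: coeff_eq_0)

lemma polys_over_eval:
  assumes "q \<in> polys_over A" "A \<subseteq> subalg F" "t \<in> subalg F"
  shows "(\<lambda>x. poly (q x) (t x)) \<in> subalg F"
proof -
  obtain n where n: "\<And>x. degree (q x) \<le> n" and A: "\<And>i. (\<lambda>x. coeff (q x) i) \<in> A"
    using assms unfolding polys_over_def by auto
  have "(\<lambda>x. poly (q x) (t x)) = (\<lambda>x. \<Sum>i\<le>n. coeff (q x) i * t x ^ i)"
    using poly_bounded[OF n] by auto
  also have "\<dots> \<in> subalg F"
    using A assms by (intro subalg_sum subalg.mult subalg_power) auto
  finally show ?thesis .
qed

lemma subalg_insert:
  assumes "b \<in> subalg (insert f F)"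
  shows "\<exists>q\<in>polys_over (subalg F). b = (\<lambda>x. poly (q x) (f x))"
  using assms
proof induction
  case (const c)
  show ?case
    by (intro bexI[of _ "\<lambda>x. [:c:]"] polys_overI[where n = 0])
       (auto simp: coeff_pCons split: nat.split intro: subalg.intros)
next
  case (gen g)
  show ?case
  proof (cases "g = f")
    case True
    then show ?thesis
      by (intro bexI[of _ "\<lambda>x. [:0, 1:]"] polys_overI[where n = 1])
         (auto simp: coeff_pCons split: nat.split intro: subalg.intros)
  next
    case False
    have "(\<lambda>x. coeff [:g x:] i) \<in> subalg F" for i
      using gen False by (cases i) (auto intro: subalg.intros)
    then show ?thesis
      by (intro bexI[of _ "\<lambda>x. [:g x:]"] polys_overI[where n = 0]) auto
  qed
next
  case (add a b)
  then obtain p q where *: "p \<in> polys_over (subalg F)" "a = (\<lambda>x. poly (p x) (f x))"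
    "q \<in> polys_over (subalg F)" "b = (\<lambda>x. poly (q x) (f x))" by auto
  then obtain m n where mn: "\<And>x. degree (p x) \<le> m" "\<And>x. degree (q x) \<le> n"
    unfolding polys_over_def by auto
  have "degree (p x + q x) \<le> max m n" for x
    using mn[of x] by (intro degree_add_le) auto
  moreover have "(\<lambda>x. coeff (p x + q x) i) \<in> subalg F" for i
    using * by (auto simp: polys_over_def intro: subalg.intros)
  ultimately have "(\<lambda>x. p x + q x) \<in> polys_over (subalg F)" by (rule polys_overI[rotated])
  then show ?case by (intro bexI[of _ "\<lambda>x. p x + q x"]) (auto simp: *)
next
  case (mult a b)
  then obtain p q where *: "p \<in> polys_over (subalg F)" "a = (\<lambda>x. poly (p x) (f x))"
    "q \<in> polys_over (subalg F)" "b = (\<lambda>x. poly (q x) (f x))" by auto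
  then obtain m n where mn: "\<And>x. degree (p x) \<le> m" "\<And>x. degree (q x) \<le> n"
    unfolding polys_over_def by auto
  have "degree (p x * q x) \<le> m + n" for x
    using mn[of x] degree_mult_le[of "p x" "q x"] by simp
  moreover have "(\<lambda>x. coeff (p x * q x) i) \<in> subalg F" for i
    using * by (auto simp: polys_over_def coeff_mult intro!: subalg_sum intro: subalg.intros)
  ultimately have "(\<lambda>x. p x * q x) \<in> polys_over (subalg F)" by (rule polys_overI[rotated])
  then show ?case by (intro bexI[of _ "\<lambda>x. p x * q x"]) (auto simp: *)
qed

text \<open>The coefficients are required to vanish identically and not just modulo \<open>P\<close>; so independence
  modulo \<open>P\<close> includes that no nonzero element of the generated algebra lies in \<open>P\<close>.\<close>

definition transc :: "('b \<Rightarrow> complex) set \<Rightarrow> ('b \<Rightarrow> complex) set \<Rightarrow> ('b \<Rightarrow> complex) \<Rightarrow> bool" where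
  "transc P A t \<longleftrightarrow> (\<forall>q\<in>polys_over A. (\<lambda>x. poly (q x) (t x)) \<in> P \<longrightarrow> (\<forall>x. q x = 0))"

text \<open>Built up from the right: each entry is transcendental over the algebra of the entries
  behind it. The order is only apparent; \<open>alg_indep_move\<close> brings any entry to the
  front.\<close>

fun alg_indep :: "('b \<Rightarrow> complex) set \<Rightarrow> ('b \<Rightarrow> complex) list \<Rightarrow> bool" where
  "alg_indep P [] \<longleftrightarrow> True"
| "alg_indep P (f # fs) \<longleftrightarrow> alg_indep P fs \<and> transc P (subalg (set fs)) f"

lemma transc_antimono: "transc P A t \<Longrightarrow> P' \<subseteq> P \<Longrightarrow> A' \<subseteq> A \<Longrightarrow> transc P' A' t"
  unfolding transc_def using polys_over_mono by blast

lemma alg_indep_antimono: "alg_indep P fs \<Longrightarrow> P' \<subseteq> P \<Longrightarrow> alg_indep P' fs"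
  by (induction fs) (auto intro: transc_antimono)

lemma alg_indep_drop: "alg_indep P (gs @ fs) \<Longrightarrow> alg_indep P fs"
  by (induction gs) auto

text \<open>A relation modulo \<open>P'\<close> is an element of the generated algebra, so it
  vanishes identically and becomes a relation modulo \<open>P\<close>. Independence thus survives in
  any ideal that meets the algebra trivially.\<close>

lemma alg_indep_transfer:
  assumes "alg_indep P fs" "subalg (set fs) \<inter> P' \<subseteq> {\<lambda>x. 0}" "(\<lambda>x. 0) \<in> P"
  shows "alg_indep P' fs"
  using assms
proof (induction fs)
  case (Cons f fs)
  have sub: "subalg (set fs) \<subseteq> subalg (set (f # fs))" by (rule subalg_mono) auto
  have "transc P' (subalg (set fs)) f" unfolding transc_def
  proof (intro ballI impI)
    fix q assume q: "q \<in> polys_over (subalg (set fs))" "(\<lambda>x. poly (q x) (f x)) \<in> P'"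
    have "(\<lambda>x. poly (q x) (f x)) \<in> subalg (set (f # fs))"
      by (rule polys_over_eval[OF q(1) sub]) (auto intro: subalg.intros)
    then have "(\<lambda>x. poly (q x) (f x)) = (\<lambda>x. 0)" using Cons.prems(2) q(2) by blast
    then have "(\<lambda>x. poly (q x) (f x)) \<in> P" using Cons.prems(3) by simp
    moreover have "transc P (subalg (set fs)) f" using Cons.prems(1) by simp
    ultimately show "\<forall>x. q x = 0" using q(1) unfolding transc_def by blast
  qed
  then show ?case using Cons sub by auto
qed auto

text \<open>A relation for \<open>f\<close> over the algebra of \<open>g\<close> and
  \<open>F\<close> is reread as a polynomial in \<open>g\<close> whose coefficients are polynomials
  in \<open>f\<close> over \<open>F\<close>. Transcendence of \<open>g\<close> kills these
  coefficients, and transcendence of \<open>f\<close> then kills theirs.\<close>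

lemma transc_swap:
  assumes f: "transc P (subalg F) f" and g: "transc P (subalg (insert f F)) g"
    and P0: "(\<lambda>x. 0) \<in> P"
  shows "transc P (subalg (insert g F)) f"
  unfolding transc_def
proof (intro ballI impI)
  fix q assume q: "q \<in> polys_over (subalg (insert g F))" "(\<lambda>x. poly (q x) (f x)) \<in> P"
  then obtain n where n: "\<And>x. degree (q x) \<le> n" unfolding polys_over_def by auto
  have "\<forall>i. \<exists>r\<in>polys_over (subalg F). (\<lambda>x. coeff (q x) i) = (\<lambda>x. poly (r x) (g x))"
    using q(1) subalg_insert unfolding polys_over_def by blast
  then obtain r where r: "\<And>i. r i \<in> polys_over (subalg F)"
    "\<And>i x. coeff (q x) i = poly (r i x) (g x)" unfolding fun_eq_iff by metis
  have "\<forall>i. \<exists>n. \<forall>x. degree (r i x) \<le> n" using r(1) unfolding polys_over_def by blast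
  then obtain m where m: "\<And>i x. degree (r i x) \<le> m i" by metis
  \<comment> \<open>The relation \<open>q\<close> with the roles of the two variables
    interchanged.\<close>
  define s where "s x = (\<Sum>i\<le>n. smult (f x ^ i) (r i x))" for x
  have rc: "(\<lambda>x. coeff (r i x) j) \<in> subalg F" for i j using r(1) unfolding polys_over_def by auto
  have "s \<in> polys_over (subalg (insert f F))"
  proof (rule polys_overI)
    show "degree (s x) \<le> Max (m ` {..n})" for x unfolding s_def
    proof (rule degree_sum_le)
      fix i assume "i \<in> {..n}"
      then have "m i \<le> Max (m ` {..n})" by simp
      then show "degree (smult (f x ^ i) (r i x)) \<le> Max (m ` {..n})"
        using m[of i x] degree_smult_le[of "f x ^ i" "r i x"] by linarith
    qed simp
    have "subalg F \<subseteq> subalg (insert f F)" by (rule subalg_mono) auto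
    then show "(\<lambda>x. coeff (s x) j) \<in> subalg (insert f F)" for j
      unfolding s_def coeff_sum coeff_smult using rc
      by (intro subalg_sum subalg.mult subalg_power) (auto intro: subalg.gen)
  qed
  moreover have "poly (s x) (g x) = poly (q x) (f x)" for x
    unfolding s_def poly_bounded[OF n] r(2) by (simp add: poly_sum mult.commute)
  ultimately have s0: "\<And>x. s x = 0" using g q(2) unfolding transc_def by auto
  have r0: "coeff (r i x) j = 0" if "i \<le> n" for i j x
  proof -
    \<comment> \<open>The coefficient of the j-th power of \<open>g\<close>, as a polynomial in
      \<open>f\<close>.\<close>
    define u where "u x = (\<Sum>i\<le>n. monom (coeff (r i x) j) i)" for x
    have cu: "coeff (u x) i = (if i \<le> n then coeff (r i x) j else 0)" for x i
      unfolding u_def coeff_sum coeff_monom by auto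
    have "u \<in> polys_over (subalg F)"
    proof (rule polys_overI)
      show "degree (u x) \<le> n" for x by (rule degree_le) (simp add: cu)
      show "(\<lambda>x. coeff (u x) i) \<in> subalg F" for i
        unfolding cu using rc by (cases "i \<le> n") (auto intro: subalg.intros)
    qed
    moreover have "poly (u x) (f x) = coeff (s x) j" for x
      unfolding u_def s_def by (simp add: poly_sum poly_monom coeff_sum mult.commute)
    then have "(\<lambda>x. poly (u x) (f x)) \<in> P" using s0 P0 by simp
    ultimately have "u x = 0" for x using f unfolding transc_def by auto
    then show ?thesis using cu[of x i] that by auto
  qed
  show "\<forall>x. q x = 0"
  proof (intro allI poly_eqI)
    fix x i
    show "coeff (q x) i = coeff 0 i"
    proof (cases "i \<le> n")
      case True
      then have "r i x = 0" using r0 by (intro poly_eqI) auto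
      then show ?thesis using r(2) by simp
    next
      case False
      then show ?thesis using n[of x] by (simp add: coeff_eq_0)
    qed
  qed
qed

lemma alg_indep_move:
  assumes "alg_indep P (xs @ f # zs)" "(\<lambda>x. 0) \<in> P"
  shows "alg_indep P (f # xs @ zs)"
  using assms
proof (induction xs)
  case (Cons g xs)
  then have "alg_indep P (f # xs @ zs)" and
    g: "transc P (subalg (insert f (set (xs @ zs)))) g" by auto
  then have ind: "alg_indep P (xs @ zs)" and f: "transc P (subalg (set (xs @ zs))) f" by auto
  have "transc P (subalg (set (xs @ zs))) g"
    using transc_antimono[OF g order_refl subalg_mono] by blast
  moreover have "transc P (subalg (insert g (set (xs @ zs)))) f"
    using transc_swap[OF f g] Cons.prems by auto
  ultimately show ?case using ind by auto
qed auto

context complex_fd_space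
begin

lemma subalg_R: "F \<subseteq> R \<Longrightarrow> subalg F \<subseteq> R"
proof
  fix p assume "F \<subseteq> R" "p \<in> subalg F"
  from this(2,1) show "p \<in> R" by induction (auto intro: R_intros)
qed

lemma alg_indep_Int:
  assumes P: "prime_R P" and "alg_indep P fs" "b \<in> subalg (set fs)" "b \<in> P"
  shows "b = (\<lambda>x. 0)"
proof (cases fs)
  case Nil
  then show ?thesis using assms subalg_empty prime_R_const[OF P] by fastforce
next
  case (Cons f gs)
  then obtain q where q: "q \<in> polys_over (subalg (set gs))" "b = (\<lambda>x. poly (q x) (f x))"
    using subalg_insert[of b f "set gs"] assms by auto
  moreover have "transc P (subalg (set gs)) f" using assms Cons by simp
  ultimately have "\<forall>x. q x = 0" using assms(4) unfolding transc_def by blast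
  then show ?thesis using q by auto
qed

section \<open>Nullstellensatz and sections\<close>

text \<open>Uncountably many shifts against countably many degrees. Modulo \<open>P\<close>,
  \<open>g\<close> is the fraction \<open>b * h ^ k / (t - c)\<close>. Infinitely many
  \<open>c\<close> share the exponent and a degree bound of \<open>g\<close>, so some of these
  \<open>g\<close> are linearly dependent; clearing the denominators \<open>t - c\<close> turns the
  dependence into an algebraic relation for \<open>t\<close>.\<close>

lemma not_transc_if_all_shifts_meet:
  assumes P: "prime_R P" and F: "F \<subseteq> R" and h: "h \<in> R" "h \<notin> P" and t: "t \<in> R"
    and meet: "\<And>c. \<exists>g\<in>R. \<exists>b\<in>subalg F. \<exists>k. b \<noteq> (\<lambda>x. 0) \<and>
      (\<lambda>x. b x * h x ^ k - (t x - c) * g x) \<in> P"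
  shows "\<not> transc P (subalg F) t"
proof
  assume tr: "transc P (subalg F) t"
  define rel where "rel c g b k \<longleftrightarrow> b \<noteq> (\<lambda>x. 0) \<and> (\<lambda>x. b x * h x ^ k - (t x - c) * g x) \<in> P"
    for c g b k
  have "\<forall>c. \<exists>g\<in>R. \<exists>b\<in>subalg F. \<exists>k. rel c g b k" using meet unfolding rel_def by (rule allI)
  then have "\<forall>c. \<exists>g b k s. g \<in> R \<and> b \<in> subalg F \<and> rel c g b k \<and> fin_comb (monomials s) g"
    using R_fin_comb by metis
  then obtain g b k s where gbks: "\<And>c. g c \<in> R" "\<And>c. b c \<in> subalg F" "\<And>c. rel c (g c) (b c) (k c)"
    "\<And>c. fin_comb (monomials (s c)) (g c)" by metis
  note * = gbks(1,2) conjunct1[OF gbks(3)[unfolded rel_def]] conjunct2[OF gbks(3)[unfolded rel_def]]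
    gbks(4)
  \<comment> \<open>Real shifts are already uncountable, while the pairs of exponent and degree
    bound are countable.\<close>
  have "\<exists>k0 s0. infinite {r :: real. k (of_real r) = k0 \<and> s (of_real r) = s0}"
  proof (rule ccontr)
    assume "\<not> ?thesis"
    then have "finite {r :: real. (k (of_real r), s (of_real r)) = z}" for z
      unfolding prod_eq_iff fst_conv snd_conv by blast
    then have "countable (\<Union>z\<in>UNIV. {r :: real. (k (of_real r), s (of_real r)) = z})"
      by (intro countable_UN[OF countableI_type] countable_finite)
    moreover have "(\<Union>z\<in>UNIV. {r :: real. (k (of_real r), s (of_real r)) = z}) = UNIV" by blast
    ultimately show False using uncountable_UNIV_real by simp
  qed
  then obtain k0 s0 where "infinite {r :: real. k (of_real r) = k0 \<and> s (of_real r) = s0}" by auto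
  then have "infinite (complex_of_real ` {r. k (of_real r) = k0 \<and> s (of_real r) = s0})"
    by (subst finite_image_iff) (auto simp: inj_on_def)
  then obtain I where I: "finite I" "card I = Suc (card (monomials s0))"
    "I \<subseteq> complex_of_real ` {r. k (of_real r) = k0 \<and> s (of_real r) = s0}"
    using infinite_arbitrarily_large[of _ "Suc (card (monomials s0))"] by blast
  have ks: "k c = k0" "s c = s0" if "c \<in> I" for c using that I(3) by auto
  have "\<forall>c. \<exists>\<gamma>. \<forall>x. g c x = (\<Sum>e\<in>monomials (s c). \<gamma> e * e x)"
    using *(5) unfolding fin_comb_def by auto
  then obtain \<gamma> where \<gamma>: "\<And>c x. g c x = (\<Sum>e\<in>monomials (s c). \<gamma> c e * e x)" by metis
  obtain \<alpha> c0 where \<alpha>: "c0 \<in> I" "\<alpha> c0 \<noteq> 0" "\<And>e. e \<in> monomials s0 \<Longrightarrow> (\<Sum>c\<in>I. \<alpha> c * \<gamma> c e) = 0"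
    using nontrivial_relation[OF finite_monomials I(1), of s0 \<gamma>] I(2) by auto
  have g0: "(\<Sum>c\<in>I. \<alpha> c * g c x) = 0" for x
  proof -
    have "(\<Sum>c\<in>I. \<alpha> c * g c x) = (\<Sum>c\<in>I. \<Sum>e\<in>monomials s0. \<alpha> c * \<gamma> c e * e x)"
      by (intro sum.cong refl) (simp add: \<gamma> ks sum_distrib_left mult.assoc)
    also have "\<dots> = (\<Sum>e\<in>monomials s0. (\<Sum>c\<in>I. \<alpha> c * \<gamma> c e) * e x)"
      by (subst sum.swap) (simp add: sum_distrib_right)
    finally show ?thesis using \<alpha>(3) by simp
  qed
  \<comment> \<open>Lagrange numerators: \<open>L c\<close> vanishes at every point of
    \<open>I\<close> except \<open>c\<close>, so evaluating \<open>q\<close> at \<open>c0\<close>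
    isolates the term of \<open>c0\<close> and shows that the relation is nontrivial.\<close>
  define L where "L c = (\<Prod>i\<in>I - {c}. [:- i, 1:])" for c
  define q where "q x = (\<Sum>c\<in>I. smult (\<alpha> c * b c x) (L c))" for x
  have poly_L: "poly (L c) z = (\<Prod>i\<in>I - {c}. z - i)" for c z
    unfolding L_def by (simp add: poly_prod)
  have LR: "(\<lambda>x. poly (L c) (t x)) \<in> R" for c
  proof -
    have "(\<lambda>x. \<Prod>i\<in>J. t x - i) \<in> R" for J
      by (induction J rule: infinite_finite_induct)
         (auto intro!: polynomial_functions.const polynomial_functions.mult R_diff t)
    then show ?thesis unfolding poly_L .
  qed
  have qA: "q \<in> polys_over (subalg F)"
  proof (rule polys_overI)
    show "(\<lambda>x. coeff (q x) i) \<in> subalg F" for i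
      unfolding q_def coeff_sum coeff_smult
      by (intro subalg_sum subalg.mult subalg_cmult *(2) subalg.const)
    show "degree (q x) \<le> Max ((\<lambda>c. degree (L c)) ` I)" for x unfolding q_def
    proof (rule degree_sum_le[OF I(1)])
      fix c assume "c \<in> I"
      then have "degree (L c) \<le> Max ((\<lambda>c. degree (L c)) ` I)" using I(1) by simp
      then show "degree (smult (\<alpha> c * b c x) (L c)) \<le> Max ((\<lambda>c. degree (L c)) ` I)"
        using degree_smult_le[of "\<alpha> c * b c x" "L c"] by linarith
    qed
  qed
  have "(\<lambda>x. h x ^ k0 * poly (q x) (t x)) \<in> P"
  proof -
    have "(\<lambda>x. \<Sum>c\<in>I. (b c x * h x ^ k c - (t x - c) * g c x) * (\<alpha> c * poly (L c) (t x))) \<in> P"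
      by (intro ideal_R_sum ideal_RD(4) prime_RD(1)[OF P] *(4) R_cmult LR)
    moreover have "(\<Sum>c\<in>I. (b c x * h x ^ k c - (t x - c) * g c x) * (\<alpha> c * poly (L c) (t x)))
      = h x ^ k0 * poly (q x) (t x)" for x
    proof -
      have 1: "(t x - c) * poly (L c) (t x) = (\<Prod>i\<in>I. t x - i)" if "c \<in> I" for c
        unfolding poly_L using that I(1) by (simp add: prod.remove)
      have "(\<Sum>c\<in>I. (b c x * h x ^ k c - (t x - c) * g c x) * (\<alpha> c * poly (L c) (t x)))
        = (\<Sum>c\<in>I. h x ^ k0 * (\<alpha> c * b c x * poly (L c) (t x))
             - (\<alpha> c * g c x) * (\<Prod>i\<in>I. t x - i))"
        by (intro sum.cong refl) (simp add: 1[symmetric] ks algebra_simps)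
      also have "\<dots> = h x ^ k0 * poly (q x) (t x) - (\<Sum>c\<in>I. \<alpha> c * g c x) * (\<Prod>i\<in>I. t x - i)"
        unfolding q_def
        by (simp add: sum_subtractf sum_distrib_left sum_distrib_right poly_sum)
      finally show ?thesis using g0 by simp
    qed
    ultimately show ?thesis by simp
  qed
  moreover have "(\<lambda>x. poly (q x) (t x)) \<in> R"
    unfolding q_def poly_sum poly_smult
    using *(2) subalg_R[OF F] LR by (intro R_sum polynomial_functions.mult R_cmult) auto
  ultimately have "(\<lambda>x. poly (q x) (t x)) \<in> P"
    using prime_RD(3)[OF P R_power[OF h(1)]] prime_R_power[OF P h(1)] h(2) by blast
  with tr qA have q0: "\<And>x. q x = 0" unfolding transc_def by blast
  have "b c0 x = 0" for x
  proof -
    have "poly (q x) c0 = (\<Sum>c\<in>I. if c = c0 then \<alpha> c * b c x * poly (L c) c0 else 0)"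
      unfolding q_def poly_sum poly_smult
      by (intro sum.cong refl) (auto simp: poly_L \<alpha>(1) I(1))
    also have "\<dots> = \<alpha> c0 * b c0 x * poly (L c0) c0" using \<alpha>(1) I(1) by simp
    finally have "\<alpha> c0 * b c0 x * poly (L c0) c0 = 0" using q0 by simp
    moreover have "poly (L c0) c0 \<noteq> 0" unfolding poly_L using I(1) by auto
    ultimately show ?thesis using \<alpha>(2) by simp
  qed
  then show False using *(3) by auto
qed

text \<open>Over the complex numbers the polynomial splits, and a prime ideal containing the product
  contains one of the linear factors.\<close>

lemma prime_R_linear_factor:
  fixes q :: "complex poly"
  assumes P: "prime_R P" and t: "t \<in> R"
  shows "q \<noteq> 0 \<Longrightarrow> (\<lambda>x. poly q (t x)) \<in> P \<Longrightarrow> \<exists>c. (\<lambda>x. t x - c) \<in> P"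
proof (induction "degree q" arbitrary: q)
  case 0
  then obtain c where "q = [:c:]" by (metis degree_eq_zeroE)
  with 0 show ?case using prime_R_const[OF P, of c] by simp
next
  case (Suc n)
  have "\<not> constant (poly q)" using Suc(2) constant_degree[of q] by simp
  then obtain c where "poly q c = 0" using fundamental_theorem_of_algebra by blast
  then obtain r where r: "q = [:- c, 1:] * r" using poly_eq_0_iff_dvd by (metis dvd_def)
  then have r0: "r \<noteq> 0" using Suc.prems(1) by auto
  then have "degree q = Suc (degree r)" unfolding r by (subst degree_mult_eq) auto
  then have "degree r = n" using Suc(2) by simp
  have "(\<lambda>x. poly r (t x)) \<in> R" unfolding poly_altdef
    by (intro R_sum R_cmult R_power t)
  moreover have "(\<lambda>x. (t x - c) * poly r (t x)) \<in> P"
    using Suc.prems(2) unfolding r by (simp add: algebra_simps)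
  ultimately have "(\<lambda>x. t x - c) \<in> P \<or> (\<lambda>x. poly r (t x)) \<in> P"
    by (intro prime_RD(3)[OF P]) (auto intro: R_diff t polynomial_functions.const)
  then show ?case using Suc(1)[of r] r0 \<open>degree r = n\<close> by auto
qed

text \<open>An ideal \<open>M\<close> above \<open>P\<close> that is maximal among those missing the
  powers of \<open>h\<close> is the ideal of a point. If no \<open>t - c\<close> lies in
  \<open>M\<close>, maximality makes every \<open>t - c\<close> divide a power of \<open>h\<close>
  modulo \<open>M\<close>; then \<open>t\<close> is algebraic over the constants and by
  \<open>prime_R_linear_factor\<close> some \<open>t - c\<close> lies in \<open>M\<close> after all.
  The constants belonging to the coordinates form the point.\<close>

lemma prime_R_nullstellensatz:
  assumes P: "prime_R P" and h: "h \<in> R" "h \<notin> P"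
  shows "\<exists>x\<in>zero_locus P. h x \<noteq> 0"
proof -
  define S where "S = range (\<lambda>k x. h x ^ k)"
  obtain M where M: "prime_R M" "P \<subseteq> M" "M \<inter> S = {}"
    "\<And>t. t \<in> R \<Longrightarrow> t \<notin> M \<Longrightarrow> \<exists>p\<in>M. \<exists>g\<in>R. (\<lambda>x. p x + t x * g x) \<in> S"
  proof (rule prime_R_avoiding[of P S])
    show "ideal_R P" by (rule prime_RD(1)[OF P])
    show "P \<inter> S = {}" using prime_R_power[OF P h(1)] h(2) unfolding S_def by auto
    show "S \<subseteq> R" unfolding S_def by (auto intro: R_power h)
    show "(\<lambda>x. 1) \<in> S" unfolding S_def by (rule image_eqI[of _ _ 0]) auto
    show "(\<lambda>x. p x * q x) \<in> S" if "p \<in> S" "q \<in> S" for p q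
    proof -
      obtain i where "p = (\<lambda>x. h x ^ i)" using \<open>p \<in> S\<close> unfolding S_def by blast
      moreover obtain j where "q = (\<lambda>x. h x ^ j)" using \<open>q \<in> S\<close> unfolding S_def by blast
      ultimately show ?thesis unfolding S_def by (intro image_eqI[of _ _ "i + j"]) (auto simp: power_add)
    qed
  qed blast
  have "(\<lambda>x. h x ^ 1) \<in> S" unfolding S_def by (rule rangeI)
  then have hM: "h \<notin> M" using M(3) by auto
  have ex: "\<exists>c. (\<lambda>x. t x - c) \<in> M" if t: "t \<in> R" for t
  proof (rule ccontr)
    assume no: "\<not> ?thesis"
    have "\<not> transc M (subalg {}) t"
    proof (rule not_transc_if_all_shifts_meet[OF M(1) _ h(1) hM t])
      fix c
      have "(\<lambda>x. t x - c) \<in> R" by (intro R_diff t polynomial_functions.const)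
      then obtain p g where pg: "p \<in> M" "g \<in> R" "(\<lambda>x. p x + (t x - c) * g x) \<in> S"
        using M(4) no by blast
      then obtain k where "(\<lambda>x. p x + (t x - c) * g x) = (\<lambda>x. h x ^ k)" unfolding S_def by auto
      then have eq: "p x + (t x - c) * g x = h x ^ k" for x by meson
      have "(\<lambda>x. 1 * h x ^ k - (t x - c) * g x) = p" unfolding eq[symmetric] by simp
      then have "(\<lambda>x. 1 * h x ^ k - (t x - c) * g x) \<in> M" using pg(1) by (simp only:)
      moreover have "(\<lambda>x. 1) \<noteq> (\<lambda>x::'b. 0::complex)" by (auto simp: fun_eq_iff)
      ultimately show "\<exists>g\<in>R. \<exists>b\<in>subalg {}. \<exists>k. b \<noteq> (\<lambda>x. 0) \<and>
          (\<lambda>x. b x * h x ^ k - (t x - c) * g x) \<in> M"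
        using pg(2) subalg.const[of 1 "{}"] by blast
    qed auto
    then obtain q x0 where q: "q \<in> polys_over (subalg {})" "(\<lambda>x. poly (q x) (t x)) \<in> M" "q x0 \<noteq> 0"
      unfolding transc_def by auto
    \<comment> \<open>Over the empty set of generators the coefficient functions are constants, so
      \<open>q\<close> is one fixed complex polynomial.\<close>
    have q_const: "q x = q x0" for x
    proof (rule poly_eqI)
      fix i
      obtain c where "(\<lambda>x. coeff (q x) i) = (\<lambda>x. c)"
        using q(1) subalg_empty unfolding polys_over_def by blast
      from fun_cong[OF this, of x] fun_cong[OF this, of x0]
      show "coeff (q x) i = coeff (q x0) i" by simp
    qed
    have "(\<lambda>x. poly (q x0) (t x)) \<in> M" using q(2) by (subst (asm) q_const)
    from prime_R_linear_factor[OF M(1) t q(3) this] no show False by blast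
  qed
  have "\<forall>b. \<exists>c. (\<lambda>x. coord b x - c) \<in> M" using ex coord_in_R by blast
  then obtain c where c: "\<And>b. (\<lambda>x. coord b x - c b) \<in> M" by metis
  define x0 where "x0 = (\<Sum>b\<in>Basis. sc (c b) b)"
  have iM: "ideal_R M" by (rule prime_RD(1)[OF M(1)])
  have coord_x0: "coord b x0 = c b" if "b \<in> Basis" for b
  proof -
    have "coord b x0 = (\<Sum>b'\<in>Basis. c b' * coord b b')" unfolding x0_def coord_sum coord_simps ..
    also have "\<dots> = (\<Sum>b'\<in>Basis. if b' = b then c b' else 0)"
      using that by (intro sum.cong refl) (auto simp: representation_basis[OF independent_Basis])
    finally show ?thesis using that finite_Basis by simp
  qed
  \<comment> \<open>Modulo \<open>M\<close> every function equals its value at \<open>x0\<close>; it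
    suffices to know this for the coordinates.\<close>
  have ev: "(\<lambda>x. p x - p x0) \<in> M" if "p \<in> R" for p
    using that
  proof induction
    case (const c)
    show ?case using ideal_RD(2)[OF iM] by simp
  next
    case (functional f)
    have "(\<lambda>x. \<Sum>b\<in>Basis. (coord b x - c b) * f b) \<in> M"
      by (intro ideal_R_sum iM ideal_RD(4) c polynomial_functions.const)
    moreover have "(\<Sum>b\<in>Basis. (coord b x - c b) * f b) = f x - f x0" for x
      unfolding linear_functional_coord[OF functional, of x] linear_functional_coord[OF functional, of x0]
      by (simp add: coord_x0 sum_subtractf[symmetric] algebra_simps)
    ultimately show ?case by simp
  next
    case (add p q)
    then show ?case using ideal_RD(3)[OF iM add.IH] by (simp add: algebra_simps)
  next
    case (mult p q)
    have "(\<lambda>x. (p x - p x0) * q x + (q x - q x0) * p x0) \<in> M"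
      by (rule ideal_RD(3)[OF iM])
         (auto intro!: ideal_RD(4)[OF iM] mult polynomial_functions.const)
    then show ?case by (simp add: algebra_simps)
  qed
  have vanish: "p x0 = 0" if "p \<in> M" for p
  proof -
    have "(\<lambda>x. p x - (p x - p x0)) \<in> M"
      using ideal_R_diff[OF iM that ev[OF ideal_RD(1)[OF iM that]]] .
    then show ?thesis using prime_R_const[OF M(1), of "p x0"] by simp
  qed
  have "h x0 \<noteq> 0"
  proof
    assume "h x0 = 0"
    then show False using ev[OF h(1)] hM by simp
  qed
  moreover have "x0 \<in> zero_locus P" using vanish M(2) unfolding zero_locus_def by auto
  ultimately show ?thesis by blast
qed

text \<open>If for every \<open>c\<close> the ideal generated by \<open>P\<close> and
  \<open>f - c\<close> contained some \<open>b * h ^ k\<close> with nonzero \<open>b\<close> from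
  the algebra of \<open>fs\<close>, then \<open>f\<close> would be algebraic over \<open>fs\<close>.
  So for some \<open>c\<close> it contains none, and a prime avoiding all these products keeps
  \<open>fs\<close> independent. The function \<open>h\<close> lets later arguments retain a
  prescribed open set.\<close>

lemma alg_indep_section:
  assumes P: "prime_R P" and ind: "alg_indep P (f # fs)" and R: "set (f # fs) \<subseteq> R"
    and h: "h \<in> R" "h \<notin> P"
  obtains P' c where "prime_R P'" "P \<subseteq> P'" "(\<lambda>x. f x - c) \<in> P'" "alg_indep P' fs" "h \<notin> P'"
proof -
  let ?A = "subalg (set fs)"
  have iP: "ideal_R P" by (rule prime_RD(1)[OF P])
  have A: "?A \<subseteq> R" using R by (intro subalg_R) auto
  have A0: "b = (\<lambda>x. 0)" if "b \<in> ?A" "b \<in> P" for b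
    using alg_indep_Int[OF P _ that] ind by simp
  obtain c where c: "\<And>g b k. g \<in> R \<Longrightarrow> b \<in> ?A \<Longrightarrow> b \<noteq> (\<lambda>x. 0) \<Longrightarrow>
      (\<lambda>x. b x * h x ^ k - (f x - c) * g x) \<notin> P"
  proof -
    have "\<exists>c. \<not> (\<exists>g\<in>R. \<exists>b\<in>?A. \<exists>k. b \<noteq> (\<lambda>x. 0) \<and> (\<lambda>x. b x * h x ^ k - (f x - c) * g x) \<in> P)"
    proof (rule ccontr)
      assume "\<not> ?thesis"
      then have meet: "\<And>c. \<exists>g\<in>R. \<exists>b\<in>?A. \<exists>k. b \<noteq> (\<lambda>x. 0) \<and>
          (\<lambda>x. b x * h x ^ k - (f x - c) * g x) \<in> P" by blast
      have "\<not> transc P ?A f"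
        by (rule not_transc_if_all_shifts_meet[OF P _ h _ meet]) (use R in auto)
      then show False using ind by simp
    qed
    then show thesis using that by blast
  qed
  \<comment> \<open>The case \<open>k = 0\<close> protects the algebra of \<open>fs\<close>, the
    case of constant \<open>b\<close> protects the powers of \<open>h\<close>.\<close>
  define S where "S = {\<lambda>x. b x * h x ^ k | b k. b \<in> ?A \<and> b \<noteq> (\<lambda>x. 0)}"
  define t where "t = (\<lambda>x. f x - c)"
  have t: "t \<in> R" unfolding t_def using R by (auto intro: R_diff polynomial_functions.const)
  define I where "I = {\<lambda>x. p x + t x * g x | p g. p \<in> P \<and> g \<in> R}"
  note I = ideal_R_generated[OF iP t, folded I_def]
  obtain P' where P': "prime_R P'" "I \<subseteq> P'" "P' \<inter> S = {}"
  proof (rule prime_R_avoiding[of I S])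
    show "ideal_R I" by (rule I(1))
    show "I \<inter> S = {}"
    proof (rule ccontr)
      assume "I \<inter> S \<noteq> {}"
      then obtain z where z: "z \<in> I" "z \<in> S" by auto
      then obtain p g where pg: "z = (\<lambda>x. p x + t x * g x)" "p \<in> P" "g \<in> R"
        unfolding I_def by blast
      obtain b k where bk: "z = (\<lambda>x. b x * h x ^ k)" "b \<in> ?A" "b \<noteq> (\<lambda>x. 0)"
        using z(2) unfolding S_def by blast
      have "p x + t x * g x = b x * h x ^ k" for x using fun_cong[OF pg(1)] fun_cong[OF bk(1)] by simp
      then have "p x = b x * h x ^ k - (f x - c) * g x" for x
        unfolding t_def by (simp add: eq_diff_eq)
      then have "p = (\<lambda>x. b x * h x ^ k - (f x - c) * g x)" by (rule ext)
      then show False using c[OF pg(3) bk(2,3), of k] pg(2) by simp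
    qed
    show "S \<subseteq> R" using A unfolding S_def by (auto intro!: polynomial_functions.mult R_power h)
    show "(\<lambda>x. 1) \<in> S" unfolding S_def
      by (intro CollectI exI[of _ "\<lambda>x. 1"] exI[of _ 0]) (auto simp: fun_eq_iff intro: subalg.const)
    fix p q assume "p \<in> S" "q \<in> S"
    obtain a i where a: "p = (\<lambda>x. a x * h x ^ i)" "a \<in> ?A" "a \<noteq> (\<lambda>x. 0)"
      using \<open>p \<in> S\<close> unfolding S_def by blast
    obtain b j where b: "q = (\<lambda>x. b x * h x ^ j)" "b \<in> ?A" "b \<noteq> (\<lambda>x. 0)"
      using \<open>q \<in> S\<close> unfolding S_def by blast
    note * = a b
    have "(\<lambda>x. a x * b x) \<noteq> (\<lambda>x. 0)"
    proof
      assume "(\<lambda>x. a x * b x) = (\<lambda>x. 0)"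
      then have "(\<lambda>x. a x * b x) \<in> P" using ideal_RD(2)[OF iP] by simp
      then have "a \<in> P \<or> b \<in> P" using prime_RD(3)[OF P] * A by blast
      then show False using A0 * by blast
    qed
    then show "(\<lambda>x. p x * q x) \<in> S" unfolding S_def using *
      by (intro CollectI exI[of _ "\<lambda>x. a x * b x"] exI[of _ "i + j"])
         (auto simp: power_add mult_ac intro: subalg.mult)
  qed blast
  have memS: "(\<lambda>x. b x * h x ^ k) \<in> S" if "b \<in> ?A" "b \<noteq> (\<lambda>x. 0)" for b k
    using that unfolding S_def by blast
  have "subalg (set fs) \<inter> P' \<subseteq> {\<lambda>x. 0}"
    using memS[where k = 0] P'(3) by auto
  then have "alg_indep P' fs"
    using alg_indep_transfer[of P fs P'] ind ideal_RD(2)[OF iP] by simp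
  moreover have "h \<notin> P'"
    using memS[OF subalg.const[of 1], of 1] P'(3) by (auto simp: fun_eq_iff)
  ultimately show thesis using that[OF P'(1), of c] P'(2) I(2,3) unfolding t_def by blast
qed

section \<open>Chains of primes and the Krull dimension\<close>

text \<open>A function \<open>f\<close> in \<open>P k\<close> but outside \<open>P (Suc k)\<close>
  is transcendental over the list found so far: in a relation modulo \<open>P (Suc k)\<close> the
  constant coefficient lies in \<open>P k\<close> and hence vanishes, and then \<open>f\<close> can
  be cancelled because \<open>P (Suc k)\<close> is prime.\<close>

lemma alg_indep_of_chain:
  assumes "\<And>i. i \<le> k \<Longrightarrow> prime_R (P i)" "\<And>i. i < k \<Longrightarrow> P (Suc i) \<subset> P i"
  shows "\<exists>fs. length fs = k \<and> set fs \<subseteq> R \<and> alg_indep (P k) fs"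
  using assms
proof (induction k)
  case (Suc k)
  then obtain fs where fs: "length fs = k" "set fs \<subseteq> R" "alg_indep (P k) fs" by auto
  have prime: "prime_R (P k)" "prime_R (P (Suc k))" using Suc.prems by auto
  have sub: "P (Suc k) \<subset> P k" using Suc.prems by auto
  then obtain f where f: "f \<in> P k" "f \<notin> P (Suc k)" by auto
  let ?A = "subalg (set fs)"
  have ik: "ideal_R (P k)" "ideal_R (P (Suc k))" using prime prime_RD(1) by auto
  have fR: "f \<in> R" using ideal_RD(1)[OF ik(1) f(1)] .
  have A: "?A \<subseteq> subalg (insert f (set fs))" by (rule subalg_mono) auto
  have "\<forall>x. q x = 0" if "q \<in> polys_over ?A" "(\<lambda>x. poly (q x) (f x)) \<in> P (Suc k)"
    "\<And>x. degree (q x) < n" for q n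
    using that
  proof (induction n arbitrary: q)
    case (Suc n)
    define a where "a x = coeff (q x) 0" for x
    define r where "r x = poly_shift 1 (q x)" for x
    have q: "q x = pCons (a x) (r x)" for x
      by (rule poly_eqI) (auto simp: a_def r_def coeff_pCons coeff_poly_shift split: nat.split)
    have aA: "a \<in> ?A" using Suc.prems(1) unfolding polys_over_def a_def by auto
    have rdeg: "degree (r x) \<le> n" for x
      using Suc.prems(3)[of x] unfolding r_def
      by (intro degree_le) (auto simp: coeff_poly_shift intro: coeff_eq_0)
    have rA: "r \<in> polys_over ?A"
      using Suc.prems(1) rdeg by (auto simp: polys_over_def r_def coeff_poly_shift)
    have "(\<lambda>x. poly (r x) (f x)) \<in> subalg (insert f (set fs))"
      by (rule polys_over_eval[OF rA A]) (auto intro: subalg.gen)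
    then have rR: "(\<lambda>x. poly (r x) (f x)) \<in> R" using subalg_R[of "insert f (set fs)"] fR fs by auto
    have "(\<lambda>x. (a x + f x * poly (r x) (f x)) - f x * poly (r x) (f x)) \<in> P k"
      using Suc.prems(2) sub unfolding q
      by (intro ideal_R_diff[OF ik(1)] ideal_RD(4)[OF ik(1)] f rR) auto
    then have "a = (\<lambda>x. 0)" using alg_indep_Int[OF prime(1) fs(3) aA] by simp
    then have a0: "a x = 0" for x by simp
    have "(\<lambda>x. f x * poly (r x) (f x)) \<in> P (Suc k)" using Suc.prems(2) unfolding q a0 by simp
    then have rP: "(\<lambda>x. poly (r x) (f x)) \<in> P (Suc k)" using prime_RD(3)[OF prime(2) fR rR] f by auto
    \<comment> \<open>The zero polynomial has degree 0, so the strict bound on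
      \<open>degree (r x)\<close> is available only for positive \<open>n\<close>; for
      \<open>n = 0\<close> the relation is constant.\<close>
    show ?case
    proof (cases "n = 0")
      case True
      then have "q x = [:a x:]" for x using rdeg[of x] Suc.prems(3)[of x] q
        by (metis One_nat_def a_def coeff_pCons_0 degree_eq_zeroE less_one)
      then show ?thesis using a0 by simp
    next
      case False
      have "degree (r x) < n" for x
      proof (cases "r x = 0")
        case False
        then show ?thesis using Suc.prems(3)[of x] unfolding q by simp
      qed (use \<open>n \<noteq> 0\<close> in simp)
      then have "\<forall>x. r x = 0" using Suc.IH[OF rA rP] by auto
      then show ?thesis using q a0 by simp
    qed
  qed simp
  then have "transc (P (Suc k)) ?A f" unfolding transc_def polys_over_def
    by (smt (verit) less_Suc_eq_le mem_Collect_eq)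
  moreover have "alg_indep (P (Suc k)) fs" using alg_indep_antimono[OF fs(3)] sub by auto
  ultimately show ?case using fs fR by (intro exI[of _ "f # fs"]) auto
qed auto

text \<open>Each section by a level set of the head enlarges the prime strictly, since
  \<open>f - c\<close> in \<open>P\<close> would be a relation for \<open>f\<close>. The indices run
  downwards so that \<open>P\<close> is the last and smallest member, as in
  \<open>alg_indep_of_chain\<close>.\<close>

lemma chain_of_alg_indep:
  assumes "prime_R P" "set fs \<subseteq> R" "alg_indep P fs"
  shows "\<exists>Q. (\<forall>i\<le>length fs. prime_R (Q i)) \<and> (\<forall>i<length fs. Q (Suc i) \<subset> Q i) \<and> Q (length fs) = P"
  using assms
proof (induction fs arbitrary: P)
  case Nil
  then show ?case by (intro exI[of _ "\<lambda>_. P"]) auto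
next
  case (Cons f fs)
  obtain P' c where P': "prime_R P'" "P \<subseteq> P'" "(\<lambda>x. f x - c) \<in> P'" "alg_indep P' fs"
    using alg_indep_section[OF Cons.prems(1,3,2) polynomial_functions.const prime_RD(2)[OF Cons.prems(1)]]
    by metis
  have "(\<lambda>x. f x - c) \<notin> P"
  proof
    assume "(\<lambda>x. f x - c) \<in> P"
    then have "(\<lambda>x. poly [:- c, 1:] (f x)) \<in> P" by simp
    moreover have "(\<lambda>x. [:- c, 1:]) \<in> polys_over (subalg (set fs))"
      by (rule polys_overI[where n = 1]) (auto simp: coeff_pCons split: nat.split intro: subalg.const)
    ultimately show False using Cons.prems(3) unfolding alg_indep.simps transc_def by fastforce
  qed
  then have sub: "P \<subset> P'" using P' by auto
  obtain Q where Q: "\<forall>i\<le>length fs. prime_R (Q i)" "\<forall>i<length fs. Q (Suc i) \<subset> Q i" "Q (length fs) = P'"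
    using Cons.IH[OF P'(1) _ P'(4)] Cons.prems by auto
  define Q' where "Q' = Q(Suc (length fs) := P)"
  show ?case
  proof (intro exI[of _ Q'] conjI allI impI)
    fix i assume "i \<le> length (f # fs)"
    then show "prime_R (Q' i)" using Q Cons.prems by (cases "i = Suc (length fs)") (auto simp: Q'_def)
  next
    fix i assume "i < length (f # fs)"
    then show "Q' (Suc i) \<subset> Q' i" using Q sub by (cases "i = length fs") (auto simp: Q'_def)
  qed (auto simp: Q'_def)
qed

section \<open>The correspondence between irreducible closed sets and prime ideals\<close>

definition vanishing :: "'b set \<Rightarrow> ('b \<Rightarrow> complex) set" where
  "vanishing X = {p \<in> R. \<forall>x\<in>X. p x = 0}"

lemma ideal_R_vanishing: "ideal_R (vanishing X)"
  unfolding ideal_R_def vanishing_def by (auto intro: R_intros polynomial_functions.add polynomial_functions.mult)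

lemma zero_locus_vanishing: "closedin (zariski sc) X \<Longrightarrow> zero_locus (vanishing X) = X"
  unfolding closedin_zariski zero_locus_def vanishing_def by blast

lemma vanishing_zero_locus:
  assumes "prime_R P"
  shows "vanishing (zero_locus P) = P"
proof
  show "P \<subseteq> vanishing (zero_locus P)"
    using ideal_RD(1)[OF prime_RD(1)[OF assms]] by (auto simp: vanishing_def zero_locus_def)
  show "vanishing (zero_locus P) \<subseteq> P"
    using prime_R_nullstellensatz[OF assms] by (auto simp: vanishing_def)
qed

lemma closedin_zero_locus: "P \<subseteq> R \<Longrightarrow> closedin (zariski sc) (zero_locus P)"
  unfolding closedin_zariski by blast

lemma irreducible_variety_iff:
  "irreducible_variety sc X \<longleftrightarrow> closedin (zariski sc) X \<and> prime_R (vanishing X)"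
proof (cases "closedin (zariski sc) X")
  case X: True
  have cl: "closedin (subtopology (zariski sc) X) A \<longleftrightarrow> closedin (zariski sc) A \<and> A \<subseteq> X" for A
    using closedin_closed_subtopology[OF X] .
  have "irreducible_space (subtopology (zariski sc) X) \<longleftrightarrow> prime_R (vanishing X)"
  proof
    assume irr: "irreducible_space (subtopology (zariski sc) X)"
    then have ne: "X \<noteq> {}" unfolding irreducible_space_def by simp
    show "prime_R (vanishing X)" unfolding prime_R_def
    proof (intro conjI ideal_R_vanishing ballI impI)
      show "(\<lambda>x. 1) \<notin> vanishing X" using ne by (auto simp: vanishing_def)
      fix p q assume pq: "p \<in> R" "q \<in> R" "(\<lambda>x. p x * q x) \<in> vanishing X"
      show "p \<in> vanishing X \<or> q \<in> vanishing X"
      proof (rule ccontr)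
        assume no: "\<not> ?thesis"
        have c: "closedin (zariski sc) (X \<inter> zero_locus {r})" if "r \<in> R" for r
          using X closedin_zero_locus[of "{r}"] that by (intro closedin_Int) auto
        have "X \<inter> zero_locus {p} \<subset> X" "X \<inter> zero_locus {q} \<subset> X"
          "X \<inter> zero_locus {p} \<union> X \<inter> zero_locus {q} = X"
          using no pq by (auto simp: vanishing_def zero_locus_def)
        then show False using irr c[OF pq(1)] c[OF pq(2)] unfolding irreducible_space_def cl by auto
      qed
    qed
  next
    assume pr: "prime_R (vanishing X)"
    have "X \<noteq> {}" using prime_RD(2)[OF pr] by (auto simp: vanishing_def intro: polynomial_functions.const)
    moreover have False if AB: "closedin (zariski sc) A" "closedin (zariski sc) B" "A \<subset> X" "B \<subset> X"
      "A \<union> B = X" for A B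
    proof -
      have "\<exists>p\<in>R. p \<notin> vanishing X \<and> (\<forall>x\<in>A. p x = 0)" if A: "closedin (zariski sc) A" "A \<subset> X" for A
      proof -
        obtain x where x: "x \<in> X" "x \<notin> A" using A by auto
        then obtain p where "p \<in> vanishing A" "p x \<noteq> 0"
          using zero_locus_vanishing[OF A(1)] by (auto simp: zero_locus_def)
        then show ?thesis using x by (auto simp: vanishing_def)
      qed
      then obtain p q where "p \<in> R" "q \<in> R" "p \<notin> vanishing X" "q \<notin> vanishing X"
        "\<forall>x\<in>A. p x = 0" "\<forall>x\<in>B. q x = 0" using AB by metis
      moreover from this have "(\<lambda>x. p x * q x) \<in> vanishing X"
        using AB(5) by (auto simp: vanishing_def intro: polynomial_functions.mult)
      ultimately show False using prime_RD(3)[OF pr] by blast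
    qed
    ultimately show "irreducible_space (subtopology (zariski sc) X)"
      unfolding irreducible_space_def cl by auto
  qed
  with X show ?thesis unfolding irreducible_variety_def by simp
qed (simp add: irreducible_variety_def)

text \<open>Chains of irreducible subsets are chains of primes above \<open>P\<close> with
  inclusions reversed, so \<open>chain_of_alg_indep\<close> and \<open>alg_indep_of_chain\<close>
  bound their lengths from both sides. The maximality of \<open>fs\<close> is later supplied by
  tangent spaces.\<close>

lemma variety_dim_eqI:
  assumes P: "prime_R P" and fs: "set fs \<subseteq> R" "alg_indep P fs"
    and max: "\<And>gs. set gs \<subseteq> R \<Longrightarrow> alg_indep P gs \<Longrightarrow> length gs \<le> length fs"
  shows "variety_dim sc (zero_locus P) = enat (length fs)"
proof -
  define X where "X = zero_locus P"
  have PR: "P \<subseteq> R" using ideal_RD(1)[OF prime_RD(1)[OF P]] by auto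
  have X: "closedin (zariski sc) X" unfolding X_def by (rule closedin_zero_locus[OF PR])
  have vX: "vanishing X = P" unfolding X_def by (rule vanishing_zero_locus[OF P])
  have iff: "closedin (subtopology (zariski sc) X) Z \<and>
      irreducible_space (subtopology (subtopology (zariski sc) X) Z) \<longleftrightarrow>
      Z \<subseteq> X \<and> irreducible_variety sc Z" for Z
    unfolding closedin_closed_subtopology[OF X] irreducible_variety_def subtopology_subtopology
    by (auto simp: Int_absorb1)
  define C where "C n Z \<longleftrightarrow> (\<forall>i\<le>n. Z i \<subseteq> X \<and> irreducible_variety sc (Z i)) \<and>
    (\<forall>i<n. Z i \<subset> Z (Suc i))" for n :: nat and Z
  have dim: "variety_dim sc X = Sup {enat n | n. \<exists>Z. C n Z}"
    unfolding variety_dim_def krull_dim_def C_def iff ..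
  have "\<exists>Z. C (length fs) Z"
  proof -
    obtain Q where Q: "\<And>i. i \<le> length fs \<Longrightarrow> prime_R (Q i)"
      "\<And>i. i < length fs \<Longrightarrow> Q (Suc i) \<subset> Q i" "Q (length fs) = P"
      using chain_of_alg_indep[OF P fs] by auto
    have le: "P \<subseteq> Q i" if "i \<le> length fs" for i
      using that
    proof (induction rule: inc_induct)
      case base
      then show ?case using Q(3) by simp
    next
      case (step n)
      then show ?case using Q(2)[of n] by auto
    qed
    have "C (length fs) (\<lambda>i. zero_locus (Q i))" unfolding C_def
    proof (intro conjI allI impI)
      fix i assume i: "i \<le> length fs"
      show "zero_locus (Q i) \<subseteq> X" using le[OF i] unfolding X_def zero_locus_def by auto
      have "Q i \<subseteq> R" using ideal_RD(1)[OF prime_RD(1)[OF Q(1)[OF i]]] by auto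
      then show "irreducible_variety sc (zero_locus (Q i))"
        unfolding irreducible_variety_iff vanishing_zero_locus[OF Q(1)[OF i]]
        using closedin_zero_locus Q(1)[OF i] by simp
    next
      fix i assume i: "i < length fs"
      have "zero_locus (Q i) \<subseteq> zero_locus (Q (Suc i))"
        using Q(2)[OF i] unfolding zero_locus_def by auto
      moreover have "zero_locus (Q i) \<noteq> zero_locus (Q (Suc i))"
        using Q(2)[OF i] vanishing_zero_locus Q(1)[of i] Q(1)[of "Suc i"] i
        by (metis Suc_leI less_imp_le_nat psubset_eq)
      ultimately show "zero_locus (Q i) \<subset> zero_locus (Q (Suc i))" by auto
    qed
    then show ?thesis by blast
  qed
  moreover have "n \<le> length fs" if "C n Z" for n Z
  proof -
    have Z: "\<And>i. i \<le> n \<Longrightarrow> irreducible_variety sc (Z i)" "\<And>i. i < n \<Longrightarrow> Z i \<subset> Z (Suc i)" "Z n \<subseteq> X"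
      using that unfolding C_def by auto
    obtain gs where gs: "length gs = n" "set gs \<subseteq> R" "alg_indep (vanishing (Z n)) gs"
    proof -
      have "\<exists>gs. length gs = n \<and> set gs \<subseteq> R \<and> alg_indep (vanishing (Z n)) gs"
      proof (rule alg_indep_of_chain[where P = "\<lambda>i. vanishing (Z i)"])
        show "prime_R (vanishing (Z i))" if "i \<le> n" for i
          using Z(1)[OF that] unfolding irreducible_variety_iff by simp
        fix i assume i: "i < n"
        have "vanishing (Z (Suc i)) \<subseteq> vanishing (Z i)" using Z(2)[OF i] by (auto simp: vanishing_def)
        moreover have "vanishing (Z (Suc i)) \<noteq> vanishing (Z i)"
          using Z(1)[of i] Z(1)[of "Suc i"] Z(2)[OF i] i zero_locus_vanishing
          unfolding irreducible_variety_iff by (metis Suc_leI less_imp_le_nat psubset_eq)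
        ultimately show "vanishing (Z (Suc i)) \<subset> vanishing (Z i)" by auto
      qed
      then show ?thesis using that by blast
    qed
    have "P \<subseteq> vanishing (Z n)" using Z(3) vX by (auto simp: vanishing_def)
    then show ?thesis using max[OF gs(2) alg_indep_antimono[OF gs(3)]] gs(1) by simp
  qed
  ultimately show ?thesis unfolding X_def[symmetric] dim
    by (intro antisym Sup_least Sup_upper) auto
qed

section \<open>Derivatives and tangent spaces\<close>

text \<open>The derivative along the complex line through \<open>y\<close> in direction
  \<open>v\<close>, which makes sense on a bare vector space.\<close>

definition D :: "('b \<Rightarrow> complex) \<Rightarrow> 'b \<Rightarrow> 'b \<Rightarrow> complex" where
  "D p y v = deriv (\<lambda>s. p (y + sc s v)) 0"

lemma linear_functional_simps:
  assumes "Vector_Spaces.linear sc (*) f"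
  shows "f (x + y) = f x + f y" "f (x - y) = f x - f y" "f (sc c x) = c * f x" "f 0 = 0"
    "f (\<Sum>i\<in>I. g i) = (\<Sum>i\<in>I. f (g i))"
proof -
  interpret f: Vector_Spaces.linear sc "(*)" f by fact
  show "f (x + y) = f x + f y" "f (x - y) = f x - f y" "f (sc c x) = c * f x" "f 0 = 0"
    "f (\<Sum>i\<in>I. g i) = (\<Sum>i\<in>I. f (g i))"
    by (simp_all add: f.add f.diff f.scale f.sum)
qed

lemma linear_functionalI:
  assumes "\<And>x y. f (x + y) = f x + f y" "\<And>c x. f (sc c x) = c * f x"
  shows "Vector_Spaces.linear sc (*) f"
proof -
  interpret m: vector_space "(*) :: complex \<Rightarrow> complex \<Rightarrow> complex"
    by unfold_locales (auto simp: algebra_simps)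
  show ?thesis by unfold_locales (auto simp: assms)
qed

lemma R_has_deriv:
  "p \<in> R \<Longrightarrow> ((\<lambda>s. p (y + sc s v)) has_field_derivative D p y v) (at 0)"
proof -
  assume "p \<in> R"
  then have "(\<lambda>s. p (y + sc s v)) field_differentiable at 0"
  proof induction
    case (functional f)
    have "(\<lambda>s. f y + s * f v) field_differentiable at 0"
      by (auto simp: field_differentiable_def intro!: exI derivative_eq_intros)
    then show ?case by (simp add: linear_functional_simps[OF functional])
  qed (auto intro: field_differentiable_add field_differentiable_mult)
  then show ?thesis unfolding D_def by (rule field_differentiable_derivI)
qed

lemma D_eqI: "((\<lambda>s. p (y + sc s v)) has_field_derivative d) (at 0) \<Longrightarrow> D p y v = d"
  unfolding D_def by (rule DERIV_imp_deriv)

lemma D_const: "D (\<lambda>x. c) y v = 0"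
  by (rule D_eqI) simp

lemma D_functional: "Vector_Spaces.linear sc (*) f \<Longrightarrow> D f y v = f v"
proof (rule D_eqI)
  assume f: "Vector_Spaces.linear sc (*) f"
  have "((\<lambda>s. f y + s * f v) has_field_derivative f v) (at 0)"
    by (auto intro!: derivative_eq_intros)
  then show "((\<lambda>s. f (y + sc s v)) has_field_derivative f v) (at 0)"
    by (simp add: linear_functional_simps[OF f])
qed

lemma D_add: "p \<in> R \<Longrightarrow> q \<in> R \<Longrightarrow> D (\<lambda>x. p x + q x) y v = D p y v + D q y v"
  by (rule D_eqI) (intro DERIV_add R_has_deriv)

lemma D_mult: "p \<in> R \<Longrightarrow> q \<in> R \<Longrightarrow> D (\<lambda>x. p x * q x) y v = p y * D q y v + D p y v * q y"
  by (rule D_eqI, rule DERIV_cong[OF DERIV_mult[OF R_has_deriv R_has_deriv]]) (auto simp: mult.commute)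

lemma D_power: "p \<in> R \<Longrightarrow> D (\<lambda>x. p x ^ k) y v = of_nat k * p y ^ (k - 1) * D p y v"
  by (rule D_eqI, rule DERIV_cong[OF DERIV_power[OF R_has_deriv]]) (auto simp: mult_ac)

lemma D_sum:
  "(\<And>i. i \<in> I \<Longrightarrow> p i \<in> R) \<Longrightarrow> D (\<lambda>x. \<Sum>i\<in>I. p i x) y v = (\<Sum>i\<in>I. D (p i) y v)"
  by (rule D_eqI) (intro DERIV_sum R_has_deriv)

lemma D_coord_expansion: "p \<in> R \<Longrightarrow> D p y v = (\<Sum>b\<in>Basis. coord b v * D p y b)"
proof (induction rule: polynomial_functions.induct)
  case (functional f)
  then show ?case by (simp add: D_functional linear_functional_coord[symmetric])
next
  case (add p q)
  then show ?case by (simp add: D_add algebra_simps sum.distrib)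
next
  case (mult p q)
  have "(\<Sum>b\<in>Basis. coord b v * D (\<lambda>x. p x * q x) y b) =
      p y * (\<Sum>b\<in>Basis. coord b v * D q y b) + (\<Sum>b\<in>Basis. coord b v * D p y b) * q y"
    using mult.hyps
    by (simp add: D_mult algebra_simps sum.distrib sum_distrib_left sum_distrib_right)
  also have "\<dots> = D (\<lambda>x. p x * q x) y v"
    unfolding mult.IH[symmetric] using mult.hyps by (simp add: D_mult)
  finally show ?case ..
qed (simp add: D_const)

lemma linear_D: "p \<in> R \<Longrightarrow> Vector_Spaces.linear sc (*) (D p y)"
proof (rule linear_functionalI)
  assume p: "p \<in> R"
  note D = D_coord_expansion[OF p]
  show "D p y (v + w) = D p y v + D p y w" for v w
    unfolding D[of y "v + w"] D[of y v] D[of y w]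
    by (simp add: coord_simps distrib_right sum.distrib)
  show "D p y (sc c v) = c * D p y v" for c v
    unfolding D[of y "sc c v"] D[of y v] by (simp add: coord_simps mult.assoc sum_distrib_left)
qed

lemma D_in_R: "p \<in> R \<Longrightarrow> (\<lambda>y. D p y v) \<in> R"
proof (induction rule: polynomial_functions.induct)
  case (functional f)
  then show ?case by (simp add: D_functional polynomial_functions.const)
next
  case (add p q)
  then show ?case by (simp add: D_add polynomial_functions.add)
next
  case (mult p q)
  then show ?case by (auto simp: D_mult intro: polynomial_functions.intros)
qed (simp add: D_const polynomial_functions.const)

section \<open>Tangent spaces and linear functionals depending polynomially on a point\<close>

definition tang :: "('b \<Rightarrow> complex) set \<Rightarrow> 'b \<Rightarrow> 'b set" where
  "tang P y = {v. \<forall>p\<in>P. D p y v = 0}"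

definition poly_map :: "('b \<Rightarrow> 'b) \<Rightarrow> bool" where
  "poly_map w \<longleftrightarrow> (\<forall>b. (\<lambda>y. coord b (w y)) \<in> R)"

definition poly_family :: "('b \<Rightarrow> 'b \<Rightarrow> complex) \<Rightarrow> bool" where
  "poly_family \<phi> \<longleftrightarrow> (\<forall>y. Vector_Spaces.linear sc (*) (\<phi> y)) \<and> (\<forall>v. (\<lambda>y. \<phi> y v) \<in> R)"

lemma poly_family_eval:
  assumes "poly_family \<phi>" "poly_map w"
  shows "(\<lambda>y. \<phi> y (w y)) \<in> R"
proof -
  have "(\<lambda>y. \<phi> y (w y)) = (\<lambda>y. \<Sum>b\<in>Basis. coord b (w y) * \<phi> y b)"
    using assms linear_functional_coord unfolding poly_family_def by blast
  also have "\<dots> \<in> R"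
    using assms unfolding poly_family_def poly_map_def
    by (intro R_sum polynomial_functions.mult) auto
  finally show ?thesis .
qed

lemma poly_family_simps:
  assumes "poly_family \<phi>"
  shows "\<phi> z (x + y) = \<phi> z x + \<phi> z y" "\<phi> z (x - y) = \<phi> z x - \<phi> z y" "\<phi> z (sc c x) = c * \<phi> z x"
    "\<phi> z 0 = 0" "\<phi> z (\<Sum>i\<in>I. g i) = (\<Sum>i\<in>I. \<phi> z (g i))"
proof -
  have "Vector_Spaces.linear sc (*) (\<phi> z)" using assms unfolding poly_family_def by blast
  note lin = linear_functional_simps[OF this]
  show "\<phi> z (x + y) = \<phi> z x + \<phi> z y" "\<phi> z (x - y) = \<phi> z x - \<phi> z y"
    "\<phi> z (sc c x) = c * \<phi> z x" "\<phi> z 0 = 0" "\<phi> z (\<Sum>i\<in>I. g i) = (\<Sum>i\<in>I. \<phi> z (g i))"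
    by (rule lin)+
qed

lemma poly_family_D: "p \<in> R \<Longrightarrow> poly_family (D p)"
  unfolding poly_family_def using linear_D D_in_R by auto

lemma subspace_kernel:
  assumes "\<And>\<phi>. \<phi> \<in> \<Phi> \<Longrightarrow> poly_family \<phi>" "subspace W"
  shows "subspace {v \<in> W. \<forall>\<phi>\<in>\<Phi>. \<phi> y v = 0}"
  using assms by (auto simp: subspace_def poly_family_simps)

text \<open>Gaussian elimination with polynomial entries: independence at one point modulo the common
  kernel persists where the pivots do not vanish.\<close>

lemma generic_independence:
  assumes "finite I" "\<And>\<phi>. \<phi> \<in> \<Phi> \<Longrightarrow> poly_family \<phi>" "\<And>i. i \<in> I \<Longrightarrow> poly_map (w i)"
    and "\<And>c. (\<forall>\<phi>\<in>\<Phi>. \<phi> y0 (\<Sum>i\<in>I. sc (c i) (w i y0)) = 0) \<Longrightarrow> \<forall>i\<in>I. c i = 0"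
  shows "\<exists>h\<in>R. h y0 \<noteq> 0 \<and>
    (\<forall>y c. h y \<noteq> 0 \<longrightarrow> (\<forall>\<phi>\<in>\<Phi>. \<phi> y (\<Sum>i\<in>I. sc (c i) (w i y)) = 0) \<longrightarrow> (\<forall>i\<in>I. c i = 0))"
  using assms
proof (induction I arbitrary: w rule: finite_induct)
  case empty
  show ?case by (intro bexI[of _ "\<lambda>x. 1"]) (auto intro: polynomial_functions.const)
next
  case (insert k I)
  have fam: "poly_family \<phi>" if "\<phi> \<in> \<Phi>" for \<phi> using insert.prems(1) that .
  have "\<exists>\<phi>\<in>\<Phi>. \<phi> y0 (w k y0) \<noteq> 0"
  proof (rule ccontr)
    assume "\<not> ?thesis"
    moreover have "(\<Sum>i\<in>insert k I. sc ((\<lambda>i. if i = k then 1 else 0) i) (w i y0)) = w k y0"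
    proof -
      have "(\<Sum>i\<in>I. sc (if i = k then 1 else 0) (w i y0)) = 0"
        using insert.hyps by (intro sum.neutral) auto
      then show ?thesis using insert.hyps by simp
    qed
    ultimately show False using insert.prems(3)[of "\<lambda>i. if i = k then 1 else 0"] by auto
  qed
  then obtain \<phi>0 where \<phi>0: "\<phi>0 \<in> \<Phi>" "\<phi>0 y0 (w k y0) \<noteq> 0" by auto
  define \<delta> where "\<delta> y = \<phi>0 y (w k y)" for y
  \<comment> \<open>Elimination without division: \<open>\<phi>0 y\<close> kills every
    \<open>w' i y\<close>, and the pivot enters as a factor, so the entries stay polynomial.\<close>
  define w' where "w' i y = sc (\<delta> y) (w i y) - sc (\<phi>0 y (w i y)) (w k y)" for i y
  have \<delta>R: "\<delta> \<in> R" unfolding \<delta>_def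
    by (rule poly_family_eval[OF fam[OF \<phi>0(1)]]) (use insert.prems(2) in auto)
  have w'sum: "(\<Sum>i\<in>I. sc (c i) (w' i y)) =
      sc (\<delta> y) (\<Sum>i\<in>I. sc (c i) (w i y)) - sc (\<Sum>i\<in>I. c i * \<phi>0 y (w i y)) (w k y)" for c y
    unfolding w'_def
    by (simp add: scale_right_diff_distrib sum_subtractf scale_sum_right scale_sum_left mult_ac)
  have "\<exists>h\<in>R. h y0 \<noteq> 0 \<and>
    (\<forall>y c. h y \<noteq> 0 \<longrightarrow> (\<forall>\<phi>\<in>\<Phi>. \<phi> y (\<Sum>i\<in>I. sc (c i) (w' i y)) = 0) \<longrightarrow> (\<forall>i\<in>I. c i = 0))"
  proof (rule insert.IH[OF fam])
    fix i assume i: "i \<in> I"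
    show "poly_map (w' i)" unfolding poly_map_def
    proof
      fix b
      have "(\<lambda>y. coord b (w j y)) \<in> R" if "j \<in> insert k I" for j
        using insert.prems(2)[OF that] unfolding poly_map_def by auto
      then have "(\<lambda>y. \<delta> y * coord b (w i y) - \<phi>0 y (w i y) * coord b (w k y)) \<in> R"
        using i insert.prems(2)
        by (intro R_diff polynomial_functions.mult \<delta>R poly_family_eval[OF fam[OF \<phi>0(1)]]) auto
      then show "(\<lambda>y. coord b (w' i y)) \<in> R" unfolding w'_def coord_simps .
    qed
  next
    fix c assume c: "\<forall>\<phi>\<in>\<Phi>. \<phi> y0 (\<Sum>i\<in>I. sc (c i) (w' i y0)) = 0"
    define c' where "c' i = (if i = k then - (\<Sum>i\<in>I. c i * \<phi>0 y0 (w i y0)) else \<delta> y0 * c i)" for i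
    have "(\<Sum>i\<in>insert k I. sc (c' i) (w i y0)) = (\<Sum>i\<in>I. sc (c i) (w' i y0))"
    proof -
      have "(\<Sum>i\<in>I. sc (c' i) (w i y0)) = sc (\<delta> y0) (\<Sum>i\<in>I. sc (c i) (w i y0))"
        unfolding scale_sum_right using insert.hyps by (intro sum.cong) (auto simp: c'_def)
      then show ?thesis unfolding w'sum using insert.hyps by (simp add: c'_def)
    qed
    then have "\<forall>i\<in>insert k I. c' i = 0" using insert.prems(3)[of c'] c by simp
    then show "\<forall>i\<in>I. c i = 0" using insert.hyps \<phi>0(2) by (auto simp: c'_def \<delta>_def split: if_splits)
  qed
  then obtain h where h: "h \<in> R" "h y0 \<noteq> 0" "\<And>y c. h y \<noteq> 0 \<Longrightarrow>
      (\<forall>\<phi>\<in>\<Phi>. \<phi> y (\<Sum>i\<in>I. sc (c i) (w' i y)) = 0) \<Longrightarrow> \<forall>i\<in>I. c i = 0" by blast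
  show ?case
  proof (intro bexI[of _ "\<lambda>y. h y * \<delta> y"] conjI allI impI)
    show "(\<lambda>y. h y * \<delta> y) \<in> R" by (intro polynomial_functions.mult h \<delta>R)
    show "h y0 * \<delta> y0 \<noteq> 0" using h \<phi>0 by (simp add: \<delta>_def)
    fix y c assume hy: "h y * \<delta> y \<noteq> 0"
      and c: "\<forall>\<phi>\<in>\<Phi>. \<phi> y (\<Sum>i\<in>insert k I. sc (c i) (w i y)) = 0"
    have s: "(\<Sum>i\<in>insert k I. sc (c i) (w i y)) = sc (c k) (w k y) + (\<Sum>i\<in>I. sc (c i) (w i y))"
      using insert.hyps by simp
    have "c k * \<delta> y + (\<Sum>i\<in>I. c i * \<phi>0 y (w i y)) = 0"
      using c \<phi>0(1) unfolding s by (auto simp: poly_family_simps[OF fam] \<delta>_def)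
    then have k: "(\<Sum>i\<in>I. c i * \<phi>0 y (w i y)) = - (\<delta> y * c k)" by (simp add: algebra_simps eq_neg_iff_add_eq_0)
    have "(\<Sum>i\<in>I. sc (c i) (w' i y)) = sc (\<delta> y) (\<Sum>i\<in>insert k I. sc (c i) (w i y))"
      unfolding w'sum k s by (simp add: scale_right_distrib)
    then have "\<forall>\<phi>\<in>\<Phi>. \<phi> y (\<Sum>i\<in>I. sc (c i) (w' i y)) = 0"
      using c by (auto simp: poly_family_simps[OF fam])
    then have c0: "\<forall>i\<in>I. c i = 0" using h(3) hy by auto
    then have "c k * \<delta> y = 0" using k by auto
    then show "\<forall>i\<in>insert k I. c i = 0" using hy c0 by auto
  qed
qed

text \<open>A complement of the kernel at \<open>y0\<close> inside \<open>W\<close> is spanned by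
  vectors independent modulo that kernel. By \<open>generic_independence\<close> it meets the kernel
  at \<open>y\<close> trivially wherever \<open>h\<close> is nonzero, which bounds the dimension
  there. The family \<open>\<Phi>\<close> may be infinite, as it is for the differentials of a whole
  ideal.\<close>

lemma kernel_semicontinuous:
  assumes "\<forall>\<phi>\<in>\<Phi>. poly_family \<phi>" and W: "subspace W"
  shows "\<exists>h\<in>R. h y0 \<noteq> 0 \<and> (\<forall>y. h y \<noteq> 0 \<longrightarrow>
    dim {v \<in> W. \<forall>\<phi>\<in>\<Phi>. \<phi> y v = 0} \<le> dim {v \<in> W. \<forall>\<phi>\<in>\<Phi>. \<phi> y0 v = 0})"
proof -
  note fam = assms(1)[rule_format]
  define K where "K y = {v \<in> W. \<forall>\<phi>\<in>\<Phi>. \<phi> y v = 0}" for y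
  have K: "subspace (K y)" for y unfolding K_def by (rule subspace_kernel[OF fam W])
  obtain A where A: "A \<subseteq> K y0" "independent A" "K y0 \<subseteq> span A" "card A = dim (K y0)"
    using basis_exists by blast
  have "A \<subseteq> W" using A(1) unfolding K_def by auto
  then obtain A' where A': "A \<subseteq> A'" "A' \<subseteq> W" "independent A'" "W \<subseteq> span A'"
    using maximal_independent_subset_extend[OF _ A(2)] by blast
  have fin: "finite A'" "finite A" using A(2) A'(3) finiteI_independent by auto
  define C where "C = A' - A"
  have finC: "finite C" unfolding C_def using fin by auto
  have dimW: "dim W = card A'" using A' by (metis basis_card_eq_dim)
  have cardC: "card A' = card A + card C" unfolding C_def using A'(1) fin
    by (metis card_Diff_subset card_mono le_add_diff_inverse)
  have indC: "independent C" using A'(3) independent_mono unfolding C_def by blast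
  have "\<exists>h\<in>R. h y0 \<noteq> 0 \<and>
    (\<forall>y c. h y \<noteq> 0 \<longrightarrow> (\<forall>\<phi>\<in>\<Phi>. \<phi> y (\<Sum>b\<in>C. sc (c b) ((\<lambda>b y. b) b y)) = 0) \<longrightarrow> (\<forall>b\<in>C. c b = 0))"
  proof (rule generic_independence[OF finC fam])
    fix b assume "b \<in> C"
    show "poly_map (\<lambda>y. b)" unfolding poly_map_def by (auto intro: polynomial_functions.const)
  next
    fix c assume c: "\<forall>\<phi>\<in>\<Phi>. \<phi> y0 (\<Sum>b\<in>C. sc (c b) b) = 0"
    define v where "v = (\<Sum>b\<in>C. sc (c b) b)"
    have "v \<in> W" unfolding v_def using A'(2) by (intro subspace_sum[OF W] subspace_scale[OF W]) (auto simp: C_def)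
    then have v: "v \<in> span A" using c A(3) unfolding K_def v_def by auto
    have rep: "representation A' v b = (\<Sum>b'\<in>C. c b' * (if b = b' then 1 else 0))" for b
    proof -
      have "representation A' v b = (\<Sum>b'\<in>C. representation A' (sc (c b') b') b)"
        unfolding v_def using A'(3)
        by (subst representation_sum) (auto simp: C_def intro: span_scale[OF span_base])
      also have "\<dots> = (\<Sum>b'\<in>C. c b' * representation A' b' b)"
        using A'(3) by (intro sum.cong refl) (auto simp: representation_scale span_base C_def)
      also have "\<dots> = (\<Sum>b'\<in>C. c b' * (if b = b' then 1 else 0))"
        using A'(3) by (intro sum.cong refl) (auto simp: representation_basis C_def)
      finally show ?thesis .
    qed
    show "\<forall>b\<in>C. c b = 0"
    proof
      fix b assume b: "b \<in> C"
      have "representation A' v b = representation A v b"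
        using representation_extend[OF A'(3) v A'(1)] by simp
      also have "\<dots> = 0" using representation_ne_zero[of A v b] b by (auto simp: C_def)
      finally show "c b = 0" unfolding rep using b finC by (simp add: if_distrib cong: if_cong)
    qed
  qed
  then obtain h where h: "h \<in> R" "h y0 \<noteq> 0" "\<forall>y c. h y \<noteq> 0 \<longrightarrow>
      (\<forall>\<phi>\<in>\<Phi>. \<phi> y (\<Sum>b\<in>C. sc (c b) b) = 0) \<longrightarrow> (\<forall>b\<in>C. c b = 0)" by (elim bexE conjE)
  have "dim (K y) \<le> dim (K y0)" if hy: "h y \<noteq> 0" for y
  proof -
    have "K y \<inter> span C \<subseteq> {0}"
    proof
      fix v assume v: "v \<in> K y \<inter> span C"
      then obtain c where c: "v = (\<Sum>b\<in>C. sc (c b) b)"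
        using span_finite[OF finC] by blast
      have "\<forall>\<phi>\<in>\<Phi>. \<phi> y v = 0" using v unfolding K_def by simp
      then have "\<forall>b\<in>C. c b = 0" using h(3) hy unfolding c by blast
      then show "v \<in> {0}" using c by simp
    qed
    then have "dim (K y \<inter> span C) = 0" by simp
    moreover have "{x + z |x z. x \<in> K y \<and> z \<in> span C} \<subseteq> W"
    proof -
      have "span C \<subseteq> W" using A'(2) by (intro span_minimal W) (auto simp: C_def)
      then show ?thesis using subspace_add[OF W] unfolding K_def by auto
    qed
    then have "dim {x + z |x z. x \<in> K y \<and> z \<in> span C} \<le> dim W" by (rule dim_subset)
    moreover have "dim (span C) = card C" using indC by (simp add: dim_eq_card_independent)
    ultimately show ?thesis
      using dim_sums_Int[OF K[of y] subspace_span[of C]] dimW cardC A(4) by linarith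
  qed
  then show ?thesis using h unfolding K_def by blast
qed

text \<open>Taylor expansion to first order with a polynomial remainder absorbed into the
  coefficients. At another zero \<open>x\<close> of \<open>p\<close> it becomes a linear equation
  for \<open>x - c\<close>, whose coefficients depend polynomially on \<open>x\<close> and
  specialise to the differential at \<open>c\<close>.\<close>

lemma hadamard:
  assumes "p \<in> R"
  shows "\<exists>g. (\<forall>b. g b \<in> R) \<and> (\<forall>x. p x - p c = (\<Sum>b\<in>Basis. g b x * coord b (x - c))) \<and>
    (\<forall>b\<in>Basis. g b c = D p c b)"
proof -
  define H where "H p g \<longleftrightarrow> (\<forall>b. g b \<in> R) \<and> (\<forall>x. p x - p c = (\<Sum>b\<in>Basis. g b x * coord b (x - c))) \<and>
    (\<forall>b\<in>Basis. g b c = D p c b)" for p g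
  have "\<exists>g. H p g"
    using assms
  proof induction
    case (const a)
    show ?case unfolding H_def by (intro exI[of _ "\<lambda>b x. 0"]) (auto simp: D_const intro: polynomial_functions.const)
  next
    case (functional f)
    have "f x - f c = (\<Sum>b\<in>Basis. f b * coord b (x - c))" for x
      using linear_functional_coord[OF functional, of "x - c"]
      by (simp add: linear_functional_simps[OF functional] mult.commute)
    then show ?case unfolding H_def
      by (intro exI[of _ "\<lambda>b x. f b"])
         (auto simp: D_functional[OF functional] intro: polynomial_functions.const)
  next
    case (add p q)
    then obtain g k where "H p g" "H q k" by blast
    then have g: "\<And>b. g b \<in> R" "\<And>x. p x - p c = (\<Sum>b\<in>Basis. g b x * coord b (x - c))"
      "\<And>b. b \<in> Basis \<Longrightarrow> g b c = D p c b" and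
      k: "\<And>b. k b \<in> R" "\<And>x. q x - q c = (\<Sum>b\<in>Basis. k b x * coord b (x - c))"
      "\<And>b. b \<in> Basis \<Longrightarrow> k b c = D q c b" unfolding H_def by blast+
    have "(p x + q x) - (p c + q c) = (\<Sum>b\<in>Basis. (g b x + k b x) * coord b (x - c))" for x
      using g(2)[of x] k(2)[of x] by (simp add: distrib_right sum.distrib algebra_simps)
    then show ?case using add.hyps g k unfolding H_def
      by (intro exI[of _ "\<lambda>b x. g b x + k b x"]) (auto simp: D_add intro: polynomial_functions.add)
  next
    case (mult p q)
    then obtain g k where "H p g" "H q k" by blast
    then have g: "\<And>b. g b \<in> R" "\<And>x. p x - p c = (\<Sum>b\<in>Basis. g b x * coord b (x - c))"
      "\<And>b. b \<in> Basis \<Longrightarrow> g b c = D p c b" and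
      k: "\<And>b. k b \<in> R" "\<And>x. q x - q c = (\<Sum>b\<in>Basis. k b x * coord b (x - c))"
      "\<And>b. b \<in> Basis \<Longrightarrow> k b c = D q c b" unfolding H_def by blast+
    have "p x * q x - p c * q c = (\<Sum>b\<in>Basis. (p x * k b x + g b x * q c) * coord b (x - c))" for x
    proof -
      have "p x * q x - p c * q c = p x * (q x - q c) + (p x - p c) * q c" by (simp add: algebra_simps)
      also have "\<dots> = (\<Sum>b\<in>Basis. (p x * k b x + g b x * q c) * coord b (x - c))"
        unfolding g(2) k(2)
        unfolding sum_distrib_left sum_distrib_right sum.distrib[symmetric]
        by (intro sum.cong refl) (simp add: algebra_simps)
      finally show ?thesis .
    qed
    then show ?case using mult.hyps g k unfolding H_def
      by (intro exI[of _ "\<lambda>b x. p x * k b x + g b x * q c"])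
         (auto simp: D_mult intro!: polynomial_functions.add polynomial_functions.mult[OF mult.hyps(1)]
          polynomial_functions.mult[OF _ polynomial_functions.const])
  qed
  then show ?thesis unfolding H_def .
qed

lemma subspace_tang: "P \<subseteq> R \<Longrightarrow> subspace (tang P y)"
  using subspace_kernel[of "D ` P" UNIV y] poly_family_D by (auto simp: tang_def image_iff)

lemma coord_eqI: "(\<And>b. b \<in> Basis \<Longrightarrow> coord b x = coord b y) \<Longrightarrow> x = y"
  using sum_coord[of x] sum_coord[of y] by (metis (no_types, lifting) sum.cong)

text \<open>By \<open>hadamard\<close>, \<open>y - c\<close> solves a linear system for every
  \<open>y\<close> in the locus. At \<open>c\<close> the system has trivial kernel, hence also where
  some \<open>h\<close> is nonzero, and there \<open>y = c\<close>. So \<open>h\<close> times a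
  centred coordinate lies in \<open>P\<close>, and primality removes \<open>h\<close>.\<close>

lemma isolated_point:
  assumes P: "prime_R P" and c: "c \<in> zero_locus P" and T: "dim (tang P c) = 0"
    and x: "x \<in> zero_locus P"
  shows "x = c"
proof -
  have PR: "P \<subseteq> R" using ideal_RD(1)[OF prime_RD(1)[OF P]] by auto
  have "\<forall>p\<in>P. \<exists>g. (\<forall>b. g b \<in> R) \<and> (\<forall>x. p x - p c = (\<Sum>b\<in>Basis. g b x * coord b (x - c))) \<and>
    (\<forall>b\<in>Basis. g b c = D p c b)" using hadamard PR by blast
  then obtain g where g: "\<And>p b. p \<in> P \<Longrightarrow> g p b \<in> R"
    "\<And>p x. p \<in> P \<Longrightarrow> p x - p c = (\<Sum>b\<in>Basis. g p b x * coord b (x - c))"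
    "\<And>p b. p \<in> P \<Longrightarrow> b \<in> Basis \<Longrightarrow> g p b c = D p c b" unfolding bchoice_iff by metis
  define \<Phi> where "\<Phi> = (\<lambda>p x v. \<Sum>b\<in>Basis. g p b x * coord b v) ` P"
  have fam: "\<forall>\<phi>\<in>\<Phi>. poly_family \<phi>"
  proof
    fix \<phi> assume \<phi>: "\<phi> \<in> \<Phi>"
    obtain p where p: "\<phi> = (\<lambda>x v. \<Sum>b\<in>Basis. g p b x * coord b v)" "p \<in> P"
      using \<phi> unfolding \<Phi>_def by (rule imageE)
    show "poly_family \<phi>" unfolding poly_family_def p(1)
      using g(1)[OF p(2)]
      by (auto intro!: linear_functionalI R_sum polynomial_functions.mult polynomial_functions.const
          simp: coord_simps algebra_simps sum.distrib sum_distrib_left)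
  qed
  obtain h where h: "h \<in> R" "h c \<noteq> 0" "\<And>y. h y \<noteq> 0 \<Longrightarrow>
    dim {v \<in> UNIV. \<forall>\<phi>\<in>\<Phi>. \<phi> y v = 0} \<le> dim {v \<in> UNIV. \<forall>\<phi>\<in>\<Phi>. \<phi> c v = 0}"
    using kernel_semicontinuous[OF fam subspace_UNIV, of c] by blast
  have "{v \<in> UNIV. \<forall>\<phi>\<in>\<Phi>. \<phi> c v = 0} = tang P c"
  proof -
    have "(\<Sum>b\<in>Basis. g p b c * coord b v) = D p c v" if "p \<in> P" for p v
    proof -
      have "D p c v = (\<Sum>b\<in>Basis. coord b v * D p c b)"
        using D_coord_expansion PR that by blast
      then show ?thesis using g(3)[OF that] by (simp add: mult.commute)
    qed
    then show ?thesis unfolding \<Phi>_def tang_def by auto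
  qed
  then have K0: "{v. \<forall>\<phi>\<in>\<Phi>. \<phi> y v = 0} \<subseteq> {0}" if "h y \<noteq> 0" for y
    using h(3)[OF that] T by simp
  have gen: "y = c" if y: "y \<in> zero_locus P" "h y \<noteq> 0" for y
  proof -
    have "(\<Sum>b\<in>Basis. g p b y * coord b (y - c)) = 0" if "p \<in> P" for p
    proof -
      have "p y = 0" "p c = 0" using y(1) c that by (auto simp: zero_locus_def)
      then show ?thesis using g(2)[OF that, of y] by simp
    qed
    then have "y - c \<in> {v. \<forall>\<phi>\<in>\<Phi>. \<phi> y v = 0}" unfolding \<Phi>_def by auto
    then show ?thesis using K0[OF y(2)] by auto
  qed
  show "x = c"
  proof (rule coord_eqI)
    fix b
    have "(\<lambda>y. h y * (coord b y - coord b c)) \<in> vanishing (zero_locus P)"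
      unfolding vanishing_def using gen
      by (auto intro!: polynomial_functions.mult R_diff h coord_in_R polynomial_functions.const)
    then have "(\<lambda>y. h y * (coord b y - coord b c)) \<in> P" unfolding vanishing_zero_locus[OF P] .
    moreover have "h \<notin> P" using h(2) c by (auto simp: zero_locus_def)
    moreover have "(\<lambda>y. coord b y - coord b c) \<in> R"
      by (intro R_diff coord_in_R polynomial_functions.const)
    ultimately have "(\<lambda>y. coord b y - coord b c) \<in> P"
      using prime_RD(3)[OF P h(1)] by blast
    then show "coord b x = coord b c" using x by (auto simp: zero_locus_def)
  qed
qed

section \<open>The Krull dimension is the generic dimension of the tangent space\<close>

lemma dim_hyperplane:
  assumes S: "subspace S" and l: "Vector_Spaces.linear sc (*) l"
  shows "subspace (S \<inter> {v. l v = 0})" "dim S \<le> Suc (dim (S \<inter> {v. l v = 0}))"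
    "\<exists>v\<in>S. l v \<noteq> 0 \<Longrightarrow> dim (S \<inter> {v. l v = 0}) < dim S"
proof -
  note lin = linear_functional_simps[OF l]
  show sub: "subspace (S \<inter> {v. l v = 0})" using S by (auto simp: subspace_def lin)
  show "dim S \<le> Suc (dim (S \<inter> {v. l v = 0}))"
  proof (cases "\<exists>u\<in>S. l u \<noteq> 0")
    case True
    then obtain u where u: "u \<in> S" "l u \<noteq> 0" by auto
    have "S \<subseteq> span (insert u (S \<inter> {v. l v = 0}))"
    proof
      fix v assume v: "v \<in> S"
      have "v - sc (l v / l u) u \<in> S \<inter> {v. l v = 0}"
        using u v S by (auto simp: lin subspace_diff subspace_scale)
      then have "v - sc (l v / l u) u \<in> span (S \<inter> {v. l v = 0})" by (rule span_base)
      then show "v \<in> span (insert u (S \<inter> {v. l v = 0}))" unfolding span_insert by blast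
    qed
    then have "dim S \<le> dim (insert u (S \<inter> {v. l v = 0}))" by (rule dim_mono)
    also have "\<dots> \<le> Suc (dim (S \<inter> {v. l v = 0}))" by (simp add: dim_insert)
    finally show ?thesis .
  next
    case False
    then have "S \<inter> {v. l v = 0} = S" by auto
    then show ?thesis by simp
  qed
  assume "\<exists>v\<in>S. l v \<noteq> 0"
  then have "S \<inter> {v. l v = 0} \<subset> S" by auto
  then show "dim (S \<inter> {v. l v = 0}) < dim S"
    using dim_psubset[of "S \<inter> {v. l v = 0}" S] sub S by (metis span_eq_iff)
qed

lemma dim_le_functionals:
  assumes "subspace S" "\<And>l. l \<in> set ls \<Longrightarrow> Vector_Spaces.linear sc (*) l"
    "\<And>v. v \<in> S \<Longrightarrow> \<forall>l\<in>set ls. l v = 0 \<Longrightarrow> v = 0"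
  shows "dim S \<le> length ls"
  using assms
proof (induction ls arbitrary: S)
  case Nil
  then have "S \<subseteq> {0}" by auto
  then show ?case by simp
next
  case (Cons l ls)
  have "dim (S \<inter> {v. l v = 0}) \<le> length ls"
    using Cons.prems dim_hyperplane(1)[OF Cons.prems(1)] by (intro Cons.IH) auto
  then show ?case using dim_hyperplane(2)[OF Cons.prems(1), of l] Cons.prems(2) by simp
qed

lemma not_transc_mem:
  assumes "t \<in> A" "A = subalg F" "(\<lambda>x. 0) \<in> P"
  shows "\<not> transc P A t"
proof
  assume tr: "transc P A t"
  have "(\<lambda>x. [:- t x, 1:]) \<in> polys_over A"
  proof (rule polys_overI[where n = 1])
    fix i
    consider "i = 0" | "i = 1" | j where "i = Suc (Suc j)"
      by (metis One_nat_def not0_implies_Suc)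
    then show "(\<lambda>x. coeff [:- t x, 1:] i) \<in> A"
      using assms subalg_cmult[of t F "-1"] subalg.const[of _ F] by cases auto
  qed simp
  moreover have "(\<lambda>x. poly [:- t x, 1:] (t x)) \<in> P" using assms by simp
  ultimately show False using tr unfolding transc_def by fastforce
qed

text \<open>The finitely many coordinates are tried in turn, which ensures termination before any
  bound on the length of independent lists is known.\<close>

lemma extend_alg_indep:
  assumes P: "prime_R P" and fs: "set fs \<subseteq> R" "alg_indep P fs"
  shows "\<exists>gs. set gs \<subseteq> R \<and> alg_indep P (gs @ fs) \<and>
    (\<forall>b\<in>Basis. \<not> transc P (subalg (set (gs @ fs))) (coord b))"
proof -
  have "\<exists>gs. set gs \<subseteq> R \<and> alg_indep P (gs @ fs) \<and>
    (\<forall>b\<in>B. \<not> transc P (subalg (set (gs @ fs))) (coord b))" if "finite B" for B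
    using that
  proof induction
    case empty
    show ?case using fs by (intro exI[of _ "[]"]) auto
  next
    case (insert b B)
    then obtain gs where gs: "set gs \<subseteq> R" "alg_indep P (gs @ fs)"
      "\<forall>b\<in>B. \<not> transc P (subalg (set (gs @ fs))) (coord b)" by auto
    show ?case
    proof (cases "transc P (subalg (set (gs @ fs))) (coord b)")
      case True
      have mono: "subalg (set (gs @ fs)) \<subseteq> subalg (set ((coord b # gs) @ fs))"
        by (rule subalg_mono) auto
      have "\<not> transc P (subalg (set ((coord b # gs) @ fs))) (coord b)"
        by (rule not_transc_mem[OF _ refl ideal_RD(2)[OF prime_RD(1)[OF P]]]) (auto intro: subalg.gen)
      moreover have "\<forall>b'\<in>B. \<not> transc P (subalg (set ((coord b # gs) @ fs))) (coord b')"
        using gs(3) transc_antimono[OF _ order_refl mono] by blast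
      ultimately show ?thesis using gs True coord_in_R
        by (intro exI[of _ "coord b # gs"]) auto
    qed (use gs in auto)
  qed
  from this[OF finite_Basis] show ?thesis .
qed

text \<open>A relation is differentiated as long as the derivative is again a relation. In
  characteristic zero the derivative vanishes only for polynomials constant in \<open>t\<close>, and
  such a relation would be an element of \<open>A\<close> in \<open>P\<close>, hence zero.\<close>

lemma separable_relation:
  assumes P: "prime_R P" and F: "F \<subseteq> R" and A: "A = subalg F" "A \<inter> P \<subseteq> {\<lambda>x. 0}"
    and nt: "\<not> transc P A t"
  shows "\<exists>q\<in>polys_over A. (\<lambda>x. poly (q x) (t x)) \<in> P \<and> (\<lambda>x. poly (pderiv (q x)) (t x)) \<notin> P"
proof -
  have "\<exists>q\<in>polys_over A. (\<lambda>x. poly (q x) (t x)) \<in> P \<and> (\<lambda>x. poly (pderiv (q x)) (t x)) \<notin> P"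
    if "q \<in> polys_over A" "(\<lambda>x. poly (q x) (t x)) \<in> P" "q x0 \<noteq> 0" "\<And>x. degree (q x) \<le> n" for q x0 n
    using that
  proof (induction n arbitrary: q x0)
    case (0 q)
    define a where "a x = coeff (q x) 0" for x
    have "q x = [:a x:]" for x unfolding a_def using 0(4)[of x] by (metis coeff_pCons_0 degree_eq_zeroE le_zero_eq)
    moreover have "a \<in> A" using 0(1) unfolding a_def polys_over_def by auto
    moreover have "a \<in> P" using 0(2) calculation(1) by simp
    ultimately show ?case using A(2) 0(3) by auto
  next
    case (Suc n q)
    let ?q' = "\<lambda>x. pderiv (q x)"
    show ?case
    proof (cases "(\<lambda>x. poly (?q' x) (t x)) \<in> P")
      case True
      show ?thesis
      proof (cases "\<exists>x. ?q' x \<noteq> 0")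
        case ex: True
        have deg: "degree (?q' x) \<le> n" for x using Suc.prems(4)[of x] by (simp add: degree_pderiv)
        have "?q' \<in> polys_over A"
        proof (rule polys_overI[OF _ deg])
          fix i
          have "(\<lambda>x. coeff (q x) (Suc i)) \<in> A" using Suc.prems(1) unfolding polys_over_def by auto
          then show "(\<lambda>x. coeff (?q' x) i) \<in> A" unfolding coeff_pderiv A(1) by (rule subalg_cmult)
        qed
        then show ?thesis using Suc.IH[OF _ True _ deg] ex by blast
      next
        case False
        define a where "a x = coeff (q x) 0" for x
        have "q x = [:a x:]" for x
          unfolding a_def using False pderiv_eq_0_iff[of "q x"] by (metis coeff_pCons_0 degree_eq_zeroE)
        moreover have "a \<in> A" using Suc.prems(1) unfolding a_def polys_over_def by auto
        moreover have "a \<in> P" using Suc.prems(2) calculation(1) by simp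
        ultimately show ?thesis using A(2) Suc.prems(3) by auto
      qed
    qed (use Suc.prems in blast)
  qed
  then show ?thesis using nt unfolding transc_def polys_over_def by blast
qed

lemma D_subalg:
  assumes F: "F \<subseteq> R" and "\<And>f. f \<in> F \<Longrightarrow> D f y v = 0" and "a \<in> subalg F"
  shows "D a y v = 0"
  using assms(3)
proof induction
  case (add p q)
  then show ?case using subalg_R[OF F] by (subst D_add) auto
next
  case (mult p q)
  then show ?case using subalg_R[OF F] by (subst D_mult) auto
qed (auto simp: D_const assms)

lemma pderiv_sum': "pderiv (\<Sum>i\<in>I. p i) = (\<Sum>i\<in>I. pderiv (p i))"
  by (induction I rule: infinite_finite_induct) (auto simp: pderiv_add)

lemma D_poly:
  assumes F: "F \<subseteq> R" and q: "q \<in> polys_over (subalg F)" and t: "t \<in> R"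
    and D: "\<And>f. f \<in> F \<Longrightarrow> D f y v = 0"
  shows "D (\<lambda>x. poly (q x) (t x)) y v = poly (pderiv (q y)) (t y) * D t y v"
proof -
  obtain n where n: "\<And>x. degree (q x) \<le> n" using q unfolding polys_over_def by auto
  have cA: "(\<lambda>x. coeff (q x) i) \<in> subalg F" for i using q unfolding polys_over_def by auto
  then have cR: "(\<lambda>x. coeff (q x) i) \<in> R" for i using subalg_R[OF F] by auto
  have "D (\<lambda>x. poly (q x) (t x)) y v = D (\<lambda>x. \<Sum>i\<le>n. coeff (q x) i * t x ^ i) y v"
    using poly_bounded[OF n] by simp
  also have "\<dots> = (\<Sum>i\<le>n. D (\<lambda>x. coeff (q x) i * t x ^ i) y v)"
    by (intro D_sum polynomial_functions.mult cR R_power t)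
  also have "\<dots> = (\<Sum>i\<le>n. coeff (q y) i * (of_nat i * t y ^ (i - 1) * D t y v))"
    using D_subalg[OF F D cA]
    by (intro sum.cong refl) (simp add: D_mult[OF cR R_power[OF t]] D_power[OF t])
  also have "\<dots> = poly (pderiv (\<Sum>i\<le>n. monom (coeff (q y) i) i)) (t y) * D t y v"
    unfolding pderiv_sum' by (simp add: poly_sum pderiv_monom poly_monom sum_distrib_left sum_distrib_right mult_ac)
  also have "(\<Sum>i\<le>n. monom (coeff (q y) i) i) = q y" using n by (rule poly_as_sum_of_monoms')
  finally show ?thesis .
qed

text \<open>Differentiating a separable relation for a coordinate along \<open>v\<close> leaves the
  derivative of the relation times that coordinate of \<open>v\<close>, once the differentials of
  \<open>fs\<close> vanish on \<open>v\<close>. The function \<open>h\<close> is the product of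
  these derivatives over all coordinates.\<close>

lemma differentials_injective:
  assumes P: "prime_R P" and fs: "set fs \<subseteq> R" "alg_indep P fs"
    and alg: "\<And>b. b \<in> Basis \<Longrightarrow> \<not> transc P (subalg (set fs)) (coord b)"
  shows "\<exists>h\<in>R. h \<notin> P \<and> (\<forall>y\<in>zero_locus P. h y \<noteq> 0 \<longrightarrow>
    (\<forall>v\<in>tang P y. (\<forall>f\<in>set fs. D f y v = 0) \<longrightarrow> v = 0))"
proof -
  let ?A = "subalg (set fs)"
  have A0: "?A \<inter> P \<subseteq> {\<lambda>x. 0}" using alg_indep_Int[OF P fs(2)] by auto
  have "\<exists>h\<in>R. h \<notin> P \<and> (\<forall>y\<in>zero_locus P. h y \<noteq> 0 \<longrightarrow>
    (\<forall>v\<in>tang P y. (\<forall>f\<in>set fs. D f y v = 0) \<longrightarrow> (\<forall>b\<in>B. coord b v = 0)))"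
    if "finite B" "B \<subseteq> Basis" for B
    using that
  proof induction
    case empty
    show ?case by (intro bexI[of _ "\<lambda>x. 1"]) (auto simp: prime_RD(2)[OF P] intro: polynomial_functions.const)
  next
    case (insert b B)
    then obtain h where h: "h \<in> R" "h \<notin> P" "\<forall>y\<in>zero_locus P. h y \<noteq> 0 \<longrightarrow>
      (\<forall>v\<in>tang P y. (\<forall>f\<in>set fs. D f y v = 0) \<longrightarrow> (\<forall>b\<in>B. coord b v = 0))" by auto
    obtain q where q: "q \<in> polys_over ?A" "(\<lambda>x. poly (q x) (coord b x)) \<in> P"
      "(\<lambda>x. poly (pderiv (q x)) (coord b x)) \<notin> P"
      using separable_relation[OF P fs(1) refl A0] alg insert.prems by blast
    define k where "k x = poly (pderiv (q x)) (coord b x)" for x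
    have kR: "k \<in> R"
    proof -
      obtain n where n: "\<And>x. degree (q x) \<le> n" using q unfolding polys_over_def by auto
      have "k = (\<lambda>x. \<Sum>i\<le>n. coeff (pderiv (q x)) i * coord b x ^ i)"
        unfolding k_def using n by (intro ext poly_bounded) (simp add: degree_pderiv le_diff_conv le_SucI)
      also have "\<dots> \<in> R"
        unfolding coeff_pderiv using q(1) subalg_R[OF fs(1)] unfolding polys_over_def
        by (intro R_sum polynomial_functions.mult R_cmult R_power coord_in_R) auto
      finally show ?thesis .
    qed
    show ?case
    proof (intro bexI[of _ "\<lambda>x. h x * k x"] conjI ballI impI)
      show "(\<lambda>x. h x * k x) \<in> R" by (intro polynomial_functions.mult h kR)
      show "(\<lambda>x. h x * k x) \<notin> P" using prime_RD(3)[OF P h(1) kR] h(2) q(3) unfolding k_def by blast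
      fix y v b' assume y: "y \<in> zero_locus P" "h y * k y \<noteq> 0" and v: "v \<in> tang P y"
        "\<forall>f\<in>set fs. D f y v = 0" and b': "b' \<in> insert b B"
      have "k y * coord b v = D (\<lambda>x. poly (q x) (coord b x)) y v"
        unfolding k_def using D_poly[OF fs(1) q(1) coord_in_R, of y v b] v(2)
        by (simp add: D_functional[OF linear_coord])
      also have "\<dots> = 0" using v(1) q(2) by (auto simp: tang_def)
      finally show "coord b' v = 0" using h(3) y v b' by auto
    qed
  qed
  from this[OF finite_Basis order_refl] obtain h where h: "h \<in> R" "h \<notin> P" "\<forall>y\<in>zero_locus P. h y \<noteq> 0 \<longrightarrow>
    (\<forall>v\<in>tang P y. (\<forall>f\<in>set fs. D f y v = 0) \<longrightarrow> (\<forall>b\<in>Basis. coord b v = 0))" by blast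
  have "v = 0" if "\<forall>b\<in>Basis. coord b v = 0" for v
    using that by (intro coord_eqI) (auto simp: coord_simps)
  then show ?thesis using h by blast
qed

text \<open>Cutting with a level set of an \<open>f\<close> that is not stationary along the variety lowers the
  generic tangent dimension by at least one and the number of independent functions by at most one;
  if no such \<open>f\<close> exists, the variety is a point.\<close>

lemma length_le_dim_tang:
  assumes "prime_R P" "set fs \<subseteq> R" "alg_indep P fs" "y \<in> zero_locus P"
  shows "length fs \<le> dim (tang P y)"
  using assms
proof (induction "length fs" arbitrary: P fs y)
  case (Suc d fs P y)
  note P = Suc.prems(1)
  have PR: "P \<subseteq> R" using ideal_RD(1)[OF prime_RD(1)[OF P]] by auto
  have P0: "(\<lambda>x. 0) \<in> P" using ideal_RD(2)[OF prime_RD(1)[OF P]] .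
  obtain gs where gs: "set gs \<subseteq> R" "alg_indep P (gs @ fs)"
    "\<And>b. b \<in> Basis \<Longrightarrow> \<not> transc P (subalg (set (gs @ fs))) (coord b)"
    using extend_alg_indep[OF P Suc.prems(2,3)] by blast
  \<comment> \<open>The level set is cut by an entry of the extended list, which may lie outside
    \<open>fs\<close>: only the differentials of the extension are known to separate tangent
    vectors.\<close>
  define es where "es = gs @ fs"
  have es: "set es \<subseteq> R" "alg_indep P es" unfolding es_def using gs Suc.prems by auto
  obtain h1 where h1: "h1 \<in> R" "h1 \<notin> P" "\<forall>y\<in>zero_locus P. h1 y \<noteq> 0 \<longrightarrow>
    (\<forall>v\<in>tang P y. (\<forall>f\<in>set es. D f y v = 0) \<longrightarrow> v = 0)"
  proof -
    have "\<exists>h\<in>R. h \<notin> P \<and> (\<forall>y\<in>zero_locus P. h y \<noteq> 0 \<longrightarrow>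
      (\<forall>v\<in>tang P y. (\<forall>f\<in>set es. D f y v = 0) \<longrightarrow> v = 0))"
      by (rule differentials_injective[OF P es]) (rule gs(3)[folded es_def])
    then show thesis using that by (elim bexE conjE)
  qed
  \<comment> \<open>The tangent dimension can jump up at special points; a minimising point gives
    the estimate for every \<open>y\<close>.\<close>
  obtain y1 where y1: "y1 \<in> zero_locus P" "\<And>z. z \<in> zero_locus P \<Longrightarrow> dim (tang P y1) \<le> dim (tang P z)"
  proof -
    define n where "n = (LEAST n. \<exists>z\<in>zero_locus P. dim (tang P z) = n)"
    have "\<exists>z\<in>zero_locus P. dim (tang P z) = n"
      unfolding n_def by (rule LeastI_ex) (use Suc.prems(4) in auto)
    moreover have "n \<le> dim (tang P z)" if "z \<in> zero_locus P" for z
      unfolding n_def using that by (auto intro: Least_le)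
    ultimately show thesis using that by metis
  qed
  define e where "e = dim (tang P y1)"
  have fam: "\<forall>\<phi>\<in>D ` P. poly_family \<phi>" using PR poly_family_D by auto
  have tang_ker: "{v \<in> UNIV. \<forall>\<phi>\<in>D ` P. \<phi> z v = 0} = tang P z" for z unfolding tang_def by auto
  obtain h2 where h2: "h2 \<in> R" "h2 y1 \<noteq> 0" "\<And>z. h2 z \<noteq> 0 \<Longrightarrow> dim (tang P z) \<le> e"
    using kernel_semicontinuous[OF fam subspace_UNIV, of y1] unfolding tang_ker e_def by blast
  have h2P: "h2 \<notin> P" using h2(2) y1(1) by (auto simp: zero_locus_def)
  have "(\<lambda>x. h1 x * h2 x) \<in> R" "(\<lambda>x. h1 x * h2 x) \<notin> P"
    using prime_RD(3)[OF P h1(1) h2(1)] h1 h2 h2P by (auto intro: polynomial_functions.mult)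
  then obtain y2 where y2: "y2 \<in> zero_locus P" "h1 y2 \<noteq> 0" "h2 y2 \<noteq> 0"
    using prime_R_nullstellensatz[OF P, of "\<lambda>x. h1 x * h2 x"] by auto
  have dim2: "dim (tang P y2) = e" using h2(3)[OF y2(3)] y1(2)[OF y2(1)] unfolding e_def by simp
  show ?case
  proof (cases "e = 0")
    case True
    obtain f gs' where fs: "fs = f # gs'" using Suc.hyps(2) by (cases fs) auto
    have f: "f \<in> R" using Suc.prems(2) fs by auto
    \<comment> \<open>On a single point \<open>f\<close> is constant modulo \<open>P\<close>,
      against its transcendence.\<close>
    have "z = y1" if "z \<in> zero_locus P" for z
      using isolated_point[OF P y1(1) _ that] True unfolding e_def by simp
    then have "(\<lambda>x. f x - f y1) \<in> vanishing (zero_locus P)"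
      unfolding vanishing_def using f by (auto intro: R_diff polynomial_functions.const)
    then have "(\<lambda>x. poly [:- f y1, 1:] (f x)) \<in> P" unfolding vanishing_zero_locus[OF P] by simp
    moreover have "(\<lambda>x. [:- f y1, 1:]) \<in> polys_over (subalg (set gs'))"
      by (rule polys_overI[where n = 1]) (auto simp: coeff_pCons split: nat.split intro: subalg.const)
    ultimately have False using Suc.prems(3) unfolding fs alg_indep.simps transc_def by fastforce
    then show ?thesis ..
  next
    case False
    have "\<not> tang P y2 \<subseteq> {0}" using dim2 False dim_eq_0 by metis
    then obtain v where v: "v \<in> tang P y2" "v \<noteq> 0" by auto
    then obtain f where f: "f \<in> set es" "D f y2 v \<noteq> 0" using h1(3) y2(1,2) v by blast
    then obtain xs zs where xz: "es = xs @ f # zs" by (meson split_list)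
    have fR: "f \<in> R" using f es by auto
    have ind: "alg_indep P (f # (xs @ zs))" using alg_indep_move[of P xs f zs] es(2) P0 unfolding xz by simp
    have fam': "\<forall>\<phi>\<in>D ` insert f P. poly_family \<phi>" using PR fR poly_family_D by auto
    have ker': "{v \<in> UNIV. \<forall>\<phi>\<in>D ` insert f P. \<phi> z v = 0} = tang P z \<inter> {v. D f z v = 0}" for z
      unfolding tang_def by auto
    have lt: "dim (tang P y2 \<inter> {v. D f y2 v = 0}) < e"
      using dim_hyperplane(3)[OF subspace_tang[OF PR] linear_D[OF fR], of y2 y2] v(1) f(2) dim2 by auto
    \<comment> \<open>The drop of dimension caused by the equation for \<open>f\<close> persists
      where \<open>h3\<close> is nonzero. The section below keeps \<open>h3\<close> outside the new
      prime, so it contains such a point.\<close>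
    obtain h3 where h3: "h3 \<in> R" "h3 y2 \<noteq> 0" "\<And>z. h3 z \<noteq> 0 \<Longrightarrow> dim (tang P z \<inter> {v. D f z v = 0}) < e"
      using kernel_semicontinuous[OF fam' subspace_UNIV, of y2] lt unfolding ker'
      by (meson le_less_trans)
    have h3P: "h3 \<notin> P" using h3(2) y2(1) by (auto simp: zero_locus_def)
    have "set (f # (xs @ zs)) \<subseteq> R" using es xz by auto
    from alg_indep_section[OF P ind this h3(1) h3P]
    obtain P' c where P': "prime_R P'" "P \<subseteq> P'" "(\<lambda>x. f x - c) \<in> P'" "alg_indep P' (xs @ zs)" "h3 \<notin> P'"
      by metis
    \<comment> \<open>At least \<open>d\<close> entries remain besides \<open>f\<close>; the list is
      trimmed from the front to the length required by the induction.\<close>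
    define ks where "ks = drop (length (xs @ zs) - d) (xs @ zs)"
    have len: "length ks = d"
    proof -
      have "Suc d \<le> length es" unfolding es_def using Suc.hyps(2) by simp
      then show ?thesis unfolding ks_def using xz by simp
    qed
    have ks: "set ks \<subseteq> R" using es xz unfolding ks_def by (auto dest!: in_set_dropD)
    have "alg_indep P' ks"
      using P'(4) alg_indep_drop[of P' "take (length (xs @ zs) - d) (xs @ zs)" ks]
      unfolding ks_def by (simp only: append_take_drop_id)
    obtain z where z: "z \<in> zero_locus P'" "h3 z \<noteq> 0" using prime_R_nullstellensatz[OF P'(1) h3(1) P'(5)] by auto
    have "d \<le> dim (tang P' z)"
      using Suc.hyps(1)[OF len[symmetric] P'(1) ks \<open>alg_indep P' ks\<close> z(1)] len by simp
    also have "tang P' z \<subseteq> tang P z \<inter> {v. D f z v = 0}"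
    proof
      fix v assume v: "v \<in> tang P' z"
      have "D (\<lambda>x. f x + (- c)) z v = 0" using v P'(3) by (auto simp: tang_def)
      then have "D f z v = 0" using D_add[OF fR polynomial_functions.const, of "- c" z v] by (simp add: D_const)
      then show "v \<in> tang P z \<inter> {v. D f z v = 0}" using v P'(2) by (auto simp: tang_def)
    qed
    then have "dim (tang P' z) \<le> dim (tang P z \<inter> {v. D f z v = 0})" by (rule dim_subset)
    also have "\<dots> < e" using h3(3)[OF z(2)] .
    also have "e \<le> dim (tang P y)" unfolding e_def using y1(2) Suc.prems(4) .
    finally show ?thesis using Suc.hyps(2) by simp
  qed
qed simp

text \<open>A maximal independent list bounds the tangent dimension from above where its
  differentials are injective, and \<open>length_le_dim_tang\<close> bounds the length of every
  independent list by it from the other side.\<close>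

lemma variety_dim_tang:
  assumes P: "prime_R P"
  obtains d h fs where "variety_dim sc (zero_locus P) = enat d" "h \<in> R" "h \<notin> P"
    "\<And>y. y \<in> zero_locus P \<Longrightarrow> d \<le> dim (tang P y)"
    "\<And>y. y \<in> zero_locus P \<Longrightarrow> h y \<noteq> 0 \<Longrightarrow> dim (tang P y) = d"
    "set fs \<subseteq> R" "alg_indep P fs" "length fs = d"
proof -
  have PR: "P \<subseteq> R" using ideal_RD(1)[OF prime_RD(1)[OF P]] by auto
  obtain fs where fs: "set fs \<subseteq> R" "alg_indep P fs"
    "\<And>b. b \<in> Basis \<Longrightarrow> \<not> transc P (subalg (set fs)) (coord b)"
    using extend_alg_indep[OF P, of "[]"] by auto
  obtain h where h': "h \<in> R" "h \<notin> P" "\<forall>y\<in>zero_locus P. h y \<noteq> 0 \<longrightarrow>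
    (\<forall>v\<in>tang P y. (\<forall>f\<in>set fs. D f y v = 0) \<longrightarrow> v = 0)"
  proof -
    have "\<exists>h\<in>R. h \<notin> P \<and> (\<forall>y\<in>zero_locus P. h y \<noteq> 0 \<longrightarrow>
      (\<forall>v\<in>tang P y. (\<forall>f\<in>set fs. D f y v = 0) \<longrightarrow> v = 0))"
      by (rule differentials_injective[OF P fs(1,2)]) (rule fs(3))
    then show thesis using that by (elim bexE conjE)
  qed
  note h = h'(1,2) h'(3)[rule_format]
  have le: "dim (tang P y) \<le> length fs" if y: "y \<in> zero_locus P" "h y \<noteq> 0" for y
  proof -
    have "dim (tang P y) \<le> length (map (\<lambda>f. D f y) fs)"
      using h'(3) y fs(1) linear_D by (intro dim_le_functionals subspace_tang[OF PR]) auto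
    then show ?thesis by simp
  qed
  note ge = length_le_dim_tang[OF P]
  obtain y where y: "y \<in> zero_locus P" "h y \<noteq> 0" using prime_R_nullstellensatz[OF P h(1,2)] by auto
  have "variety_dim sc (zero_locus P) = enat (length fs)"
    using ge[OF _ _ y(1)] le[OF y] by (intro variety_dim_eqI[OF P fs(1,2)]) fastforce
  then show thesis using that[OF _ h(1,2) _ _ fs(1,2) refl] ge[OF fs(1,2)] le by (metis le_antisym)
qed

end

section \<open>Sums of generic tangent spaces\<close>

lemma polynomial_functions_linear_compose:
  assumes "p \<in> polynomial_functions s2" and \<gamma>: "Vector_Spaces.linear s1 s2 \<gamma>"
  shows "(\<lambda>x. p (\<gamma> x)) \<in> polynomial_functions s1"
  using assms(1)
proof induction
  case (functional f)
  from Vector_Spaces.linear_compose[OF \<gamma> functional] show ?case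
    unfolding o_def by (rule polynomial_functions.functional)
qed (auto intro: polynomial_functions.const polynomial_functions.add polynomial_functions.mult)

text \<open>An abstraction of the result of \<open>variety_dim_tang\<close>: \<open>d\<close> is the
  minimal tangent dimension, attained wherever \<open>reg\<close> is nonzero.\<close>

locale generic_tangents = complex_fd_space sc Basis
  for sc :: "complex \<Rightarrow> 'b::ab_group_add \<Rightarrow> 'b" and Basis :: "'b set" +
  fixes P :: "('b \<Rightarrow> complex) set" and d :: nat and reg :: "'b \<Rightarrow> complex"
  assumes P: "prime_R P"
    and reg: "reg \<in> R" "reg \<notin> P"
    and dim_ge: "\<And>y. y \<in> zero_locus P \<Longrightarrow> d \<le> dim (tang P y)"
    and dim_reg: "\<And>y. y \<in> zero_locus P \<Longrightarrow> reg y \<noteq> 0 \<Longrightarrow> dim (tang P y) = d"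
begin

section \<open>Generic points and generic tuples\<close>

abbreviation V :: "'b set" where "V \<equiv> zero_locus P"

definition generically :: "('b \<Rightarrow> bool) \<Rightarrow> bool" where
  "generically Q \<longleftrightarrow> (\<exists>h\<in>R. h \<notin> P \<and> (\<forall>y\<in>V. h y \<noteq> 0 \<longrightarrow> Q y))"

lemma PR: "P \<subseteq> R"
  using ideal_RD(1)[OF prime_RD(1)[OF P]] by auto

lemma generically_mono: "generically Q \<Longrightarrow> (\<And>y. y \<in> V \<Longrightarrow> Q y \<Longrightarrow> Q' y) \<Longrightarrow> generically Q'"
  unfolding generically_def by blast

lemma generically_always: "(\<And>y. y \<in> V \<Longrightarrow> Q y) \<Longrightarrow> generically Q"
  unfolding generically_def
  by (intro bexI[of _ "\<lambda>x. 1"]) (auto simp: prime_RD(2)[OF P] intro: polynomial_functions.const)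

lemma generically_conj:
  assumes "generically Q" "generically Q'"
  shows "generically (\<lambda>y. Q y \<and> Q' y)"
proof -
  obtain h k where *: "h \<in> R" "h \<notin> P" "\<forall>y\<in>V. h y \<noteq> 0 \<longrightarrow> Q y"
    "k \<in> R" "k \<notin> P" "\<forall>y\<in>V. k y \<noteq> 0 \<longrightarrow> Q' y" using assms unfolding generically_def by blast
  show ?thesis unfolding generically_def
  proof (intro bexI[of _ "\<lambda>y. h y * k y"] conjI)
    show "(\<lambda>y. h y * k y) \<notin> P" using prime_RD(3)[OF P] * by blast
  qed (use * in \<open>auto intro: polynomial_functions.mult\<close>)
qed

lemma generically_ex: "generically Q \<Longrightarrow> \<exists>y\<in>V. Q y"
  unfolding generically_def using prime_R_nullstellensatz[OF P] by blast

lemma generically_nonzero: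
  assumes "h \<in> R" "y \<in> V" "h y \<noteq> 0"
  shows "generically (\<lambda>y. h y \<noteq> 0)"
  unfolding generically_def using assms by (auto simp: zero_locus_def)

text \<open>An iterated quantifier: the open set for each point may depend on the points before it.
  It takes the place of density in the product of copies of the variety.\<close>

fun generic_tuples :: "nat \<Rightarrow> ('b list \<Rightarrow> bool) \<Rightarrow> bool" where
  "generic_tuples 0 Q \<longleftrightarrow> Q []"
| "generic_tuples (Suc m) Q \<longleftrightarrow> generically (\<lambda>x. generic_tuples m (\<lambda>xs. Q (x # xs)))"

definition tuples :: "nat \<Rightarrow> 'b list set" where
  "tuples m = {xs. length xs = m \<and> set xs \<subseteq> V}"

lemma generic_tuples_mono:
  "generic_tuples m Q \<Longrightarrow> (\<And>xs. xs \<in> tuples m \<Longrightarrow> Q xs \<Longrightarrow> Q' xs) \<Longrightarrow> generic_tuples m Q'"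
proof (induction m arbitrary: Q Q')
  case (Suc m)
  from Suc.prems(1) show ?case unfolding generic_tuples.simps
  proof (rule generically_mono)
    fix y assume y: "y \<in> V" "generic_tuples m (\<lambda>xs. Q (y # xs))"
    from y(2) show "generic_tuples m (\<lambda>xs. Q' (y # xs))"
      by (rule Suc.IH) (use Suc.prems(2) y(1) in \<open>auto simp: tuples_def\<close>)
  qed
qed (auto simp: tuples_def)

lemma generic_tuples_always: "(\<And>xs. xs \<in> tuples m \<Longrightarrow> Q xs) \<Longrightarrow> generic_tuples m Q"
  by (induction m arbitrary: Q) (auto simp: tuples_def intro!: generically_always)

lemma generic_tuples_conj:
  "generic_tuples m Q \<Longrightarrow> generic_tuples m Q' \<Longrightarrow> generic_tuples m (\<lambda>xs. Q xs \<and> Q' xs)"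
proof (induction m arbitrary: Q Q')
  case (Suc m)
  then show ?case unfolding generic_tuples.simps
    by (intro generically_mono[OF generically_conj[OF Suc.prems[unfolded generic_tuples.simps]]]) auto
qed auto

lemma generic_tuples_all:
  "finite I \<Longrightarrow> (\<And>i. i \<in> I \<Longrightarrow> generic_tuples m (Q i)) \<Longrightarrow> generic_tuples m (\<lambda>xs. \<forall>i\<in>I. Q i xs)"
proof (induction I rule: finite_induct)
  case empty
  show ?case by (rule generic_tuples_always) auto
next
  case (insert i I)
  then have "generic_tuples m (\<lambda>xs. Q i xs \<and> (\<forall>i\<in>I. Q i xs))" by (intro generic_tuples_conj) auto
  then show ?case by (rule generic_tuples_mono) auto
qed

lemma generic_tuples_ex: "generic_tuples m Q \<Longrightarrow> \<exists>xs\<in>tuples m. Q xs"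
proof (induction m arbitrary: Q)
  case (Suc m)
  then obtain y where y: "y \<in> V" "generic_tuples m (\<lambda>xs. Q (y # xs))" using generically_ex by auto
  obtain xs where "xs \<in> tuples m" "Q (y # xs)" using Suc.IH[OF y(2)] by auto
  then show ?case using y by (intro bexI[of _ "y # xs"]) (auto simp: tuples_def)
qed (auto simp: tuples_def)

lemma generic_tuples_append:
  "generic_tuples (m + n) Q \<longleftrightarrow> generic_tuples m (\<lambda>xs. generic_tuples n (\<lambda>ys. Q (xs @ ys)))"
  by (induction m arbitrary: Q) auto

text \<open>The entries of one good tuple are exchanged for generic points from left to right, and
  openness in a single slot preserves \<open>Q\<close> at each exchange.\<close>

lemma generic_tuplesI:
  assumes "zs \<in> tuples m" "Q zs"
    and "\<And>xs z ys. xs @ z # ys \<in> tuples m \<Longrightarrow> Q (xs @ z # ys) \<Longrightarrow> generically (\<lambda>w. Q (xs @ w # ys))"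
  shows "generic_tuples m Q"
  using assms
proof (induction m arbitrary: zs Q)
  case (Suc m)
  then obtain z ys where zs: "zs = z # ys" "z \<in> V" "ys \<in> tuples m"
    by (cases zs) (auto simp: tuples_def)
  have "generically (\<lambda>w. Q (w # ys))" using Suc.prems(3)[of "[]" z ys] Suc.prems(1,2) zs by simp
  then show ?case unfolding generic_tuples.simps
  proof (rule generically_mono)
    fix w assume w: "w \<in> V" "Q (w # ys)"
    show "generic_tuples m (\<lambda>xs. Q (w # xs))"
    proof (rule Suc.IH[of ys "\<lambda>xs. Q (w # xs)", OF zs(3)])
      show "Q (w # ys)" by (rule w(2))
    next
      fix xs z ys assume "xs @ z # ys \<in> tuples m" "Q (w # xs @ z # ys)"
      then show "generically (\<lambda>u. Q (w # xs @ u # ys))"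
        using Suc.prems(3)[of "w # xs" z ys] w(1) by (simp add: tuples_def)
    qed
  qed
qed (auto simp: tuples_def)

section \<open>Tangent sums and their generic dimensions\<close>

definition regular :: "'b set" where
  "regular = {y \<in> V. dim (tang P y) = d}"

lemma generically_regular: "generically (\<lambda>y. y \<in> regular)"
  unfolding generically_def regular_def using reg dim_reg by blast

definition tang_sum :: "'b set \<Rightarrow> 'b set" where
  "tang_sum S = span (\<Union>x\<in>S. tang P x)"

lemma subspace_tang_sum: "subspace (tang_sum S)"
  unfolding tang_sum_def by (rule subspace_span)

lemma tang_sum_mono: "S \<subseteq> S' \<Longrightarrow> tang_sum S \<subseteq> tang_sum S'"
  unfolding tang_sum_def by (intro span_mono) auto

lemma tang_sum_empty: "tang_sum {} = {0}"
  unfolding tang_sum_def by simp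

lemma tang_sum_insert: "tang_sum (insert w S) = {x + y |x y. x \<in> tang P w \<and> y \<in> tang_sum S}"
proof -
  have "span (tang P w) = tang P w" using subspace_tang[OF PR] span_eq_iff by blast
  then show ?thesis unfolding tang_sum_def UN_insert span_Un by (simp only:)
qed

lemma dim_tang_sum_insert:
  "dim (tang_sum (insert w S)) + dim (tang P w \<inter> tang_sum S) = dim (tang P w) + dim (tang_sum S)"
  unfolding tang_sum_insert by (rule dim_sums_Int[OF subspace_tang[OF PR] subspace_tang_sum])

text \<open>The intersection with \<open>tang_sum S\<close> is a kernel of differentials inside a
  fixed space, so generically it is no larger than at \<open>z\<close>. The tangent space itself is
  no smaller than at \<open>z\<close>, because \<open>z\<close> is regular.\<close>

lemma dim_tang_sum_insert_open:
  assumes z: "z \<in> regular" and r: "r \<le> dim (tang_sum (insert z S))"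
  shows "generically (\<lambda>w. r \<le> dim (tang_sum (insert w S)))"
proof -
  have eq: "{v \<in> tang_sum S. \<forall>\<phi>\<in>D ` P. \<phi> y v = 0} = tang P y \<inter> tang_sum S" for y
    unfolding tang_def by auto
  have fam: "\<forall>\<phi>\<in>D ` P. poly_family \<phi>" using PR poly_family_D by auto
  obtain h where h: "h \<in> R" "h z \<noteq> 0"
    "\<forall>y. h y \<noteq> 0 \<longrightarrow> dim (tang P y \<inter> tang_sum S) \<le> dim (tang P z \<inter> tang_sum S)"
    using kernel_semicontinuous[OF fam subspace_tang_sum, of z S] unfolding eq by blast
  have "generically (\<lambda>w. h w \<noteq> 0)" using h z by (intro generically_nonzero) (auto simp: regular_def)
  then show ?thesis
  proof (rule generically_mono)
    fix w assume w: "w \<in> V" "h w \<noteq> 0"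
    have "dim (tang P w \<inter> tang_sum S) \<le> dim (tang P z \<inter> tang_sum S)" using h(3) w(2) by blast
    moreover have "dim (tang P z) \<le> dim (tang P w)" using z dim_ge[OF w(1)] by (simp add: regular_def)
    ultimately show "r \<le> dim (tang_sum (insert w S))"
      using r dim_tang_sum_insert[of w S] dim_tang_sum_insert[of z S] by linarith
  qed
qed

definition rk :: "nat \<Rightarrow> nat" where
  "rk k = Max ((\<lambda>xs. dim (tang_sum (set xs))) ` {xs. length xs = k \<and> set xs \<subseteq> regular})"

lemma finite_ranks: "finite ((\<lambda>xs. dim (tang_sum (set xs))) ` X)"
  by (rule finite_subset[of _ "{..dimension}"]) (use dim_subset_UNIV in auto)

lemma rk_ge: "set xs \<subseteq> regular \<Longrightarrow> dim (tang_sum (set xs)) \<le> rk (length xs)"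
  unfolding rk_def by (rule Max_ge[OF finite_ranks]) auto

lemma regular_point: obtains z where "z \<in> regular"
  using generically_ex[OF generically_regular] by auto

lemma rk_attained: "\<exists>xs. length xs = k \<and> set xs \<subseteq> regular \<and> dim (tang_sum (set xs)) = rk k"
proof -
  obtain z where z: "z \<in> regular" using regular_point .
  have "rk k \<in> (\<lambda>xs. dim (tang_sum (set xs))) ` {xs. length xs = k \<and> set xs \<subseteq> regular}"
    unfolding rk_def
  proof (rule Max_in[OF finite_ranks])
    have "replicate k z \<in> {xs. length xs = k \<and> set xs \<subseteq> regular}" using z by auto
    then show "(\<lambda>xs. dim (tang_sum (set xs))) ` {xs. length xs = k \<and> set xs \<subseteq> regular} \<noteq> {}" by blast
  qed
  then show ?thesis by auto
qed

text \<open>All sets of positions are controlled at once, so that exchange arguments can pass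
  between subfamilies of a single tuple.\<close>

definition totally_generic :: "nat \<Rightarrow> 'b list \<Rightarrow> bool" where
  "totally_generic M zs \<longleftrightarrow> length zs = M \<and> set zs \<subseteq> regular \<and>
     (\<forall>I\<subseteq>{..<M}. dim (tang_sum ((!) zs ` I)) = rk (card I))"

lemma generic_totally_generic: "generic_tuples M (totally_generic M)"
proof -
  have "generic_tuples M (\<lambda>zs. set zs \<subseteq> regular \<and> rk (card I) \<le> dim (tang_sum ((!) zs ` I)))"
    if I: "I \<subseteq> {..<M}" for I
  proof -
    have finI: "finite I" using I finite_subset by blast
    obtain us where us: "length us = card I" "set us \<subseteq> regular" "dim (tang_sum (set us)) = rk (card I)"
      using rk_attained by blast
    obtain f where f: "bij_betw f I {0..<card I}" using ex_bij_betw_finite_nat[OF finI] by blast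
    obtain z0 where z0: "z0 \<in> regular" using regular_point .
    \<comment> \<open>A witness for one \<open>I\<close>: a list of maximal rank on the positions in
      \<open>I\<close>, an arbitrary regular point elsewhere.\<close>
    define zs where "zs = map (\<lambda>i. if i \<in> I then us ! f i else z0) [0..<M]"
    have "(!) zs ` I = (!) us ` (f ` I)" unfolding zs_def image_image using I by (intro image_cong) auto
    also have "f ` I = {0..<card I}" using f by (simp add: bij_betw_def)
    also have "(!) us ` {0..<card I} = set us" using us(1) by (auto simp: set_conv_nth)
    finally have zsI: "(!) zs ` I = set us" .
    have zs_reg: "set zs \<subseteq> regular"
    proof -
      have "us ! f i \<in> regular" if "i \<in> I" for i
        using us(2) zsI that unfolding zs_def using I
        by (metis (no_types, lifting) bij_betwE f us(1) nth_mem atLeastLessThan_iff subsetD)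
      then show ?thesis unfolding zs_def using z0 by auto
    qed
    show ?thesis
    proof (rule generic_tuplesI[of zs])
      show "zs \<in> tuples M" using zs_reg by (auto simp: tuples_def zs_def regular_def)
      show "set zs \<subseteq> regular \<and> rk (card I) \<le> dim (tang_sum ((!) zs ` I))"
        using zs_reg us(3) zsI by simp
    next
      fix xs z ys
      assume len: "xs @ z # ys \<in> tuples M" and
        Q: "set (xs @ z # ys) \<subseteq> regular \<and> rk (card I) \<le> dim (tang_sum ((!) (xs @ z # ys) ` I))"
      let ?j = "length xs"
      define S where "S = (!) (xs @ z # ys) ` (I - {?j})"
      have S: "S = (!) (xs @ w # ys) ` (I - {?j})" for w
        unfolding S_def by (intro image_cong) (auto simp: nth_append nth_Cons split: nat.split)
      have set_I: "(!) (xs @ w # ys) ` I = (if ?j \<in> I then insert w S else S)" for w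
      proof (cases "?j \<in> I")
        case True
        then have "(!) (xs @ w # ys) ` I = insert ((xs @ w # ys) ! ?j) ((!) (xs @ w # ys) ` (I - {?j}))"
          by blast
        then show ?thesis using True S[of w] by simp
      next
        case False
        then have "I - {?j} = I" by auto
        then show ?thesis using False S[of w] by simp
      qed
      have "generically (\<lambda>w. rk (card I) \<le> dim (tang_sum ((!) (xs @ w # ys) ` I)))"
      proof (cases "?j \<in> I")
        case True
        then show ?thesis using Q dim_tang_sum_insert_open[of z "rk (card I)" S] unfolding set_I by simp
      next
        case False
        then show ?thesis using Q unfolding set_I by (intro generically_always) simp
      qed
      then show "generically (\<lambda>w. set (xs @ w # ys) \<subseteq> regular \<and>
          rk (card I) \<le> dim (tang_sum ((!) (xs @ w # ys) ` I)))"
        using generically_conj[OF generically_regular] Q by (auto elim!: generically_mono)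
    qed
  qed
  then have "generic_tuples M (\<lambda>zs. \<forall>I\<in>Pow {..<M}. set zs \<subseteq> regular \<and>
      rk (card I) \<le> dim (tang_sum ((!) zs ` I)))"
    by (intro generic_tuples_all) auto
  then show ?thesis
  proof (rule generic_tuples_mono)
    fix zs assume zs: "zs \<in> tuples M" "\<forall>I\<in>Pow {..<M}. set zs \<subseteq> regular \<and>
      rk (card I) \<le> dim (tang_sum ((!) zs ` I))"
    then have len: "length zs = M" and reg: "set zs \<subseteq> regular" by (auto simp: tuples_def)
    have "dim (tang_sum ((!) zs ` I)) \<le> rk (card I)" if I: "I \<subseteq> {..<M}" for I
    proof -
      have "finite I" using I finite_subset by blast
      then have l: "set (sorted_list_of_set I) = I" "length (sorted_list_of_set I) = card I" by auto
      have "set (map ((!) zs) (sorted_list_of_set I)) \<subseteq> regular"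
        using reg I len l(1) nth_mem by fastforce
      from rk_ge[OF this] show ?thesis using l by simp
    qed
    then show "totally_generic M zs" unfolding totally_generic_def using zs len by (auto intro: antisym)
  qed
qed

text \<open>Increments are read as intersections: the further tangent space meets the tangent sum in
  dimension \<open>d\<close> minus the increment.\<close>

lemma totally_generic_Int:
  assumes zs: "totally_generic M zs" and I: "I \<subseteq> {..<M}" and j: "j < M" "j \<notin> I"
  shows "dim (tang P (zs ! j) \<inter> tang_sum ((!) zs ` I)) + rk (Suc (card I)) = d + rk (card I)"
proof -
  have "zs ! j \<in> regular" using zs j unfolding totally_generic_def by auto
  then have d: "dim (tang P (zs ! j)) = d" by (simp add: regular_def)
  have fin: "finite I" using I finite_subset by blast
  have "dim (tang_sum ((!) zs ` insert j I)) = rk (card (insert j I))"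
    using zs I j unfolding totally_generic_def by (metis insert_subset lessThan_iff)
  then have "dim (tang_sum (insert (zs ! j) ((!) zs ` I))) = rk (Suc (card I))" using j fin by simp
  moreover have "dim (tang_sum ((!) zs ` I)) = rk (card I)"
    using zs I unfolding totally_generic_def by auto
  ultimately show ?thesis using dim_tang_sum_insert[of "zs ! j" "(!) zs ` I"] d by linarith
qed

lemma ex_totally_generic: obtains zs where "totally_generic M zs"
  using generic_tuples_ex[OF generic_totally_generic[of M]] by blast

lemma rk_0: "rk 0 = 0"
  using rk_attained[of 0] by (auto simp: tang_sum_empty)

lemma rk_le: "rk k \<le> card Basis"
  using rk_attained[of k] dim_subset_UNIV unfolding dimension_def by metis

lemma rk_mono: "rk k \<le> rk (Suc k)"
proof -
  obtain zs where zs: "totally_generic (Suc k) zs" by (rule ex_totally_generic)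
  have "dim (tang_sum ((!) zs ` {..<k})) \<le> dim (tang_sum ((!) zs ` {..<Suc k}))"
    by (intro dim_subset tang_sum_mono image_mono) auto
  moreover have "{..<k} \<subseteq> {..<Suc k}" by auto
  ultimately show ?thesis using zs unfolding totally_generic_def by fastforce
qed

lemma rk_Suc_le: "rk (Suc k) \<le> rk k + d"
proof -
  obtain zs where zs: "totally_generic (Suc k) zs" by (rule ex_totally_generic)
  from totally_generic_Int[OF this, of "{..<k}" k] show ?thesis by simp
qed

text \<open>A larger tangent sum meets the tangent space of a further point in at least as large a
  subspace, so the increment cannot grow.\<close>

lemma rk_concave: "rk (Suc (Suc k)) + rk k \<le> 2 * rk (Suc k)"
proof -
  obtain zs where zs: "totally_generic (Suc (Suc k)) zs" by (rule ex_totally_generic)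
  let ?T = "tang P (zs ! Suc k)"
  have "dim (?T \<inter> tang_sum ((!) zs ` {..<k})) \<le> dim (?T \<inter> tang_sum ((!) zs ` {..<Suc k}))"
    by (intro dim_subset Int_mono order_refl tang_sum_mono image_mono) auto
  moreover have "dim (?T \<inter> tang_sum ((!) zs ` {..<k})) + rk (Suc k) = d + rk k"
    using totally_generic_Int[OF zs, of "{..<k}" "Suc k"] by simp
  moreover have "dim (?T \<inter> tang_sum ((!) zs ` {..<Suc k})) + rk (Suc (Suc k)) = d + rk (Suc k)"
    using totally_generic_Int[OF zs, of "{..<Suc k}" "Suc k"] by simp
  ultimately show ?thesis by linarith
qed

section \<open>Stalling increments and the invariant subspace\<close>

text \<open>If the increments of \<open>rk\<close> stall at \<open>k\<close>, then exchanging the \<open>k\<close> points one at a time does not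
  change the intersection of a further generic tangent space with their tangent sum.\<close>

lemma stalled_intersection:
  assumes eq: "rk (Suc (Suc k)) + rk k = 2 * rk (Suc k)" and zs: "totally_generic (Suc (k + k)) zs"
  shows "tang P (zs ! 0) \<inter> tang_sum ((!) zs ` {1..k}) = tang P (zs ! 0) \<inter> tang_sum ((!) zs ` {Suc k..k + k})"
proof -
  let ?T = "tang P (zs ! 0)"
  \<comment> \<open>Equal consecutive increments mean equal dimensions of the two intersections, so
    one more point changes nothing.\<close>
  have add: "?T \<inter> tang_sum ((!) zs ` insert j I) = ?T \<inter> tang_sum ((!) zs ` I)"
    if I: "I \<subseteq> {1..<Suc (k + k)}" "card I = k" and j: "j \<in> {1..<Suc (k + k)}" "j \<notin> I" for I j
  proof -
    have fin: "finite I" using I finite_subset by blast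
    have "dim (?T \<inter> tang_sum ((!) zs ` I)) + rk (Suc k) = d + rk k"
      using totally_generic_Int[OF zs, of I 0] I by fastforce
    moreover have "dim (?T \<inter> tang_sum ((!) zs ` insert j I)) + rk (Suc (Suc k)) = d + rk (Suc k)"
    proof -
      have "insert j I \<subseteq> {..<Suc (k + k)}" "0 \<notin> insert j I" using I j by auto
      moreover have "card (insert j I) = Suc k" using I j fin by simp
      ultimately show ?thesis using totally_generic_Int[OF zs, of "insert j I" 0] by simp
    qed
    ultimately have "dim (?T \<inter> tang_sum ((!) zs ` insert j I)) = dim (?T \<inter> tang_sum ((!) zs ` I))"
      using eq by linarith
    moreover have "?T \<inter> tang_sum ((!) zs ` I) \<subseteq> ?T \<inter> tang_sum ((!) zs ` insert j I)"
      by (intro Int_mono order_refl tang_sum_mono image_mono) auto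
    ultimately show ?thesis
      using subspace_dim_equal[OF subspace_inter[OF subspace_tang[OF PR] subspace_tang_sum]
          subspace_inter[OF subspace_tang[OF PR] subspace_tang_sum]] by (metis order_refl)
  qed
  have "?T \<inter> tang_sum ((!) zs ` {1..k}) = ?T \<inter> tang_sum ((!) zs ` {Suc j..k + j})" if "j \<le> k" for j
    using that
  proof (induction j)
    case (Suc j)
    \<comment> \<open>Neighbouring windows of length \<open>k\<close> lie in a common set of
      \<open>k + 1\<close> indices, and \<open>add\<close> compares each of them with it.\<close>
    let ?I = "{Suc j..k + j}" and ?I' = "{Suc (Suc j)..k + Suc j}"
    have "insert (k + Suc j) ?I = insert (Suc j) ?I'" by auto
    moreover have "?T \<inter> tang_sum ((!) zs ` insert (k + Suc j) ?I) = ?T \<inter> tang_sum ((!) zs ` ?I)"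
      using Suc.prems by (intro add) auto
    moreover have "?T \<inter> tang_sum ((!) zs ` insert (Suc j) ?I') = ?T \<inter> tang_sum ((!) zs ` ?I')"
      using Suc.prems by (intro add) auto
    ultimately show ?case using Suc by simp
  qed simp
  from this[of k] show ?thesis by simp
qed

definition generic_vectors :: "nat \<Rightarrow> 'b set" where
  "generic_vectors k = {v. generic_tuples k (\<lambda>ys. v \<in> tang_sum (set ys))}"

lemma subspace_generic_vectors: "subspace (generic_vectors k)"
  unfolding subspace_def generic_vectors_def mem_Collect_eq
proof (intro conjI ballI allI)
  show "generic_tuples k (\<lambda>ys. 0 \<in> tang_sum (set ys))"
    by (rule generic_tuples_always) (simp add: subspace_0[OF subspace_tang_sum])
next
  fix x y assume "x \<in> {v. generic_tuples k (\<lambda>ys. v \<in> tang_sum (set ys))}"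
    "y \<in> {v. generic_tuples k (\<lambda>ys. v \<in> tang_sum (set ys))}"
  then have "generic_tuples k (\<lambda>ys. x \<in> tang_sum (set ys) \<and> y \<in> tang_sum (set ys))"
    by (intro generic_tuples_conj) auto
  then show "generic_tuples k (\<lambda>ys. x + y \<in> tang_sum (set ys))"
    by (rule generic_tuples_mono) (simp add: subspace_add[OF subspace_tang_sum])
next
  fix c x assume "x \<in> {v. generic_tuples k (\<lambda>ys. v \<in> tang_sum (set ys))}"
  then have "generic_tuples k (\<lambda>ys. x \<in> tang_sum (set ys))" by simp
  then show "generic_tuples k (\<lambda>ys. sc c x \<in> tang_sum (set ys))"
    by (rule generic_tuples_mono) (simp add: subspace_scale[OF subspace_tang_sum])
qed

text \<open>For generic fixed \<open>x\<close> and \<open>xs\<close> the intersection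
  \<open>U\<close> of their tangent space and tangent sum equals the one formed with generic
  \<open>ys\<close>, so \<open>U\<close> consists of generic vectors. Its dimension is
  \<open>d\<close> minus the increment, which is positive.\<close>

lemma generic_vectors_nontrivial:
  assumes eq: "rk (Suc (Suc k)) + rk k = 2 * rk (Suc k)" and lt: "rk (Suc k) < rk k + d"
  shows "generic_vectors k \<noteq> {0}"
proof -
  have "generically (\<lambda>x. generic_tuples k (\<lambda>xs. generic_tuples k (\<lambda>ys.
      totally_generic (Suc (k + k)) (x # xs @ ys))))"
    using generic_totally_generic[of "Suc (k + k)"]
    by (simp only: generic_tuples.simps generic_tuples_append)
  then obtain x xs where x: "x \<in> V" "xs \<in> tuples k"
    "generic_tuples k (\<lambda>ys. totally_generic (Suc (k + k)) (x # xs @ ys))"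
    using generically_ex generic_tuples_ex by blast
  define U where "U = tang P x \<inter> tang_sum (set xs)"
  have len: "length xs = k" using x(2) by (simp add: tuples_def)
  have set_xs: "(!) (x # xs @ ys) ` {1..k} = set xs" for ys
  proof -
    have "{1..k} = Suc ` {..<k}" by (simp add: image_Suc_lessThan)
    then show ?thesis using len by (auto simp: image_image set_conv_nth nth_append)
  qed
  have set_ys: "(!) (x # xs @ ys) ` {Suc k..k + k} = set ys" if "length ys = k" for ys
  proof -
    have "{Suc k..k + k} = (\<lambda>i. Suc (k + i)) ` {..<k}"
    proof (intro equalityI subsetI)
      fix i assume "i \<in> {Suc k..k + k}"
      then show "i \<in> (\<lambda>i. Suc (k + i)) ` {..<k}" by (intro image_eqI[of _ _ "i - Suc k"]) auto
    qed auto
    then show ?thesis using len that by (auto simp: image_image set_conv_nth nth_append)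
  qed
  have "generic_tuples k (\<lambda>ys. U \<subseteq> tang_sum (set ys))"
    using x(3)
  proof (rule generic_tuples_mono)
    fix ys assume ys: "ys \<in> tuples k" "totally_generic (Suc (k + k)) (x # xs @ ys)"
    have "length ys = k" using ys(1) by (simp add: tuples_def)
    from stalled_intersection[OF eq ys(2), unfolded set_xs set_ys[OF this]]
    show "U \<subseteq> tang_sum (set ys)" unfolding U_def by auto
  qed
  then have sub: "U \<subseteq> generic_vectors k"
    unfolding generic_vectors_def by (auto elim!: generic_tuples_mono)
  obtain ys where "totally_generic (Suc (k + k)) (x # xs @ ys)" using generic_tuples_ex[OF x(3)] by blast
  from totally_generic_Int[OF this, of "{1..k}" 0]
  have "dim U + rk (Suc k) = d + rk k" unfolding set_xs U_def by fastforce
  then have "dim U \<noteq> 0" using lt by linarith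
  then have "\<not> U \<subseteq> {0}" by simp
  then show ?thesis using sub by blast
qed

text \<open>Each vector has its own generic set of tuples, but a finite basis permits a common
  tuple.\<close>

lemma generic_vectors_full:
  assumes "generic_vectors k = UNIV"
  shows "rk k = card Basis"
proof -
  have "generic_tuples k (\<lambda>ys. \<forall>b\<in>Basis. b \<in> tang_sum (set ys))"
    using assms by (intro generic_tuples_all[OF finite_Basis]) (auto simp: generic_vectors_def)
  then have "generic_tuples k (\<lambda>ys. (\<forall>b\<in>Basis. b \<in> tang_sum (set ys)) \<and> totally_generic k ys)"
    by (rule generic_tuples_conj[OF _ generic_totally_generic])
  then obtain ys where ys: "Basis \<subseteq> tang_sum (set ys)" "totally_generic k ys"
    using generic_tuples_ex by blast
  have "UNIV \<subseteq> tang_sum (set ys)"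
    unfolding span_Basis[symmetric] using ys(1) by (rule span_minimal[OF _ subspace_tang_sum])
  then have "dim (tang_sum (set ys)) = card Basis" using dim_UNIV by (metis top.extremum_unique)
  moreover have "dim (tang_sum (set ys)) \<le> rk k"
    using rk_ge[of ys] ys(2) unfolding totally_generic_def by auto
  ultimately show ?thesis using rk_le[of k] by simp
qed

lemma D_linear_compose:
  assumes \<gamma>: "Vector_Spaces.linear sc sc \<gamma>"
  shows "D p (\<gamma> y) (\<gamma> v) = D (\<lambda>x. p (\<gamma> x)) y v"
proof -
  interpret g: Vector_Spaces.linear sc sc \<gamma> by fact
  show ?thesis unfolding D_def by (simp add: g.add g.scale)
qed

text \<open>The map preserves the variety and hence carries tangent spaces to tangent spaces; its
  inverse transports the generic sets of tuples.\<close>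

lemma generic_vectors_invariant:
  assumes \<gamma>: "Vector_Spaces.linear sc sc \<gamma>" and \<gamma>': "Vector_Spaces.linear sc sc \<gamma>'"
    and inv: "\<And>x. \<gamma>' (\<gamma> x) = x" "\<And>x. \<gamma> (\<gamma>' x) = x"
    and V: "\<And>x. x \<in> V \<Longrightarrow> \<gamma> x \<in> V" "\<And>x. x \<in> V \<Longrightarrow> \<gamma>' x \<in> V"
    and v: "v \<in> generic_vectors k"
  shows "\<gamma> v \<in> generic_vectors k"
proof -
  interpret g: Vector_Spaces.linear sc sc \<gamma> by fact
  have memP: "p \<in> P \<longleftrightarrow> p \<in> R \<and> (\<forall>x\<in>V. p x = 0)" for p
    using vanishing_zero_locus[OF P] unfolding vanishing_def by auto
  have pull: "(\<lambda>x. p (\<gamma> x)) \<in> P" if "p \<in> P" for p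
    using that V(1) polynomial_functions_linear_compose[OF _ \<gamma>] unfolding memP by auto
  have tang: "\<gamma> u \<in> tang P (\<gamma> y)" if "u \<in> tang P y" for u y
    using that pull D_linear_compose[OF \<gamma>] unfolding tang_def by auto
  have tsum: "\<gamma> u \<in> tang_sum (\<gamma> ` S)" if "u \<in> tang_sum S" for u S
  proof -
    have "\<gamma> ` tang_sum S = span (\<gamma> ` (\<Union>x\<in>S. tang P x))"
      unfolding tang_sum_def by (rule g.span_image[symmetric])
    also have "\<dots> \<subseteq> tang_sum (\<gamma> ` S)" unfolding tang_sum_def using tang by (intro span_mono) auto
    finally show ?thesis using that by auto
  qed
  have gen: "generically (\<lambda>y. Q (\<gamma>' y))" if Q: "generically Q" for Q
  proof -
    obtain h where h: "h \<in> R" "h \<notin> P" "\<forall>y\<in>V. h y \<noteq> 0 \<longrightarrow> Q y" using Q unfolding generically_def by auto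
    show ?thesis unfolding generically_def
    proof (intro bexI[of _ "\<lambda>y. h (\<gamma>' y)"] conjI)
      show "(\<lambda>y. h (\<gamma>' y)) \<in> R" by (rule polynomial_functions_linear_compose[OF h(1) \<gamma>'])
      \<comment> \<open>Otherwise pulling back once more along \<open>\<gamma>\<close> would put
        \<open>h\<close> itself into \<open>P\<close>.\<close>
      show "(\<lambda>y. h (\<gamma>' y)) \<notin> P"
        using pull[of "\<lambda>y. h (\<gamma>' y)"] h(2) by (auto simp: inv)
      show "\<forall>y\<in>V. h (\<gamma>' y) \<noteq> 0 \<longrightarrow> Q (\<gamma>' y)" using h(3) V(2) by auto
    qed
  qed
  have gens: "generic_tuples m Q \<Longrightarrow> generic_tuples m (\<lambda>ys. Q (map \<gamma>' ys))" for m Q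
  proof (induction m arbitrary: Q)
    case (Suc m)
    from gen[OF Suc.prems[unfolded generic_tuples.simps]]
    show ?case unfolding generic_tuples.simps
    proof (rule generically_mono)
      fix y assume "generic_tuples m (\<lambda>xs. Q (\<gamma>' y # xs))"
      from Suc.IH[OF this] show "generic_tuples m (\<lambda>xs. Q (map \<gamma>' (y # xs)))" by simp
    qed
  qed simp
  have "generic_tuples k (\<lambda>ys. v \<in> tang_sum (set (map \<gamma>' ys)))"
    using gens v unfolding generic_vectors_def by blast
  then have "generic_tuples k (\<lambda>ys. \<gamma> v \<in> tang_sum (set ys))"
  proof (rule generic_tuples_mono)
    fix ys assume "v \<in> tang_sum (set (map \<gamma>' ys))"
    from tsum[OF this] show "\<gamma> v \<in> tang_sum (set ys)" by (simp add: image_image inv)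
  qed
  then show ?thesis unfolding generic_vectors_def by simp
qed

end

text \<open>After the first increment below \<open>d\<close> the increments decrease strictly until the maximum \<open>n\<close>
  is reached.\<close>

lemma strictly_concave_growth:
  fixes r :: "nat \<Rightarrow> nat"
  assumes d: "d \<ge> 1" and r0: "r 0 = 0" and le: "\<And>k. r k \<le> n"
    and mono: "\<And>k. r k \<le> r (Suc k)" and Suc_le: "\<And>k. r (Suc k) \<le> r k + d"
    and concave: "\<And>k. r (Suc (Suc k)) + r k \<le> 2 * r (Suc k)"
    and stall: "\<And>k. r (Suc (Suc k)) + r k = 2 * r (Suc k) \<Longrightarrow> r (Suc k) < r k + d \<Longrightarrow> r k = n"
  shows "m * d + d * d \<le> n \<Longrightarrow> r m = m * d" and "\<exists>k. k * d \<le> n + d * d - d \<and> r k = n"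
proof -
  have ex: "\<exists>k. r (Suc k) < r k + d"
  proof (rule ccontr)
    assume "\<not> ?thesis"
    then have "r (Suc k) = r k + d" for k using Suc_le[of k] by (metis leD le_neq_implies_less)
    then have "r k = k * d" for k by (induction k) (auto simp: r0)
    then have "Suc n * d \<le> n" using le[of "Suc n"] by simp
    then show False using d by (metis Suc_n_not_le_n le_trans mult.right_neutral mult_le_mono2)
  qed
  define k where "k = (LEAST k. r (Suc k) < r k + d)"
  have k: "r (Suc k) < r k + d" unfolding k_def by (rule LeastI_ex[OF ex])
  have "r (Suc j) = r j + d" if "j < k" for j
    using not_less_Least[of j "\<lambda>k. r (Suc k) < r k + d"] that Suc_le[of j] unfolding k_def by linarith
  then have rk: "r j = j * d" if "j \<le> k" for j using that by (induction j) (auto simp: r0)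
  have kd: "k * d \<le> n" using le[of k] rk[of k] by simp
  have full: "r (Suc j) = n" if "r j = n" for j using that mono[of j] le[of "Suc j"] by simp
  \<comment> \<open>The loss starts at one because the increment at \<open>k\<close> is already
    below \<open>d\<close>, and each further index costs at least one more.\<close>
  have step: "r (k + j) = n \<or> r (Suc (k + j)) + Suc j \<le> r (k + j) + d" for j
  proof (induction j)
    case 0
    then show ?case using k by simp
  next
    case (Suc j)
    show ?case
    proof (cases "r (k + j) = n")
      case True
      then show ?thesis using full by simp
    next
      case False
      then have IH: "r (Suc (k + j)) + Suc j \<le> r (k + j) + d" using Suc by simp
      have "r (Suc (Suc (k + j))) + r (k + j) \<noteq> 2 * r (Suc (k + j))"
        using stall[of "k + j"] False IH by linarith
      then have "r (Suc (Suc (k + j))) + r (k + j) < 2 * r (Suc (k + j))" using concave[of "k + j"] by simp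
      then show ?thesis using IH by simp
    qed
  qed
  have fin: "r (k + (d - 1)) = n"
  proof (rule ccontr)
    let ?j = "k + (d - 1)"
    assume ne: "r ?j \<noteq> n"
    \<comment> \<open>No increment is left at this index, and by concavity none at the next. The
      sequence therefore stalls below \<open>d\<close>, which forces the value
      \<open>n\<close>.\<close>
    then have "r (Suc ?j) + d \<le> r ?j + d" using step[of "d - 1"] d by simp
    then have e1: "r (Suc ?j) = r ?j" using mono[of ?j] by simp
    then have "r (Suc (Suc ?j)) = r (Suc ?j)" using concave[of ?j] mono[of "Suc ?j"] by simp
    then show False using stall[of ?j] e1 d ne by simp
  qed
  show "\<exists>k. k * d \<le> n + d * d - d \<and> r k = n"
  proof (intro exI[of _ "k + (d - 1)"] conjI fin)
    have "(k + (d - 1)) * d = k * d + (d * d - d)"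
      by (simp add: distrib_right diff_mult_distrib)
    moreover have "d \<le> d * d" using d by simp
    ultimately show "(k + (d - 1)) * d \<le> n + d * d - d" using kd by linarith
  qed
  assume m: "m * d + d * d \<le> n"
  have bound: "r (k + j) \<le> k * d + j * (d - 1)" if "j \<le> d" for j
    using that
  proof (induction j)
    case (Suc j)
    have "r (Suc (k + j)) \<le> r (k + j) + (d - 1)"
    proof (cases "r (k + j) = n")
      case True
      then show ?thesis using full by simp
    next
      case False
      then show ?thesis using step[of j] d by linarith
    qed
    then show ?case using Suc by simp
  qed (simp add: rk)
  have "n \<le> k * d + (d - 1) * (d - 1)" using bound[of "d - 1"] fin by simp
  \<comment> \<open>The bound \<open>d * d\<close> becomes, after division by \<open>d\<close>, the
    term subtracted in the range of nondefective \<open>m\<close>.\<close>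
  also have "(d - 1) * (d - 1) \<le> d * d" by (intro mult_le_mono) auto
  finally have "m * d \<le> k * d" using m by linarith
  then have "m \<le> k" using d by simp
  then show "r m = m * d" by (rule rk)
qed

section \<open>Joins and secant varieties\<close>

lemma subalg_compose:
  assumes "a \<in> subalg ((\<lambda>f z. f (s z)) ` F)"
  shows "\<exists>b\<in>subalg F. a = (\<lambda>z. b (s z))"
  using assms
proof induction
  case (const c)
  show ?case by (rule bexI[OF _ subalg.const]) simp
next
  case (gen f)
  then show ?case by (auto intro: subalg.gen)
next
  case (add p q)
  then obtain b b' where "b \<in> subalg F" "b' \<in> subalg F" "p = (\<lambda>z. b (s z))" "q = (\<lambda>z. b' (s z))" by blast
  then show ?case by (intro bexI[of _ "\<lambda>x. b x + b' x"]) (auto intro: subalg.add)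
next
  case (mult p q)
  then obtain b b' where "b \<in> subalg F" "b' \<in> subalg F" "p = (\<lambda>z. b (s z))" "q = (\<lambda>z. b' (s z))" by blast
  then show ?case by (intro bexI[of _ "\<lambda>x. b x * b' x"]) (auto intro: subalg.mult)
qed

text \<open>The coefficients of a relation between pulled back functions are pullbacks themselves,
  so the relation lifts along \<open>s\<close> to one modulo \<open>J\<close>.\<close>

lemma alg_indep_compose:
  assumes "alg_indep J fs" and "\<And>p. p \<in> subalg (set fs) \<Longrightarrow> (\<lambda>z. p (s z)) \<in> Q \<Longrightarrow> p \<in> J"
  shows "alg_indep Q (map (\<lambda>f z. f (s z)) fs)"
  using assms
proof (induction fs)
  case (Cons f fs)
  let ?A = "subalg (set fs)" and ?B = "subalg (set (map (\<lambda>f z. f (s z)) fs))"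
  have sub: "?A \<subseteq> subalg (set (f # fs))" by (rule subalg_mono) auto
  have "transc Q ?B (\<lambda>z. f (s z))" unfolding transc_def
  proof (intro ballI impI)
    fix q assume q: "q \<in> polys_over ?B" "(\<lambda>z. poly (q z) (f (s z))) \<in> Q"
    then obtain n where n: "\<And>z. degree (q z) \<le> n" unfolding polys_over_def by auto
    have "\<forall>i. \<exists>b\<in>?A. (\<lambda>z. coeff (q z) i) = (\<lambda>z. b (s z))"
      using q(1) subalg_compose[of _ s "set fs"] unfolding polys_over_def by simp
    then obtain b where b: "\<And>i. b i \<in> ?A" "\<And>i. (\<lambda>z. coeff (q z) i) = (\<lambda>z. b i (s z))"
      unfolding bchoice_iff choice_iff Bex_def by blast
    define u where "u x = (\<Sum>i\<le>n. monom (b i x) i)" for x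
    have cu: "coeff (u x) i = (if i \<le> n then b i x else 0)" for x i
      unfolding u_def coeff_sum coeff_monom by auto
    have uA: "u \<in> polys_over ?A"
    proof (rule polys_overI)
      show "degree (u x) \<le> n" for x by (rule degree_le) (simp add: cu)
      show "(\<lambda>x. coeff (u x) i) \<in> ?A" for i
        unfolding cu using b(1) by (cases "i \<le> n") (auto intro: subalg.const)
    qed
    have uq: "u (s z) = q z" for z
    proof (rule poly_eqI)
      fix i
      show "coeff (u (s z)) i = coeff (q z) i"
        using fun_cong[OF b(2)[of i], of z] n[of z] by (auto simp: cu coeff_eq_0)
    qed
    have "(\<lambda>x. poly (u x) (f x)) \<in> subalg (set (f # fs))"
      by (rule polys_over_eval[OF uA sub]) (auto intro: subalg.gen)
    moreover have "(\<lambda>z. poly (u (s z)) (f (s z))) \<in> Q" using q(2) by (simp add: uq)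
    ultimately have "(\<lambda>x. poly (u x) (f x)) \<in> J" using Cons.prems(2) by blast
    then have "u x = 0" for x using Cons.prems(1) uA unfolding alg_indep.simps transc_def by blast
    then show "\<forall>z. q z = 0" using uq by metis
  qed
  then show ?case using Cons sub by auto
qed simp

context complex_fd_space
begin

text \<open>Functions independent on the join pull back along addition to independent functions on
  the product of the two loci. Every tangent space of the product lies in the product of tangent
  spaces, and \<open>length_le_dim_tang\<close> applies there.\<close>

lemma alg_indep_join_le:
  assumes P1: "prime_R P1" and P2: "prime_R P2"
    and J: "\<And>p. p \<in> R \<Longrightarrow> \<forall>x\<in>zero_locus P1. \<forall>y\<in>zero_locus P2. p (x + y) = 0 \<Longrightarrow> p \<in> J"
    and fs: "set fs \<subseteq> R" "alg_indep J fs"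
    and y: "y1 \<in> zero_locus P1" "y2 \<in> zero_locus P2"
  shows "length fs \<le> dim (tang P1 y1) + dim (tang P2 y2)"
proof -
  interpret pr: finite_dimensional_vector_space_prod sc sc Basis Basis by unfold_locales
  interpret p: complex_fd_space pr.scale pr.Basis_pair
    unfolding complex_fd_space_def by (rule pr.p.finite_dimensional_vector_space_axioms)
  have P1R: "P1 \<subseteq> R" "P2 \<subseteq> R" using ideal_RD(1)[OF prime_RD(1)] P1 P2 by auto
  have sc: "pr.scale c z = (sc c (fst z), sc c (snd z))" for c z by (simp add: pr.scale_def)
  have lin: "Vector_Spaces.linear pr.scale sc fst" "Vector_Spaces.linear pr.scale sc snd"
    "Vector_Spaces.linear pr.scale sc (\<lambda>z. fst z + snd z)"
    by (unfold_locales; simp add: sc scale_right_distrib)+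
  note comp = polynomial_functions_linear_compose[OF _ lin(1)]
    polynomial_functions_linear_compose[OF _ lin(2)] polynomial_functions_linear_compose[OF _ lin(3)]
  have slice: "(\<lambda>x. q (x, b)) \<in> R \<and> (\<lambda>y. q (a, y)) \<in> R" if "q \<in> p.R" for q a b
    using that
  proof induction
    case (functional f)
    interpret f: Vector_Spaces.linear pr.scale "(*)" f by fact
    have f: "f (x, y) = f (x, 0) + f (0, y)" for x y by (simp add: f.add[symmetric])
    have l: "Vector_Spaces.linear sc (*) (\<lambda>x. f (x, 0))" "Vector_Spaces.linear sc (*) (\<lambda>y. f (0, y))"
      by (rule linear_functionalI; simp add: f.add[symmetric] f.scale[symmetric] sc)+
    show ?case
      by (subst (1 2) f) (intro conjI polynomial_functions.add polynomial_functions.const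
          polynomial_functions.functional[OF l(1)] polynomial_functions.functional[OF l(2)])
  qed (auto intro: polynomial_functions.const polynomial_functions.add polynomial_functions.mult)
  define Q where "Q = p.vanishing (zero_locus P1 \<times> zero_locus P2)"
  have Q: "q \<in> Q \<longleftrightarrow> q \<in> p.R \<and> (\<forall>x\<in>zero_locus P1. \<forall>y\<in>zero_locus P2. q (x, y) = 0)" for q
    unfolding Q_def p.vanishing_def by auto
  have mem: "h \<notin> P" if "h x \<noteq> 0" "x \<in> zero_locus P" for h P and x :: 'b
    using that by (auto simp: zero_locus_def)
  \<comment> \<open>Irreducibility of a product by slices: a common \<open>x\<close> makes two fixed
    slices nonzero, and then a common \<open>y\<close> makes both functions nonzero at
    \<open>(x, y)\<close>.\<close>
  have "p.prime_R Q" unfolding p.prime_R_def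
  proof (intro conjI ballI impI)
    show "p.ideal_R Q" unfolding Q_def by (rule p.ideal_R_vanishing)
    show "(\<lambda>x. 1) \<notin> Q" using y unfolding Q by auto
    fix q r assume q: "q \<in> p.R" and r: "r \<in> p.R" and qr: "(\<lambda>z. q z * r z) \<in> Q"
    show "q \<in> Q \<or> r \<in> Q"
    proof (rule ccontr)
      assume "\<not> ?thesis"
      then obtain a b c e where *: "a \<in> zero_locus P1" "b \<in> zero_locus P2" "q (a, b) \<noteq> 0"
        "c \<in> zero_locus P1" "e \<in> zero_locus P2" "r (c, e) \<noteq> 0" using q r unfolding Q by blast
      have "(\<lambda>x. q (x, b) * r (x, e)) \<notin> P1"
        using prime_RD(3)[OF P1, of "\<lambda>x. q (x, b)" "\<lambda>x. r (x, e)"] slice[OF q] slice[OF r]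
          mem[of "\<lambda>x. q (x, b)" a P1] mem[of "\<lambda>x. r (x, e)" c P1] * by auto
      then obtain x where x: "x \<in> zero_locus P1" "q (x, b) * r (x, e) \<noteq> 0"
        using prime_R_nullstellensatz[OF P1, of "\<lambda>x. q (x, b) * r (x, e)"]
          polynomial_functions.mult[OF conjunct1[OF slice[OF q]] conjunct1[OF slice[OF r]]] by blast
      have "(\<lambda>y. q (x, y) * r (x, y)) \<notin> P2"
        using prime_RD(3)[OF P2, of "\<lambda>y. q (x, y)" "\<lambda>y. r (x, y)"] slice[OF q] slice[OF r]
          mem[of "\<lambda>y. q (x, y)" b P2] mem[of "\<lambda>y. r (x, y)" e P2] * x by auto
      then obtain y where y: "y \<in> zero_locus P2" "q (x, y) * r (x, y) \<noteq> 0"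
        using prime_R_nullstellensatz[OF P2, of "\<lambda>y. q (x, y) * r (x, y)"]
          polynomial_functions.mult[OF conjunct2[OF slice[OF q]] conjunct2[OF slice[OF r]]] by blast
      then show False using qr x unfolding Q by auto
    qed
  qed
  moreover have "alg_indep Q (map (\<lambda>f z. f (fst z + snd z)) fs)"
  proof (rule alg_indep_compose[OF fs(2)])
    fix p assume "p \<in> subalg (set fs)" "(\<lambda>z. p (fst z + snd z)) \<in> Q"
    then show "p \<in> J" using J[of p] subalg_R[OF fs(1)] unfolding Q by auto
  qed
  moreover have "set (map (\<lambda>f z. f (fst z + snd z)) fs) \<subseteq> p.R" using fs(1) comp(3) by auto
  moreover have "(y1, y2) \<in> zero_locus Q" using y by (auto simp: zero_locus_def[of Q] Q)
  ultimately have "length (map (\<lambda>f z. f (fst z + snd z)) fs) \<le>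
      vector_space.dim pr.scale (p.tang Q (y1, y2))"
    by (intro p.length_le_dim_tang)
  also have "p.tang Q (y1, y2) \<subseteq> tang P1 y1 \<times> tang P2 y2"
  proof
    fix w assume w: "w \<in> p.tang Q (y1, y2)"
    have "D q y1 (fst w) = 0" if "q \<in> P1" for q
    proof -
      have "(\<lambda>z. q (fst z)) \<in> Q" unfolding Q using that P1R comp(1) by (auto simp: zero_locus_def)
      then have "p.D (\<lambda>z. q (fst z)) (y1, y2) w = 0" using w by (auto simp: p.tang_def)
      then show ?thesis unfolding p.D_def D_def by (simp add: sc)
    qed
    moreover have "D q y2 (snd w) = 0" if "q \<in> P2" for q
    proof -
      have "(\<lambda>z. q (snd z)) \<in> Q" unfolding Q using that P1R comp(2) by (auto simp: zero_locus_def)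
      then have "p.D (\<lambda>z. q (snd z)) (y1, y2) w = 0" using w by (auto simp: p.tang_def)
      then show ?thesis unfolding p.D_def D_def by (simp add: sc)
    qed
    ultimately show "w \<in> tang P1 y1 \<times> tang P2 y2" by (cases w) (auto simp: tang_def)
  qed
  then have "vector_space.dim pr.scale (p.tang Q (y1, y2)) \<le>
      vector_space.dim pr.scale (tang P1 y1 \<times> tang P2 y2)" by (rule pr.p.dim_subset)
  also have "\<dots> = dim (tang P1 y1) + dim (tang P2 y2)"
    by (intro pr.dim_Times subspace_tang P1R)
  finally show ?thesis by simp
qed

lemma R_on_line: "p \<in> R \<Longrightarrow> \<exists>q. \<forall>s. p (x + sc s v) = poly q s"
proof (induction rule: polynomial_functions.induct)
  case (const c)
  show ?case by (intro exI[of _ "[:c:]"]) simp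
next
  case (functional f)
  show ?case
    by (intro exI[of _ "[:f x, f v:]"]) (simp add: linear_functional_simps[OF functional])
next
  case (add p q)
  then obtain a b where "\<forall>s. p (x + sc s v) = poly a s" "\<forall>s. q (x + sc s v) = poly b s" by auto
  then show ?case by (intro exI[of _ "a + b"]) simp
next
  case (mult p q)
  then obtain a b where "\<forall>s. p (x + sc s v) = poly a s" "\<forall>s. q (x + sc s v) = poly b s" by auto
  then show ?case by (intro exI[of _ "a * b"]) simp
qed

text \<open>Two nonzero functions are restricted to a line joining points where they do not vanish;
  polynomials in one variable have no zero divisors.\<close>

lemma prime_R_zero: "prime_R {\<lambda>x. 0}"
  unfolding prime_R_def
proof (intro conjI ballI impI)
  show "ideal_R {\<lambda>x. 0}" unfolding ideal_R_def by (auto intro: polynomial_functions.const)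
  show "(\<lambda>x. 1) \<notin> {\<lambda>x::'b. 0::complex}" by (auto simp: fun_eq_iff)
  fix p q assume p: "p \<in> R" and q: "q \<in> R" and pq: "(\<lambda>x. p x * q x) \<in> {\<lambda>x. 0}"
  show "p \<in> {\<lambda>x. 0} \<or> q \<in> {\<lambda>x. 0}"
  proof (rule ccontr)
    assume "\<not> ?thesis"
    then obtain x y where xy: "p x \<noteq> 0" "q y \<noteq> 0" by (auto simp: fun_eq_iff)
    obtain a where a: "\<And>s. p (x + sc s (y - x)) = poly a s" using R_on_line[OF p] by metis
    obtain b where b: "\<And>s. q (x + sc s (y - x)) = poly b s" using R_on_line[OF q] by metis
    have "poly (a * b) s = 0" for s
    proof -
      have "p (x + sc s (y - x)) * q (x + sc s (y - x)) = 0"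
        using pq fun_cong[of "\<lambda>x. p x * q x" "\<lambda>x. 0"] by blast
      then show ?thesis unfolding a b by simp
    qed
    then have "a * b = 0" using poly_all_0_iff_0 by blast
    moreover have "a \<noteq> 0" using a[of 0] xy by auto
    moreover have "b \<noteq> 0" using b[of 1] xy by auto
    ultimately show False by simp
  qed
qed

text \<open>A nonzero \<open>P\<close> would allow the zero ideal to be added below a chain of
  length \<open>card Basis\<close>, giving more independent functions than the tangent space of the
  whole space admits.\<close>

lemma zero_locus_full:
  assumes P: "prime_R P" and fs: "set fs \<subseteq> R" "alg_indep P fs" "length fs = card Basis"
  shows "zero_locus P = UNIV"
proof (rule ccontr)
  assume "zero_locus P \<noteq> UNIV"
  then have "P \<noteq> {\<lambda>x. 0}" by (auto simp: zero_locus_def)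
  moreover have "(\<lambda>x. 0) \<in> P" using ideal_RD(2)[OF prime_RD(1)[OF P]] .
  ultimately have sub: "{\<lambda>x. 0} \<subset> P" by auto
  let ?n = "length fs"
  obtain C where C: "\<forall>i\<le>?n. prime_R (C i)" "\<forall>i<?n. C (Suc i) \<subset> C i" "C ?n = P"
    using chain_of_alg_indep[OF P fs(1,2)] by blast
  define C' where "C' = C(Suc ?n := {\<lambda>x. 0})"
  have "\<exists>gs. length gs = Suc ?n \<and> set gs \<subseteq> R \<and> alg_indep (C' (Suc ?n)) gs"
  proof (rule alg_indep_of_chain)
    show "prime_R (C' i)" if "i \<le> Suc ?n" for i
      using that C(1) prime_R_zero by (cases "i = Suc ?n") (auto simp: C'_def)
    show "C' (Suc i) \<subset> C' i" if "i < Suc ?n" for i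
      using that C(2,3) sub by (cases "i = ?n") (auto simp: C'_def)
  qed
  then obtain gs where gs: "length gs = Suc ?n" "set gs \<subseteq> R" "alg_indep {\<lambda>x. 0} gs"
    by (auto simp: C'_def)
  have "length gs \<le> dim (tang {\<lambda>x. 0} 0)"
    by (rule length_le_dim_tang[OF prime_R_zero gs(2,3)]) (simp add: zero_locus_def)
  also have "\<dots> \<le> card Basis" using dim_subset_UNIV unfolding dimension_def by auto
  finally show False using gs(1) fs(3) by simp
qed

lemma closure_of_zariski: "zariski sc closure_of S = zero_locus (vanishing S)"
proof
  have "closedin (zariski sc) (zero_locus (vanishing S))"
    by (rule closedin_zero_locus) (auto simp: vanishing_def)
  then show "zariski sc closure_of S \<subseteq> zero_locus (vanishing S)"
    by (intro closure_of_minimal) (auto simp: vanishing_def zero_locus_def)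
  have "closedin (zariski sc) (zariski sc closure_of S)" by simp
  moreover have "S \<subseteq> zariski sc closure_of S" by (rule closure_of_subset) simp
  ultimately show "zero_locus (vanishing S) \<subseteq> zariski sc closure_of S"
    unfolding closedin_zariski by (fastforce simp: vanishing_def zero_locus_def)
qed

end

context generic_tangents
begin

definition secant_ideal :: "nat \<Rightarrow> ('b \<Rightarrow> complex) set" where
  "secant_ideal m = vanishing (sum_list ` tuples m)"

lemma secant_variety_eq: "secant_variety sc m V = zero_locus (secant_ideal m)"
proof -
  have "{\<Sum>i<m. x i | x. \<forall>i<m. x i \<in> V} = sum_list ` tuples m"
  proof
    show "{\<Sum>i<m. x i | x. \<forall>i<m. x i \<in> V} \<subseteq> sum_list ` tuples m"
    proof
      fix z assume "z \<in> {\<Sum>i<m. x i | x. \<forall>i<m. x i \<in> V}"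
      then obtain x where "z = (\<Sum>i<m. x i)" "\<forall>i<m. x i \<in> V" by auto
      then show "z \<in> sum_list ` tuples m"
        by (intro image_eqI[of _ _ "map x [0..<m]"])
           (auto simp: tuples_def sum_list_sum_nth atLeast0LessThan)
    qed
    show "sum_list ` tuples m \<subseteq> {\<Sum>i<m. x i | x. \<forall>i<m. x i \<in> V}"
    proof
      fix z assume "z \<in> sum_list ` tuples m"
      then obtain xs where "z = sum_list xs" "length xs = m" "set xs \<subseteq> V" by (auto simp: tuples_def)
      then show "z \<in> {\<Sum>i<m. x i | x. \<forall>i<m. x i \<in> V}"
        by (intro CollectI exI[of _ "(!) xs"]) (auto simp: sum_list_sum_nth atLeast0LessThan)
    qed
  qed
  then show ?thesis unfolding secant_variety_def secant_ideal_def closure_of_zariski by simp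
qed

lemma R_translate: "p \<in> R \<Longrightarrow> (\<lambda>x. p (a + x + b)) \<in> R"
proof (induction rule: polynomial_functions.induct)
  case (functional f)
  have "(\<lambda>x. f a + f x + f b) \<in> R"
    by (intro polynomial_functions.add polynomial_functions.const polynomial_functions.functional functional)
  then show ?case by (simp add: linear_functional_simps[OF functional])
qed (auto intro: polynomial_functions.const polynomial_functions.add polynomial_functions.mult)

lemma generic_sum_nonzero:
  assumes h: "h \<in> R" "h \<notin> secant_ideal m"
  shows "generic_tuples m (\<lambda>xs. h (sum_list xs) \<noteq> 0)"
proof -
  obtain zs where zs: "zs \<in> tuples m" "h (sum_list zs) \<noteq> 0"
    using h unfolding secant_ideal_def vanishing_def by auto
  show ?thesis
  proof (rule generic_tuplesI[of zs])
    fix xs z ys assume z: "xs @ z # ys \<in> tuples m" "h (sum_list (xs @ z # ys)) \<noteq> 0"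
    have "generically (\<lambda>w. h (sum_list xs + w + sum_list ys) \<noteq> 0)"
      using generically_nonzero[OF R_translate[OF h(1)], of z "sum_list xs" "sum_list ys"] z
      by (simp add: tuples_def add.assoc)
    then show "generically (\<lambda>w. h (sum_list (xs @ w # ys)) \<noteq> 0)" by (simp add: add.assoc)
  qed (use zs in auto)
qed

text \<open>Two functions that are each nonzero at some sum are both nonzero at one generic
  sum.\<close>

lemma prime_secant_ideal: "prime_R (secant_ideal m)"
  unfolding prime_R_def
proof (intro conjI ballI impI)
  show "ideal_R (secant_ideal m)" unfolding secant_ideal_def by (rule ideal_R_vanishing)
  obtain xs where "xs \<in> tuples m"
    using generic_tuples_ex[OF generic_tuples_always[of m "\<lambda>_. True"]] by auto
  then show "(\<lambda>x. 1) \<notin> secant_ideal m" unfolding secant_ideal_def vanishing_def by auto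
  fix p q assume pq: "p \<in> R" "q \<in> R" "(\<lambda>x. p x * q x) \<in> secant_ideal m"
  show "p \<in> secant_ideal m \<or> q \<in> secant_ideal m"
  proof (rule ccontr)
    assume "\<not> ?thesis"
    then have "generic_tuples m (\<lambda>xs. p (sum_list xs) \<noteq> 0 \<and> q (sum_list xs) \<noteq> 0)"
      using pq by (intro generic_tuples_conj generic_sum_nonzero) auto
    then obtain xs where "xs \<in> tuples m" "p (sum_list xs) \<noteq> 0" "q (sum_list xs) \<noteq> 0"
      using generic_tuples_ex by blast
    then show False using pq(3) unfolding secant_ideal_def vanishing_def by auto
  qed
qed

text \<open>One summand varies in the variety while the others stay fixed: the translate of
  \<open>p\<close> lies in \<open>P\<close>, so its derivative along a tangent vector
  vanishes.\<close>

lemma tang_sum_subset_secant: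
  assumes xs: "xs \<in> tuples m"
  shows "tang_sum (set xs) \<subseteq> tang (secant_ideal m) (sum_list xs)"
proof -
  have IR: "secant_ideal m \<subseteq> R" unfolding secant_ideal_def vanishing_def by auto
  have "tang P x \<subseteq> tang (secant_ideal m) (sum_list xs)" if x: "x \<in> set xs" for x
  proof
    fix v assume v: "v \<in> tang P x"
    obtain as bs where ab: "xs = as @ x # bs" using split_list[OF x] by blast
    show "v \<in> tang (secant_ideal m) (sum_list xs)" unfolding tang_def
    proof (intro CollectI ballI)
      fix p assume p: "p \<in> secant_ideal m"
      let ?q = "\<lambda>w. p (sum_list as + w + sum_list bs)"
      have "?q w = 0" if "w \<in> V" for w
      proof -
        have "as @ w # bs \<in> tuples m" using xs that ab by (auto simp: tuples_def)
        then have "p (sum_list (as @ w # bs)) = 0" using p unfolding secant_ideal_def vanishing_def by auto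
        then show ?thesis by (simp add: add.assoc)
      qed
      moreover have "?q \<in> R" using R_translate IR p by blast
      ultimately have "?q \<in> P" using vanishing_zero_locus[OF P] unfolding vanishing_def by auto
      then have "D ?q x v = 0" using v by (auto simp: tang_def)
      then show "D p (sum_list xs) v = 0" unfolding D_def ab by (simp add: algebra_simps)
    qed
  qed
  then show ?thesis unfolding tang_sum_def by (intro span_minimal subspace_tang[OF IR]) auto
qed

lemma secant_join:
  assumes "p \<in> R" "\<forall>x\<in>V. \<forall>y\<in>zero_locus (secant_ideal m). p (x + y) = 0"
  shows "p \<in> secant_ideal (Suc m)"
proof -
  have "p (sum_list xs) = 0" if "xs \<in> tuples (Suc m)" for xs
  proof -
    from that obtain x ys where "xs = x # ys" by (cases xs) (auto simp: tuples_def)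
    with that have xs: "xs = x # ys" "x \<in> V" "ys \<in> tuples m" by (auto simp: tuples_def)
    then have "sum_list ys \<in> zero_locus (secant_ideal m)"
      unfolding zero_locus_def secant_ideal_def vanishing_def by auto
    then show ?thesis using xs assms(2) by simp
  qed
  then show ?thesis unfolding secant_ideal_def vanishing_def using assms(1) by auto
qed

text \<open>A tuple generic enough to be totally generic and to have a sum where the tangent
  dimension is \<open>e\<close> yields \<open>rk m \<le> e\<close>. The independent list and the
  point \<open>y\<close> are both provided, since the join estimate takes the list from one secant
  variety and the point from the preceding one.\<close>

lemma secant_dimension:
  obtains e fs y where "variety_dim sc (secant_variety sc m V) = enat e" "rk m \<le> e"
    "set fs \<subseteq> R" "alg_indep (secant_ideal m) fs" "length fs = e"
    "y \<in> zero_locus (secant_ideal m)" "dim (tang (secant_ideal m) y) = e"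
proof -
  let ?I = "secant_ideal m"
  obtain e h fs where e: "variety_dim sc (zero_locus ?I) = enat e" "h \<in> R" "h \<notin> ?I"
    "\<And>y. y \<in> zero_locus ?I \<Longrightarrow> h y \<noteq> 0 \<Longrightarrow> dim (tang ?I y) = e"
    "set fs \<subseteq> R" "alg_indep ?I fs" "length fs = e"
    using variety_dim_tang[OF prime_secant_ideal] by metis
  have "generic_tuples m (\<lambda>xs. h (sum_list xs) \<noteq> 0 \<and> totally_generic m xs)"
    by (intro generic_tuples_conj generic_sum_nonzero e(2,3) generic_totally_generic)
  then obtain xs where xs: "xs \<in> tuples m" "h (sum_list xs) \<noteq> 0" "totally_generic m xs"
    using generic_tuples_ex by blast
  have y: "sum_list xs \<in> zero_locus ?I"
    using xs(1) unfolding zero_locus_def secant_ideal_def vanishing_def by auto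
  have "(!) xs ` {..<m} = set xs" using xs(1) by (auto simp: tuples_def set_conv_nth)
  then have "dim (tang_sum (set xs)) = rk m"
    using xs(3) unfolding totally_generic_def by (metis card_lessThan order_refl)
  then have "rk m \<le> e"
    using dim_subset[OF tang_sum_subset_secant[OF xs(1)]] e(4)[OF y xs(2)] by simp
  then show thesis using that[OF _ _ e(5-7) y e(4)[OF y xs(2)]] e(1) unfolding secant_variety_eq by simp
qed

lemma secant_dimension_le: "variety_dim sc (secant_variety sc m V) \<le> enat (m * d)"
proof (induction m)
  case 0
  obtain e fs y where e: "variety_dim sc (secant_variety sc 0 V) = enat e"
    "y \<in> zero_locus (secant_ideal 0)" "dim (tang (secant_ideal 0) y) = e"
    by (rule secant_dimension)
  have "tang (secant_ideal 0) y \<subseteq> {0}"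
  proof
    fix v assume v: "v \<in> tang (secant_ideal 0) y"
    have "coord b \<in> secant_ideal 0" for b
      unfolding secant_ideal_def vanishing_def tuples_def by (auto simp: coord_in_R coord_simps)
    then have "D (coord b) y v = 0" for b using v by (auto simp: tang_def)
    then show "v \<in> {0}" by (auto intro!: coord_eqI simp: D_functional[OF linear_coord] coord_simps)
  qed
  then show ?case using e dim_eq_0 by (metis enat_ord_simps(1) le_numeral_extra(3) mult_zero_left)
next
  case (Suc m)
  obtain e' fs y' where e': "variety_dim sc (secant_variety sc (Suc m) V) = enat e'"
    "set fs \<subseteq> R" "alg_indep (secant_ideal (Suc m)) fs" "length fs = e'"
    by (rule secant_dimension)
  obtain e gs y where e: "variety_dim sc (secant_variety sc m V) = enat e"
    "y \<in> zero_locus (secant_ideal m)" "dim (tang (secant_ideal m) y) = e"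
    by (rule secant_dimension)
  obtain z where "z \<in> regular" by (rule regular_point)
  then have z: "z \<in> V" "dim (tang P z) = d" by (auto simp: regular_def)
  have "length fs \<le> dim (tang P z) + dim (tang (secant_ideal m) y)"
    by (rule alg_indep_join_le[OF P prime_secant_ideal secant_join e'(2,3) z(1) e(2)])
  then show ?case using Suc e e' z by simp
qed

lemma secant_full_iff:
  "secant_variety sc m V = UNIV \<longleftrightarrow> variety_dim sc (secant_variety sc m V) = enat (card Basis)"
proof -
  obtain e fs y where e: "variety_dim sc (secant_variety sc m V) = enat e"
    "set fs \<subseteq> R" "alg_indep (secant_ideal m) fs" "length fs = e"
    "y \<in> zero_locus (secant_ideal m)" "dim (tang (secant_ideal m) y) = e"
    by (rule secant_dimension)
  show ?thesis
  proof
    assume full: "secant_variety sc m V = UNIV"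
    then have "secant_ideal m = vanishing UNIV"
      using vanishing_zero_locus[OF prime_secant_ideal, of m] unfolding secant_variety_eq by simp
    then have "tang (secant_ideal m) y = UNIV"
      unfolding tang_def vanishing_def by (auto simp: fun_eq_iff[symmetric] D_const)
    then show "variety_dim sc (secant_variety sc m V) = enat (card Basis)" using e by simp
  next
    assume "variety_dim sc (secant_variety sc m V) = enat (card Basis)"
    then show "secant_variety sc m V = UNIV"
      using zero_locus_full[OF prime_secant_ideal e(2,3)] e unfolding secant_variety_eq by simp
  qed
qed

end

section \<open>Invariant cones in irreducible modules\<close>

theorem theorem1p1:
  fixes G :: "('g, 'x) monoid_scheme"
    and sc :: "complex \<Rightarrow> 'b::ab_group_add \<Rightarrow> 'b"
    and B :: "'b set"
    and \<phi> :: "'g \<Rightarrow> 'b \<Rightarrow> 'b"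
    and V :: "'b set"
    and N :: nat
  assumes "Group.group G"
    and "finite_dimensional_vector_space sc B"
    and "irreducible_module G sc \<phi>"
    and "affine_cone sc V"
    and "irreducible_variety sc V"
    and "variety_dim sc V = enat N"
    and "N \<ge> 1"
    and "invariant_under G \<phi> V"
  shows "(\<forall>m::nat. m \<ge> 1 \<and> real m \<le> real (vector_space.dim sc (UNIV :: 'b set)) / real N - real N \<longrightarrow>
            nondefective sc m V) \<and>
         (\<exists>m. secant_variety sc m V = UNIV) \<and>
         real (vector_space.dim sc (UNIV :: 'b set)) / real N \<le> real (generic_rank sc V) \<and>
         real (generic_rank sc V) \<le> real (vector_space.dim sc (UNIV :: 'b set)) / real N + real N"
proof -
  interpret complex_fd_space sc B
    unfolding complex_fd_space_def by (rule assms(2))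
  define n where "n = card B"
  have n: "dim UNIV = n" unfolding n_def by simp
  define P where "P = vanishing V"
  have P: "prime_R P" and V: "V = zero_locus P"
    using assms(5) zero_locus_vanishing unfolding P_def irreducible_variety_iff by auto
  obtain reg where reg: "reg \<in> R" "reg \<notin> P" "\<And>y. y \<in> zero_locus P \<Longrightarrow> N \<le> dim (tang P y)"
    "\<And>y. y \<in> zero_locus P \<Longrightarrow> reg y \<noteq> 0 \<Longrightarrow> dim (tang P y) = N"
  proof -
    obtain d h fs where d: "variety_dim sc (zero_locus P) = enat d" "h \<in> R" "h \<notin> P"
      "\<And>y. y \<in> zero_locus P \<Longrightarrow> d \<le> dim (tang P y)"
      "\<And>y. y \<in> zero_locus P \<Longrightarrow> h y \<noteq> 0 \<Longrightarrow> dim (tang P y) = d"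
      using variety_dim_tang[OF P] by metis
    have "d = N" using d(1) assms(6) V by simp
    then show thesis using that d by blast
  qed
  interpret g: generic_tangents sc B P N reg
    by unfold_locales (use P reg in auto)
  have linG: "linear_action G sc \<phi>" using assms(3) unfolding irreducible_module_def by blast
  interpret act: group_action G UNIV \<phi> using linG unfolding linear_action_def by blast
  interpret G: Group.group G by (rule assms(1))
  have lin: "Vector_Spaces.linear sc sc (\<phi> x)" if "x \<in> carrier G" for x
    using linG that unfolding linear_action_def by blast
  have inv: "\<phi> (inv\<^bsub>G\<^esub> x) (\<phi> x v) = v" "\<phi> x (\<phi> (inv\<^bsub>G\<^esub> x) v) = v" if "x \<in> carrier G" for x v
    using act.orbit_sym_aux[of x v "\<phi> x v"] act.orbit_sym_aux[of "inv\<^bsub>G\<^esub> x" v "\<phi> (inv\<^bsub>G\<^esub> x) v"]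
      that by auto
  \<comment> \<open>Here irreducibility of the module enters: generic vectors form an invariant
    subspace that a stall makes nonzero, hence everything.\<close>
  have stall: "g.rk k = n"
    if eq: "g.rk (Suc (Suc k)) + g.rk k = 2 * g.rk (Suc k)" and lt: "g.rk (Suc k) < g.rk k + N" for k
  proof -
    have "invariant_under G \<phi> (g.generic_vectors k)" unfolding invariant_under_def
    proof (intro ballI)
      fix x w assume x: "x \<in> carrier G" and w: "w \<in> g.generic_vectors k"
      have "\<phi> y v \<in> zero_locus P" if "y \<in> carrier G" "v \<in> zero_locus P" for y v
        using assms(8) that V unfolding invariant_under_def by auto
      then show "\<phi> x w \<in> g.generic_vectors k"
        using x by (intro g.generic_vectors_invariant[OF lin lin[OF G.inv_closed] inv(1) inv(2) _ _ w]) auto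
    qed
    then have "g.generic_vectors k = {0} \<or> g.generic_vectors k = UNIV"
      using assms(3) g.subspace_generic_vectors unfolding irreducible_module_def by blast
    then show ?thesis using g.generic_vectors_nontrivial[OF eq lt] g.generic_vectors_full n_def by blast
  qed
  note growth = strictly_concave_growth[of N g.rk n, OF assms(7) g.rk_0 g.rk_le[folded n_def]
      g.rk_mono g.rk_Suc_le g.rk_concave stall]
  have N: "real N > 0" using assms(7) by simp
  \<comment> \<open>Nondefectivity will be the collapse of these two bounds when
    \<open>g.rk m = m * N\<close>.\<close>
  have sec: "\<exists>e. variety_dim sc (secant_variety sc m V) = enat e \<and> g.rk m \<le> e \<and> e \<le> m * N" for m
  proof -
    obtain e where "variety_dim sc (secant_variety sc m (zero_locus P)) = enat e" "g.rk m \<le> e"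
      by (rule g.secant_dimension)
    then show ?thesis using g.secant_dimension_le[of m] unfolding V by auto
  qed
  have full: "secant_variety sc m V = UNIV \<longleftrightarrow> variety_dim sc (secant_variety sc m V) = enat n" for m
    using g.secant_full_iff unfolding V n_def .
  have nondef: "nondefective sc m V" if "real m \<le> real n / real N - real N" for m
  proof -
    have "real m * real N + real N * real N \<le> real n" using that N by (simp add: field_simps)
    then have le: "m * N + N * N \<le> n" by (metis of_nat_add of_nat_le_iff of_nat_mult)
    then have "g.rk m = m * N" using growth(1) by simp
    then have "variety_dim sc (secant_variety sc m V) = enat (m * N)" using sec[of m] by auto
    moreover have "min (enat (m * N)) (enat n) = enat (m * N)" using le by simp
    ultimately show ?thesis unfolding nondefective_def assms(6) n by simp
  qed
  obtain k where k: "k * N \<le> n + N * N - N" "g.rk k = n" using growth(2) by blast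
  have ex: "secant_variety sc k V = UNIV"
  proof -
    obtain e fs y where e: "variety_dim sc (secant_variety sc k (zero_locus P)) = enat e" "g.rk k \<le> e"
      "dim (tang (g.secant_ideal k) y) = e" by (rule g.secant_dimension)
    have "e \<le> n" using e(3) dim_subset_UNIV unfolding dimension_def n_def by auto
    then show ?thesis unfolding full using e k V by simp
  qed
  define m where "m = generic_rank sc V"
  have m: "secant_variety sc m V = UNIV" unfolding m_def generic_rank_def
    by (rule LeastI[of "\<lambda>m. secant_variety sc m V = UNIV", OF ex])
  have "m \<le> k" unfolding m_def generic_rank_def
    by (rule Least_le[of "\<lambda>m. secant_variety sc m V = UNIV", OF ex])
  then have "m * N \<le> n + N * N" using k(1) mult_le_mono1[of m k N] by linarith
  then have "real m * real N \<le> real n + real N * real N" by (metis of_nat_add of_nat_le_iff of_nat_mult)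
  then have upper: "real m \<le> real n / real N + real N" using N by (simp add: field_simps)
  \<comment> \<open>A dimension count: a secant variety filling the space has dimension
    \<open>n\<close>.\<close>
  have "n \<le> m * N" using sec[of m] m unfolding full by auto
  then have "real n \<le> real m * real N" by (metis of_nat_le_iff of_nat_mult)
  then have lower: "real n / real N \<le> real m" using N by (simp add: field_simps)
  show ?thesis unfolding n using nondef ex upper lower unfolding m_def by blast
qed

end
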